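(* Let $p\in(0,1)$, let $\{X_k\}_{k\ge1}$ be the $\{+1,-1\}$-valued Markov chain with parameter $p$ defined in the context, let $\{a_k\}_{k\ge1}$ be a deterministic real sequence, and let $S_0:=0$, $S_n:=\sum_{k=1}^n a_kX_k$, $A_n:=\sum_{k=1}^n a_k^2$. Suppose that $A_n\to\infty$ as $n\to\infty$ and that $a_n^2=O(A_n^{1-\delta})$ as $n\to\infty$ for some $\delta\in(0,1]$. Assume in addition that either $\sum_{k=1}^\infty(a_{k+1}-a_k)^2<+\infty$, or $\{a_k\}_{k\ge1}$ is a monotone sequence. Then, without changing the distribution of the process $\{S_n:n\ge0\}$, one can redefine $\{S_n:n\ge0\}$ on a richer probability space on which a standard Brownian motion $\{B(t):t\ge0\}$ is defined such that $$S_n-\sqrt{\frac{p}{1-p}}\,B(A_n)=o\bigl(A_n^{\frac12-\frac{\delta}{16}}\bigr)\quad\text{as } n\to\infty,\ \text{a.s.}$$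
   Context: For $p\in(0,1)$, $\{X_k\}_{k\ge1}$ is the $\{+1,-1\}$-valued Markov chain with $P(X_1=+1)=P(X_1=-1)=\tfrac12$ and, for $k\ge1$, $P(X_{k+1}=+1\mid X_k=+1)=P(X_{k+1}=-1\mid X_k=-1)=p$ and $P(X_{k+1}=-1\mid X_k=+1)=P(X_{k+1}=+1\mid X_k=-1)=1-p$. "Redefining $\{S_n\}$ on a richer probability space without changing its distribution" means: there exists a probability space carrying both a process with the same distribution as $\{S_n:n\ge0\}$ (again denoted $\{S_n\}$) and a standard Brownian motion $\{B(t)\}$ such that the stated relation holds. *)

theory Defs
  imports "HOL-Probability.Probability" "HOL-Library.Landau_Symbols"
begin

text \<open>
  The chain is indexed by \<open>k \<ge> 1\<close>; the value \<open>X 0\<close> is unconstrained and never used.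
  The guard in the Markov property excludes conditioning on null events, where
  \<^const>\<open>cond_prob\<close> is \<open>0\<close> by convention. Time homogeneity is contained in the four
  transition probabilities.
\<close>

definition sign_markov_chain :: "'a measure \<Rightarrow> real \<Rightarrow> (nat \<Rightarrow> 'a \<Rightarrow> real) \<Rightarrow> bool" where
  "sign_markov_chain M p X \<longleftrightarrow>
     prob_space M \<and>
     (\<forall>k\<ge>1. X k \<in> borel_measurable M) \<and>
     (\<forall>k\<ge>1. \<forall>\<omega>\<in>space M. X k \<omega> \<in> {1, -1}) \<and>
     (\<forall>k\<ge>1. \<forall>x :: nat \<Rightarrow> real. \<forall>y.
        \<P>(\<omega> in M. \<forall>j\<in>{1..k}. X j \<omega> = x j) \<noteq> 0 \<longrightarrow>
        \<P>(\<omega> in M. X (Suc k) \<omega> = y \<bar> \<forall>j\<in>{1..k}. X j \<omega> = x j) =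
        \<P>(\<omega> in M. X (Suc k) \<omega> = y \<bar> X k \<omega> = x k)) \<and>
     \<P>(\<omega> in M. X 1 \<omega> = 1) = 1 / 2 \<and>
     \<P>(\<omega> in M. X 1 \<omega> = -1) = 1 / 2 \<and>
     (\<forall>k\<ge>1.
        \<P>(\<omega> in M. X (Suc k) \<omega> = 1 \<bar> X k \<omega> = 1) = p \<and>
        \<P>(\<omega> in M. X (Suc k) \<omega> = -1 \<bar> X k \<omega> = -1) = p \<and>
        \<P>(\<omega> in M. X (Suc k) \<omega> = -1 \<bar> X k \<omega> = 1) = 1 - p \<and>
        \<P>(\<omega> in M. X (Suc k) \<omega> = 1 \<bar> X k \<omega> = -1) = 1 - p)"

definition weighted_sum :: "(nat \<Rightarrow> real) \<Rightarrow> (nat \<Rightarrow> 'a \<Rightarrow> real) \<Rightarrow> nat \<Rightarrow> 'a \<Rightarrow> real" where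
  "weighted_sum a X n \<omega> = (\<Sum>k=1..n. a k * X k \<omega>)"

definition square_sum :: "(nat \<Rightarrow> real) \<Rightarrow> nat \<Rightarrow> real" where
  "square_sum a n = (\<Sum>k=1..n. (a k)\<^sup>2)"

text \<open>
  Only times \<open>t \<ge> 0\<close> matter. Note that \<^const>\<open>normal_density\<close> takes the standard deviation.
\<close>

definition standard_brownian_motion :: "'b measure \<Rightarrow> (real \<Rightarrow> 'b \<Rightarrow> real) \<Rightarrow> bool" where
  "standard_brownian_motion N B \<longleftrightarrow>
     prob_space N \<and>
     (\<forall>t\<ge>0. B t \<in> borel_measurable N) \<and>
     (\<forall>\<omega>\<in>space N. B 0 \<omega> = 0) \<and>
     (\<forall>\<omega>\<in>space N. continuous_on {0..} (\<lambda>t. B t \<omega>)) \<and>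
     (\<forall>s t. 0 \<le> s \<and> s < t \<longrightarrow>
        distributed N lborel (\<lambda>\<omega>. B t \<omega> - B s \<omega>) (normal_density 0 (sqrt (t - s)))) \<and>
     (\<forall>(n::nat) (t :: nat \<Rightarrow> real).
        0 \<le> t 0 \<and> (\<forall>i<n. t i < t (Suc i)) \<longrightarrow>
        prob_space.indep_vars N (\<lambda>_. borel) (\<lambda>i \<omega>. B (t (Suc i)) \<omega> - B (t i) \<omega>) {..<n})"

text \<open>
  Equality in law of whole real-valued processes indexed by \<open>nat\<close>, i.e. of the induced measures on
  the product sigma-algebra. Measurability is required because \<^const>\<open>distr\<close> is meaningless
  for non-measurable maps.
\<close>

definition same_process_law ::
  "'b measure \<Rightarrow> (nat \<Rightarrow> 'b \<Rightarrow> real) \<Rightarrow> 'a measure \<Rightarrow> (nat \<Rightarrow> 'a \<Rightarrow> real) \<Rightarrow> bool" where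
  "same_process_law N S' M S \<longleftrightarrow>
     (\<forall>n. S' n \<in> borel_measurable N) \<and>
     (\<forall>n. S n \<in> borel_measurable M) \<and>
     distr N (\<Pi>\<^sub>M n\<in>(UNIV::nat set). borel) (\<lambda>\<omega> n. S' n \<omega>) =
     distr M (\<Pi>\<^sub>M n\<in>(UNIV::nat set). borel) (\<lambda>\<omega> n. S n \<omega>)"

end

theory Submission
  imports Defs "HOL-Real_Asymp.Real_Asymp"
begin

text \<open>
  With \<open>\<rho> = 2p - 1\<close> the variables \<open>d\<^sub>k = (X\<^sub>k - \<rho> X\<^sub>k\<^sub>-\<^sub>1) / (1 - \<rho>)\<close> are bounded martingale differences whose
  conditional variance is the constant \<open>p / (1 - p)\<close>, and summation by parts shows that
  \<open>S\<^sub>n\<close> differs from \<open>\<Sum> a\<^sub>k d\<^sub>k\<close> by \<open>O(|a\<^sub>n|)\<close> and a multiple of \<open>\<Sum> (a\<^sub>k\<^sub>+\<^sub>1 - a\<^sub>k) X\<^sub>k\<close>, which is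
  harmless under either regularity assumption.

  Instead of a Skorokhod embedding, the chain is built block by block from a given Brownian motion.
  The blocks are chosen such that \<open>A powr \<beta>\<close> grows by about one on each of them, for a small multiple \<open>\<beta>\<close>
  of \<open>\<delta>\<close>. In each block the path of signs is a function of the Brownian increment over the block and of
  the last sign before it, namely the one for which the martingale sum is the quantile transform of the increment.
  Lindeberg's method bounds the Wasserstein distance between the two, hence the expected coupling error
  of the block; these errors are summable after normalisation. Between the block ends, both processes are
  controlled by exponential maximal inequalities and the Borel-Cantelli lemma.
\<close>

section \<open>Independence from characteristic functions\<close>

text \<open>The signs are read off from the Brownian motion, so no conditional laws have to be glued
  together: block increments are independent, and for each fixed last sign the transform of an
  increment has the law of the next stretch of the chain. The last sign is random but has only two
  values; estimates over a block are made for both and added.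

  Since the conditional variance does not depend on the present sign, the clock \<open>A\<close> is
  deterministic, block ends are fixed times, and no random time has to be compared with its mean.

  The exponent balances two effects. With blocks of length about \<open>A powr (1 - \<beta>)\<close>
  and a target exponent \<open>1/2 - c * \<delta>\<close>, the oscillation inside a block requires
  \<open>\<beta> > 2 * c * \<delta>\<close>, while Lindeberg's error, balanced against the smoothing
  scale and summed over the blocks, requires
  \<open>2 * \<beta> + 3 * c * \<delta> < \<delta> / 2\<close>. Together they allow every
  \<open>c < 1/14\<close>, in particular \<open>1/16\<close>.\<close>

lemma (in prob_space) weighted_law_eq:
  fixes w D :: "'a \<Rightarrow> real"
  assumes [measurable]: "w \<in> borel_measurable M" "D \<in> borel_measurable M" "A \<in> sets borel"
    and w: "\<And>\<omega>. 0 \<le> w \<omega>" "\<And>\<omega>. w \<omega> \<le> 2"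
    and eq: "\<And>t. (CLINT \<omega>|M. w \<omega> *\<^sub>R iexp (t * D \<omega>)) =
                (LINT \<omega>|M. w \<omega>) *\<^sub>R (CLINT \<omega>|M. iexp (t * D \<omega>))"
  shows "(LINT \<omega>|M. w \<omega> * indicator A (D \<omega>)) = (LINT \<omega>|M. w \<omega>) * prob {\<omega>\<in>space M. D \<omega> \<in> A}"
proof -
  have iw: "integrable M w"
    by (rule integrable_const_bound[where B=2]) (use w in auto)
  define c where "c = (LINT \<omega>|M. w \<omega>)"
  have c0: "c \<ge> 0" unfolding c_def using w by simp
  show ?thesis
  proof (cases "c = 0")
    case True
    then have "AE \<omega> in M. w \<omega> = 0"
      using integral_nonneg_eq_0_iff_AE[OF iw] w unfolding c_def by auto
    then have "(LINT \<omega>|M. w \<omega> * indicator A (D \<omega>)) = (LINT \<omega>|M. 0)"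
      by (intro integral_cong_AE) auto
    then show ?thesis using True by (simp add: c_def)
  next
    case False
    with c0 have c: "c > 0" by simp
    define Q where "Q = density M (\<lambda>\<omega>. ennreal (w \<omega> / c))"
    have "emeasure Q (space Q) = (\<integral>\<^sup>+\<omega>. ennreal (w \<omega> / c) \<partial>M)"
      unfolding Q_def by (subst emeasure_density) (auto intro!: nn_integral_cong)
    also have "\<dots> = ennreal (LINT \<omega>|M. w \<omega> / c)"
      by (rule nn_integral_eq_integral) (use iw w c in auto)
    also have "\<dots> = 1" using c by (simp add: c_def)
    finally interpret Q: prob_space Q by (rule prob_spaceI)
    have [measurable]: "D \<in> borel_measurable Q" unfolding Q_def by simp
    have "distr Q borel D = distr M borel D"
    proof (rule Levy_uniqueness)
      show "real_distribution (distr Q borel D)" by (rule Q.real_distribution_distr) simp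
      show "real_distribution (distr M borel D)" by (rule real_distribution_distr) simp
      show "char (distr Q borel D) = char (distr M borel D)"
      proof
        fix t
        have "char (distr Q borel D) t = (CLINT \<omega>|Q. iexp (t * D \<omega>))"
          by (simp add: char_def integral_distr)
        also have "\<dots> = (CLINT \<omega>|M. (w \<omega> / c) *\<^sub>R iexp (t * D \<omega>))"
          unfolding Q_def by (rule integral_density) (use w c in auto)
        also have "\<dots> = (CLINT \<omega>|M. (1/c) *\<^sub>R (w \<omega> *\<^sub>R iexp (t * D \<omega>)))"
          by simp
        also have "\<dots> = (1/c) *\<^sub>R (CLINT \<omega>|M. w \<omega> *\<^sub>R iexp (t * D \<omega>))"
          by (rule integral_scaleR_right) 
        also have "\<dots> = char (distr M borel D) t"
          unfolding eq c_def[symmetric] using c by (simp add: char_def integral_distr)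
        finally show "char (distr Q borel D) t = char (distr M borel D) t" .
      qed
    qed
    then have "measure (distr Q borel D) A = measure (distr M borel D) A" by simp
    then have "Q.prob {\<omega>\<in>space M. D \<omega> \<in> A} = prob {\<omega>\<in>space M. D \<omega> \<in> A}"
      by (simp add: measure_distr vimage_def Int_def conj_commute Q_def)
    moreover have "Q.prob {\<omega>\<in>space M. D \<omega> \<in> A} = (LINT \<omega>|Q. indicator A (D \<omega>))"
    proof -
      have "(LINT \<omega>|Q. indicator A (D \<omega>) :: real) = (LINT \<omega>|Q. indicator {\<omega>\<in>space M. D \<omega> \<in> A} \<omega>)"
        by (rule Bochner_Integration.integral_cong) (auto simp: Q_def indicator_def)
      moreover have "{\<omega>\<in>space M. D \<omega> \<in> A} \<inter> space M = {\<omega>\<in>space M. D \<omega> \<in> A}" by auto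
      ultimately show ?thesis by (simp add: Q_def)
    qed
    moreover have "(LINT \<omega>|Q. indicator A (D \<omega>) :: real) = (LINT \<omega>|M. (w \<omega> / c) *\<^sub>R indicator A (D \<omega>))"
      unfolding Q_def by (rule integral_density) (use w c in auto)
    moreover have "\<dots> = (LINT \<omega>|M. w \<omega> * indicator A (D \<omega>)) / c"
      by simp
    ultimately show ?thesis using c by (simp add: c_def field_simps)
  qed
qed

text \<open>
  The complex weight \<open>exp (\<i> Y)\<close> is split into the nonnegative weights \<open>1 + cos Y\<close> and \<open>1 + sin Y\<close>,
  to which the uniqueness theorem for characteristic functions of probability measures applies.
\<close>

lemma (in prob_space) indicator_iexp_factor:
  fixes Y D :: "'a \<Rightarrow> real"
  assumes [measurable]: "Y \<in> borel_measurable M" "D \<in> borel_measurable M" "A \<in> sets borel"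
    and eq: "\<And>t v. (CLINT \<omega>|M. iexp (v * Y \<omega> + t * D \<omega>)) =
                (CLINT \<omega>|M. iexp (v * Y \<omega>)) * (CLINT \<omega>|M. iexp (t * D \<omega>))"
  shows "(CLINT \<omega>|M. indicator A (D \<omega>) *\<^sub>R iexp (Y \<omega>)) =
     prob {\<omega>\<in>space M. D \<omega> \<in> A} *\<^sub>R (CLINT \<omega>|M. iexp (Y \<omega>))"
proof -
  have int: "integrable M (\<lambda>\<omega>. iexp (f \<omega>))" if "f \<in> borel_measurable M" for f :: "'a \<Rightarrow> real"
    by (rule integrable_iexp) (use that in auto)
  \<comment> \<open>The factors \<open>1\<close> and \<open>(-1)\<close> are kept so that both
    exponentials are instances of \<open>iexp (v * Y \<omega>)\<close> in the hypothesis
    \<open>eq\<close>.\<close>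
  have cos_eq: "complex_of_real (cos x) = (iexp (1 * x) + iexp ((-1) * x)) / 2" for x :: real
    by (simp add: cos_of_real[symmetric] cos_exp_eq)
  have sin_eq: "complex_of_real (sin x) = (iexp (1 * x) - iexp ((-1) * x)) / (2 * \<i>)" for x :: real
    by (simp add: sin_of_real[symmetric] sin_exp_eq)
  have main: "(LINT \<omega>|M. g \<omega> * indicator A (D \<omega>)) = (LINT \<omega>|M. g \<omega>) * prob {\<omega>\<in>space M. D \<omega> \<in> A}"
    if g: "\<And>\<omega>. complex_of_real (g \<omega>) = \<alpha> * iexp (1 * Y \<omega>) + \<beta> * iexp ((-1) * Y \<omega>)"
      and [measurable]: "g \<in> borel_measurable M" and b: "\<And>\<omega>. \<bar>g \<omega>\<bar> \<le> 1" for g \<alpha> \<beta>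
  proof -
    have "(LINT \<omega>|M. (1 + g \<omega>) * indicator A (D \<omega>)) = (LINT \<omega>|M. 1 + g \<omega>) * prob {\<omega>\<in>space M. D \<omega> \<in> A}"
    proof (rule weighted_law_eq)
      fix t
      have ig: "integrable M g" by (rule integrable_const_bound[where B=1]) (use b in auto)
      have "(CLINT \<omega>|M. complex_of_real (g \<omega>)) = \<alpha> * (CLINT \<omega>|M. iexp (1 * Y \<omega>)) + \<beta> * (CLINT \<omega>|M. iexp ((-1) * Y \<omega>))"
      proof -
        have i: "integrable M (\<lambda>\<omega>. \<alpha> * iexp (1 * Y \<omega>))" "integrable M (\<lambda>\<omega>. \<beta> * iexp ((-1) * Y \<omega>))"
          by (intro integrable_mult_right int; measurable)+
        show ?thesis
          unfolding g by (subst Bochner_Integration.integral_add[OF i]) simp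
      qed
      then have cg: "complex_of_real (LINT \<omega>|M. g \<omega>) = \<alpha> * (CLINT \<omega>|M. iexp (1 * Y \<omega>)) + \<beta> * (CLINT \<omega>|M. iexp ((-1) * Y \<omega>))"
        by simp
      have "(CLINT \<omega>|M. (1 + g \<omega>) *\<^sub>R iexp (t * D \<omega>)) =
         (CLINT \<omega>|M. iexp (t * D \<omega>) + (\<alpha> * iexp (1 * Y \<omega> + t * D \<omega>) + \<beta> * iexp ((-1) * Y \<omega> + t * D \<omega>)))"
      proof (rule Bochner_Integration.integral_cong[OF refl])
        fix \<omega>
        have "(1 + g \<omega>) *\<^sub>R iexp (t * D \<omega>) = iexp (t * D \<omega>) + complex_of_real (g \<omega>) * iexp (t * D \<omega>)"
          by (simp add: scaleR_conv_of_real algebra_simps)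
        also have "\<dots> = iexp (t * D \<omega>) + (\<alpha> * iexp (1 * Y \<omega> + t * D \<omega>) + \<beta> * iexp ((-1) * Y \<omega> + t * D \<omega>))"
          unfolding g by (simp add: algebra_simps exp_add[symmetric] exp_diff exp_minus divide_inverse)
        finally show "(1 + g \<omega>) *\<^sub>R iexp (t * D \<omega>) = \<dots>" .
      qed
      also have "\<dots> = (CLINT \<omega>|M. iexp (t * D \<omega>)) + (\<alpha> * (CLINT \<omega>|M. iexp (1 * Y \<omega> + t * D \<omega>)) + \<beta> * (CLINT \<omega>|M. iexp ((-1) * Y \<omega> + t * D \<omega>)))"
      proof -
        have i: "integrable M (\<lambda>\<omega>. iexp (t * D \<omega>))"
          "integrable M (\<lambda>\<omega>. \<alpha> * iexp (1 * Y \<omega> + t * D \<omega>))" "integrable M (\<lambda>\<omega>. \<beta> * iexp ((-1) * Y \<omega> + t * D \<omega>))"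
          by (intro integrable_mult_right int; measurable)+
        show ?thesis
          by (subst Bochner_Integration.integral_add[OF i(1) Bochner_Integration.integrable_add[OF i(2,3)]],
              subst Bochner_Integration.integral_add[OF i(2,3)]) simp
      qed
      also have "\<dots> = (1 + complex_of_real (LINT \<omega>|M. g \<omega>)) * (CLINT \<omega>|M. iexp (t * D \<omega>))"
        unfolding eq cg by (simp add: algebra_simps)
      also have "1 + complex_of_real (LINT \<omega>|M. g \<omega>) = complex_of_real (LINT \<omega>|M. 1 + g \<omega>)"
        using ig by (simp add: prob_space)
      finally show "(CLINT \<omega>|M. (1 + g \<omega>) *\<^sub>R iexp (t * D \<omega>)) =
                (LINT \<omega>|M. 1 + g \<omega>) *\<^sub>R (CLINT \<omega>|M. iexp (t * D \<omega>))"
        by (simp add: scaleR_conv_of_real)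
    qed (use b in \<open>auto simp: abs_le_iff\<close>, (smt (verit) b)+)
    moreover have ig: "integrable M g" by (rule integrable_const_bound[where B=1]) (use b in auto)
    moreover have "integrable M (\<lambda>\<omega>. g \<omega> * indicator A (D \<omega>))"
      by (rule integrable_const_bound[where B=1]) (use b in \<open>auto simp: indicator_def\<close>)
    moreover have iA: "integrable M (\<lambda>\<omega>. indicator A (D \<omega>) :: real)"
      by (rule integrable_const_bound[where B=1]) (auto simp: indicator_def)
    moreover have "(LINT \<omega>|M. indicator A (D \<omega>)) = prob {\<omega>\<in>space M. D \<omega> \<in> A}"
    proof -
      have "(LINT \<omega>|M. indicator A (D \<omega>) :: real) = (LINT \<omega>|M. indicator {\<omega>\<in>space M. D \<omega> \<in> A} \<omega>)"
        by (rule Bochner_Integration.integral_cong) (auto simp: indicator_def)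
      moreover have "{\<omega>\<in>space M. D \<omega> \<in> A} \<inter> space M = {\<omega>\<in>space M. D \<omega> \<in> A}" by auto
      ultimately show ?thesis by simp
    qed
    ultimately show ?thesis by (simp add: prob_space algebra_simps)
  qed
  have C: "(LINT \<omega>|M. cos (Y \<omega>) * indicator A (D \<omega>)) = (LINT \<omega>|M. cos (Y \<omega>)) * prob {\<omega>\<in>space M. D \<omega> \<in> A}"
    by (rule main[of _ "1/2" "1/2"]) (auto simp: cos_eq add_divide_distrib)
  have S: "(LINT \<omega>|M. sin (Y \<omega>) * indicator A (D \<omega>)) = (LINT \<omega>|M. sin (Y \<omega>)) * prob {\<omega>\<in>space M. D \<omega> \<in> A}"
    by (rule main[of _ "1/(2*\<i>)" "-1/(2*\<i>)"]) (auto simp: sin_eq field_simps)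
  have ie: "iexp x = complex_of_real (cos x) + \<i> * complex_of_real (sin x)" for x
    by (simp add: complex_eq_iff Re_exp Im_exp)
  have split: "(CLINT \<omega>|M. complex_of_real (f \<omega>) + \<i> * complex_of_real (g \<omega>)) =
     complex_of_real (LINT \<omega>|M. f \<omega>) + \<i> * complex_of_real (LINT \<omega>|M. g \<omega>)"
    if "integrable M f" "integrable M g" for f g :: "'a \<Rightarrow> real"
    using that by simp
  have "(CLINT \<omega>|M. indicator A (D \<omega>) *\<^sub>R iexp (Y \<omega>)) =
     (CLINT \<omega>|M. complex_of_real (cos (Y \<omega>) * indicator A (D \<omega>)) + \<i> * complex_of_real (sin (Y \<omega>) * indicator A (D \<omega>)))"
    by (rule Bochner_Integration.integral_cong[OF refl], unfold ie) (simp add: scaleR_conv_of_real algebra_simps)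
  also have "\<dots> = complex_of_real (LINT \<omega>|M. cos (Y \<omega>) * indicator A (D \<omega>)) + \<i> * complex_of_real (LINT \<omega>|M. sin (Y \<omega>) * indicator A (D \<omega>))"
    by (rule split; rule integrable_const_bound[where B=1]) (auto simp: indicator_def)
  also have "\<dots> = prob {\<omega>\<in>space M. D \<omega> \<in> A} *\<^sub>R (complex_of_real (LINT \<omega>|M. cos (Y \<omega>)) + \<i> * complex_of_real (LINT \<omega>|M. sin (Y \<omega>)))"
    unfolding C S by (simp add: scaleR_conv_of_real algebra_simps)
  also have "\<dots> = prob {\<omega>\<in>space M. D \<omega> \<in> A} *\<^sub>R (CLINT \<omega>|M. iexp (Y \<omega>))"
    unfolding ie by (subst split) (auto intro!: integrable_const_bound[where B=1])
  finally show ?thesis .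
qed


text \<open>
  Conditioning on the event \<open>D n \<in> A n\<close> does not change the joint characteristic function of the
  variables \<open>D i\<close> with \<open>i < n\<close>, so the induction runs over all probability spaces.
\<close>

lemma cf_product_measure:
  fixes D :: "nat \<Rightarrow> 'a \<Rightarrow> real"
  assumes "prob_space M" "\<And>i. i < n \<Longrightarrow> D i \<in> borel_measurable M"
    and "\<And>i. i < n \<Longrightarrow> real_distribution (\<mu> i)" "\<And>i. i < n \<Longrightarrow> A i \<in> sets borel"
    and "\<And>u. (CLINT \<omega>|M. iexp (\<Sum>i<n. u i * D i \<omega>)) = (\<Prod>i<n. char (\<mu> i) (u i))"
  shows "measure M {\<omega>\<in>space M. \<forall>i<n. D i \<omega> \<in> A i} = (\<Prod>i<n. measure (\<mu> i) (A i))"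
  using assms
proof (induction n arbitrary: M)
  case 0
  then show ?case by (simp add: prob_space.prob_space)
next
  case (Suc n)
  interpret prob_space M by fact
  have [measurable]: "D i \<in> borel_measurable M" if "i < Suc n" for i using Suc.prems(2)[OF that] .
  then have [measurable]: "D n \<in> borel_measurable M" by simp
  have [measurable]: "A i \<in> sets borel" if "i < Suc n" for i using Suc.prems(4)[OF that] .
  then have [measurable]: "A n \<in> sets borel" by simp
  have rd: "real_distribution (\<mu> i)" if "i < Suc n" for i using Suc.prems(3)[OF that] .
  have c0: "char (\<mu> i) 0 = 1" if "i < Suc n" for i
    using rd[OF that] by (rule real_distribution.char_zero)
  have both: "(CLINT \<omega>|M. iexp ((\<Sum>i<n. u i * D i \<omega>) + t * D n \<omega>)) = (\<Prod>i<n. char (\<mu> i) (u i)) * char (\<mu> n) t" for u t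
  proof -
    have "(CLINT \<omega>|M. iexp (\<Sum>i<Suc n. (u(n := t)) i * D i \<omega>)) = (\<Prod>i<Suc n. char (\<mu> i) ((u(n := t)) i))"
      by (rule Suc.prems(5))
    moreover have "(\<Sum>i<Suc n. (u(n := t)) i * D i \<omega>) = (\<Sum>i<n. u i * D i \<omega>) + t * D n \<omega>" for \<omega>
      by (auto intro!: sum.cong)
    moreover have "(\<Prod>i<Suc n. char (\<mu> i) ((u(n := t)) i)) = (\<Prod>i<n. char (\<mu> i) (u i)) * char (\<mu> n) t"
      by (auto intro!: prod.cong)
    ultimately show ?thesis by simp
  qed
  have Yc: "(CLINT \<omega>|M. iexp (\<Sum>i<n. u i * D i \<omega>)) = (\<Prod>i<n. char (\<mu> i) (u i))" for u
    using both[of u 0] c0[of n] by simp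
  have Dc: "(CLINT \<omega>|M. iexp (t * D n \<omega>)) = char (\<mu> n) t" for t
    using both[of "\<lambda>_. 0" t] c0 by simp
  have law: "distr M borel (D n) = \<mu> n"
  proof (rule Levy_uniqueness)
    show "real_distribution (distr M borel (D n))" by (rule real_distribution_distr) simp
    show "char (distr M borel (D n)) = char (\<mu> n)"
      using Dc by (auto simp: char_def integral_distr)
  qed (simp add: rd)
  define q where "q = prob {\<omega>\<in>space M. D n \<omega> \<in> A n}"
  have q: "q = measure (\<mu> n) (A n)"
    unfolding q_def law[symmetric] by (simp add: measure_distr vimage_def Int_def conj_commute)
  have f: "(CLINT \<omega>|M. indicator (A n) (D n \<omega>) *\<^sub>R iexp (\<Sum>i<n. u i * D i \<omega>)) = q *\<^sub>R (\<Prod>i<n. char (\<mu> i) (u i))" for u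
    unfolding q_def Yc[symmetric]
  proof (rule indicator_iexp_factor)
    fix t v
    have *: "v * (\<Sum>i<n. u i * D i \<omega>) = (\<Sum>i<n. (v * u i) * D i \<omega>)" for \<omega>
      by (simp add: sum_distrib_left mult.assoc)
    show "(CLINT \<omega>|M. iexp (v * (\<Sum>i<n. u i * D i \<omega>) + t * D n \<omega>)) =
                (CLINT \<omega>|M. iexp (v * (\<Sum>i<n. u i * D i \<omega>))) * (CLINT \<omega>|M. iexp (t * D n \<omega>))"
      unfolding * both Yc Dc ..
  qed measurable
  show ?case
  proof (cases "q = 0")
    case True
    have "prob {\<omega>\<in>space M. \<forall>i<Suc n. D i \<omega> \<in> A i} \<le> q"
      unfolding q_def by (rule finite_measure_mono) auto
    then have "prob {\<omega>\<in>space M. \<forall>i<Suc n. D i \<omega> \<in> A i} = 0" using True measure_nonneg[of M] by (smt (verit))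
    then show ?thesis using True q by simp
  next
    case False
    then have qp: "q > 0" using measure_nonneg[of M] unfolding q_def by (smt (verit))
    define B where "B = {\<omega>\<in>space M. D n \<omega> \<in> A n}"
    have [measurable]: "B \<in> sets M" unfolding B_def by measurable
    define Q where "Q = uniform_measure M B"
    have eB: "emeasure M B = ennreal q" by (simp add: q_def B_def emeasure_eq_measure)
    have Qd: "Q = density M (\<lambda>\<omega>. ennreal (indicator B \<omega> / q))"
      unfolding Q_def uniform_measure_def eB using qp
      by (intro arg_cong2[where f=density] refl ext) (auto simp: indicator_def divide_ennreal[symmetric])
    have "prob_space Q" unfolding Q_def
      by (rule prob_space_uniform_measure) (use qp eB in auto)
    then have "measure Q {\<omega>\<in>space Q. \<forall>i<n. D i \<omega> \<in> A i} = (\<Prod>i<n. measure (\<mu> i) (A i))"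
    proof (rule Suc.IH)
      fix u :: "nat \<Rightarrow> real"
      have "(CLINT \<omega>|Q. iexp (\<Sum>i<n. u i * D i \<omega>)) = (CLINT \<omega>|M. (indicator B \<omega> / q) *\<^sub>R iexp (\<Sum>i<n. u i * D i \<omega>))"
        unfolding Qd by (rule integral_density) (use qp in auto)
      also have "\<dots> = (CLINT \<omega>|M. (1/q) *\<^sub>R (indicator (A n) (D n \<omega>) *\<^sub>R iexp (\<Sum>i<n. u i * D i \<omega>)))"
        by (rule Bochner_Integration.integral_cong) (auto simp: B_def indicator_def)
      also have "\<dots> = (1/q) *\<^sub>R (CLINT \<omega>|M. (indicator (A n) (D n \<omega>) *\<^sub>R iexp (\<Sum>i<n. u i * D i \<omega>)))"
        by (rule integral_scaleR_right)
      also have "\<dots> = (\<Prod>i<n. char (\<mu> i) (u i))"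
        unfolding f using qp by simp
      finally show "(CLINT \<omega>|Q. iexp (\<Sum>i<n. u i * D i \<omega>)) = (\<Prod>i<n. char (\<mu> i) (u i))" .
    qed (auto simp: Qd rd)
    moreover have "measure Q {\<omega>\<in>space Q. \<forall>i<n. D i \<omega> \<in> A i} = prob (B \<inter> {\<omega>\<in>space M. \<forall>i<n. D i \<omega> \<in> A i}) / q"
      using qp eB unfolding Q_def by (subst measure_uniform_measure) (auto simp: q_def B_def)
    moreover have "B \<inter> {\<omega>\<in>space M. \<forall>i<n. D i \<omega> \<in> A i} = {\<omega>\<in>space M. \<forall>i<Suc n. D i \<omega> \<in> A i}"
      unfolding B_def by (auto simp: less_Suc_eq)
    ultimately show ?thesis using qp q by (simp add: field_simps)
  qed
qed

section \<open>Construction of Brownian motion\<close>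

text \<open>
  Levy's construction: \<open>z (0, i)\<close> is the increment over \<open>[i, i + 1]\<close>, and \<open>z (Suc m, k)\<close> is the standardised
  displacement of the midpoint of the \<open>k\<close>-th dyadic interval of level \<open>m\<close>.
\<close>

fun dyadic_value :: "(nat \<times> nat \<Rightarrow> real) \<Rightarrow> nat \<Rightarrow> nat \<Rightarrow> real" where
  "dyadic_value z 0 k = (\<Sum>i<k. z (0, i))"
| "dyadic_value z (Suc m) k = (if even k then dyadic_value z m (k div 2)
     else (dyadic_value z m (k div 2) + dyadic_value z m (Suc (k div 2))) / 2
          + (1 / sqrt 2) ^ m / 2 * z (Suc m, k div 2))"

lemma dyadic_value_even: "dyadic_value z (Suc m) (2 * k) = dyadic_value z m k"
  by simp

lemma dyadic_value_odd: "dyadic_value z (Suc m) (Suc (2 * k)) =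
   (dyadic_value z m k + dyadic_value z m (Suc k)) / 2 + (1 / sqrt 2) ^ m / 2 * z (Suc m, k)"
  by simp

lemma dyadic_value_refine: "dyadic_value z (m + j) (k * 2 ^ j) = dyadic_value z m k"
proof (induction j)
  case (Suc j)
  have "k * 2 ^ Suc j = 2 * (k * 2 ^ j)" by simp
  then show ?case using dyadic_value_even[of z "m + j" "k * 2 ^ j"] Suc
    by (simp only: add_Suc_right)
qed simp

lemma dyadic_value_0 [simp]: "dyadic_value z m 0 = 0"
  by (induction m) auto

text \<open>Piecewise linear interpolation through the points \<open>(k, v k)\<close>, meaningful
  for \<open>x \<ge> 0\<close>.\<close>

definition lerp :: "(nat \<Rightarrow> real) \<Rightarrow> real \<Rightarrow> real" where
  "lerp v x = v (nat \<lfloor>x\<rfloor>) + frac x * (v (Suc (nat \<lfloor>x\<rfloor>)) - v (nat \<lfloor>x\<rfloor>))"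

lemma lerp_of_nat [simp]: "lerp v (real k) = v k"
  by (simp add: lerp_def)

lemma lerp_eq:
  assumes "real k \<le> x" "x \<le> real k + 1"
  shows "lerp v x = v k + (x - k) * (v (Suc k) - v k)"
proof (cases "x = real k + 1")
  case True
  then have "x = real (Suc k)" by simp
  then show ?thesis by (simp only: lerp_of_nat) simp
next
  case False
  with assms have "\<lfloor>x\<rfloor> = int k" by (simp add: floor_eq_iff)
  then show ?thesis by (simp add: lerp_def frac_def)
qed


lemma continuous_on_atLeast_0I:
  fixes f :: "real \<Rightarrow> real"
  assumes "\<And>K::nat. continuous_on {0..real K} f"
  shows "continuous_on {0..} f"
  unfolding continuous_on_eq_continuous_within
proof
  fix x :: real assume "x \<in> {0..}"
  then have x: "x \<ge> 0" by simp
  obtain K :: nat where K: "x < real K" using reals_Archimedean2 by blast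
  have "continuous (at x within {0..real K}) f"
    using assms[of K] x K by (auto simp: continuous_on_eq_continuous_within)
  moreover have "at x within {0..real K} = at x within {0..}"
    by (rule at_within_nhd[of _ "{..<real K}"]) (use K in auto)
  ultimately show "continuous (at x within {0..}) f" by simp
qed


lemma continuous_on_lerp: "continuous_on {0..} (lerp v)"
proof (rule continuous_on_atLeast_0I)
  show "continuous_on {0..real K} (lerp v)" for K
  proof (induction K)
    case (Suc K)
    have "continuous_on {real K..real (Suc K)} (lerp v)"
      by (rule continuous_on_eq[of _ "\<lambda>x::real. v K + (x - K) * (v (Suc K) - v K)"])
         (auto intro!: continuous_intros simp: lerp_eq)
    with Suc have "continuous_on ({0..real K} \<union> {real K..real (Suc K)}) (lerp v)"
      by (intro continuous_on_closed_Un) auto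
    moreover have "{0..real K} \<union> {real K..real (Suc K)} = {0..real (Suc K)}" by auto
    ultimately show ?case by simp
  qed simp
qed

text \<open>Both interpolations agree at the old grid points and differ by a tent over each old
  interval. The bound is twice the height of the tent at the midpoint.\<close>

lemma lerp_refine_diff:
  assumes "0 \<le> x"
  shows "\<bar>lerp (dyadic_value z (Suc m)) (2 * x) - lerp (dyadic_value z m) x\<bar>
           \<le> (1 / sqrt 2) ^ m * \<bar>z (Suc m, nat \<lfloor>x\<rfloor>)\<bar>"
proof -
  define k where "k = nat \<lfloor>x\<rfloor>"
  have k: "real k \<le> x" "x \<le> real k + 1" using assms unfolding k_def by linarith+
  define c where "c = (1 / sqrt 2) ^ m * z (Suc m, k)"
  let ?V = "dyadic_value z m"
  have l: "lerp ?V x = ?V k + (x - k) * (?V (Suc k) - ?V k)" by (rule lerp_eq) (use k in auto)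
  have e: "dyadic_value z (Suc m) (Suc (Suc (2 * k))) = ?V (Suc k)"
    using dyadic_value_even[of z m "Suc k"] by (simp del: dyadic_value.simps)
  show ?thesis
  proof (cases "x \<le> real k + 1/2")
    case True
    have "lerp (dyadic_value z (Suc m)) (2 * x) = dyadic_value z (Suc m) (2 * k) +
       (2 * x - real (2 * k)) * (dyadic_value z (Suc m) (Suc (2 * k)) - dyadic_value z (Suc m) (2 * k))"
      by (rule lerp_eq) (use k True in auto)
    also have "\<dots> = ?V k + (x - k) * (?V (Suc k) - ?V k) + (x - k) * c"
      unfolding dyadic_value_even dyadic_value_odd by (simp add: field_simps c_def del: dyadic_value.simps)
    finally have "\<bar>lerp (dyadic_value z (Suc m)) (2 * x) - lerp ?V x\<bar> = (x - k) * \<bar>c\<bar>"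
      using l k by (simp add: abs_mult)
    also have "\<dots> \<le> 1 * \<bar>c\<bar>" by (rule mult_right_mono) (use k in auto)
    finally show ?thesis by (simp add: c_def abs_mult k_def)
  next
    case False
    have "lerp (dyadic_value z (Suc m)) (2 * x) = dyadic_value z (Suc m) (Suc (2 * k)) +
       (2 * x - real (Suc (2 * k))) * (dyadic_value z (Suc m) (Suc (Suc (2 * k))) - dyadic_value z (Suc m) (Suc (2 * k)))"
      by (rule lerp_eq) (use k False in auto)
    also have "\<dots> = ?V k + (x - k) * (?V (Suc k) - ?V k) + (k + 1 - x) * c"
      unfolding e dyadic_value_odd by (simp add: field_simps c_def del: dyadic_value.simps)
    finally have "\<bar>lerp (dyadic_value z (Suc m)) (2 * x) - lerp ?V x\<bar> = (k + 1 - x) * \<bar>c\<bar>"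
      using l k by (simp add: abs_mult)
    also have "\<dots> \<le> 1 * \<bar>c\<bar>" by (rule mult_right_mono) (use k in auto)
    finally show ?thesis by (simp add: c_def abs_mult k_def)
  qed
qed

definition levy_approx :: "(nat \<times> nat \<Rightarrow> real) \<Rightarrow> nat \<Rightarrow> real \<Rightarrow> real" where
  "levy_approx z m t = lerp (dyadic_value z m) (2 ^ m * t)"

text \<open>
  The bound \<open>5/4\<close> lies between \<open>2 powr (1/4)\<close>, so that a Gaussian array is tame almost surely already by
  fourth-moment tails, and \<open>sqrt 2\<close>, so that the approximations converge geometrically.
\<close>

definition tame_array :: "(nat \<times> nat \<Rightarrow> real) \<Rightarrow> bool" where
  "tame_array z \<longleftrightarrow> (\<forall>K. \<forall>\<^sub>F m in sequentially. \<forall>k < K * 2 ^ m. \<bar>z (Suc m, k)\<bar> \<le> (5/4) ^ m)"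

text \<open>The default \<open>0\<close> off the tame arrays makes every path continuous and not
  only almost every one, as \<open>standard_brownian_motion\<close> demands.\<close>

definition levy_path :: "(nat \<times> nat \<Rightarrow> real) \<Rightarrow> real \<Rightarrow> real" where
  "levy_path z t = (if tame_array z then lim (\<lambda>m. levy_approx z m t) else 0)"

lemma levy_approx_uniform_limit:
  assumes "tame_array z"
  shows "uniform_limit {0..<real K} (levy_approx z) (levy_path z) sequentially"
proof -
  have "uniformly_convergent_on {0..<real K} (\<lambda>n t. \<Sum>m<n. levy_approx z (Suc m) t - levy_approx z m t)"
  proof (rule Weierstrass_m_test'_ev)
    show "summable (\<lambda>m. (1 / sqrt 2 * (5/4)) ^ m :: real)"
    proof (rule summable_geometric)
      have "5/4 < sqrt 2" by (rule real_less_rsqrt) (simp add: power2_eq_square)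
      then show "norm (1 / sqrt 2 * (5/4) :: real) < 1" by (simp add: field_simps)
    qed
    have "\<forall>\<^sub>F m in sequentially. \<forall>k < K * 2 ^ m. \<bar>z (Suc m, k)\<bar> \<le> (5/4) ^ m"
      using assms unfolding tame_array_def by blast
    then show "\<forall>\<^sub>F m in sequentially. \<forall>t\<in>{0..<real K}. norm (levy_approx z (Suc m) t - levy_approx z m t) \<le> (1 / sqrt 2 * (5/4)) ^ m"
    proof (eventually_elim, intro ballI)
      fix m t assume H: "\<forall>k < K * 2 ^ m. \<bar>z (Suc m, k)\<bar> \<le> (5/4) ^ m" and t: "t \<in> {0..<real K}"
      have "2 ^ m * t < 2 ^ m * real K" using t by simp
      then have "nat \<lfloor>2 ^ m * t\<rfloor> < K * 2 ^ m"
        using t by (simp add: nat_less_iff floor_less_iff mult.commute)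
      then have "\<bar>z (Suc m, nat \<lfloor>2 ^ m * t\<rfloor>)\<bar> \<le> (5/4) ^ m" using H by blast
      have "\<bar>levy_approx z (Suc m) t - levy_approx z m t\<bar> \<le> (1 / sqrt 2) ^ m * \<bar>z (Suc m, nat \<lfloor>2 ^ m * t\<rfloor>)\<bar>"
        using lerp_refine_diff[of "2 ^ m * t" z m] t by (simp add: levy_approx_def mult.assoc)
      also have "\<dots> \<le> (1 / sqrt 2) ^ m * (5/4) ^ m"
        by (rule mult_left_mono) (fact, simp)
      finally show "norm (levy_approx z (Suc m) t - levy_approx z m t) \<le> (1 / sqrt 2 * (5/4)) ^ m"
        by (simp add: power_mult_distrib power_divide)
    qed
  qed
  then obtain l where l: "uniform_limit {0..<real K} (\<lambda>n t. \<Sum>m<n. levy_approx z (Suc m) t - levy_approx z m t) l sequentially"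
    by (auto simp: uniformly_convergent_on_def)
  have "uniform_limit {0..<real K} (\<lambda>n t. levy_approx z 0 t + (\<Sum>m<n. levy_approx z (Suc m) t - levy_approx z m t))
     (\<lambda>t. levy_approx z 0 t + l t) sequentially"
    by (intro uniform_limit_add uniform_limit_const l)
  moreover have "levy_approx z 0 t + (\<Sum>m<n. levy_approx z (Suc m) t - levy_approx z m t) = levy_approx z n t" for n t
    using sum_lessThan_telescope[of "\<lambda>m. levy_approx z m t" n] by simp
  ultimately have u: "uniform_limit {0..<real K} (levy_approx z) (\<lambda>t. levy_approx z 0 t + l t) sequentially"
    by simp
  have "levy_path z t = levy_approx z 0 t + l t" if "t \<in> {0..<real K}" for t
    using tendsto_uniform_limitI[OF u that] assms unfolding levy_path_def by (simp add: limI)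
  then show ?thesis
    by (intro uniform_limit_cong'[THEN iffD2, OF _ _ u]) auto
qed

lemma levy_path_continuous: "continuous_on {0..} (levy_path z)"
proof (cases "tame_array z")
  case True
  show ?thesis
  proof (rule continuous_on_atLeast_0I)
    fix K
    have "continuous_on {0..<real (Suc K)} (levy_path z)"
    proof (rule uniform_limit_theorem[OF _ levy_approx_uniform_limit[OF True]])
      show "\<forall>\<^sub>F n in sequentially. continuous_on {0..<real (Suc K)} (levy_approx z n)"
        unfolding levy_approx_def
        by (intro always_eventually allI continuous_on_compose2[OF continuous_on_lerp] continuous_intros) auto
    qed simp
    then show "continuous_on {0..real K} (levy_path z)"
      by (rule continuous_on_subset) auto
  qed
qed (simp add: levy_path_def)

lemma levy_path_dyadic:
  assumes "tame_array z"
  shows "levy_path z (real k / 2 ^ m) = dyadic_value z m k"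
proof -
  have "levy_approx z (n + m) (real k / 2 ^ m) = dyadic_value z m k" for n
  proof -
    have "2 ^ (n + m) * (real k / 2 ^ m) = real (k * 2 ^ n)" by (simp add: power_add)
    then show ?thesis using dyadic_value_refine[of z m n k]
      by (simp only: levy_approx_def lerp_of_nat add.commute)
  qed
  then have "(\<lambda>n. levy_approx z (n + m) (real k / 2 ^ m)) \<longlonglongrightarrow> dyadic_value z m k" by simp
  then have "(\<lambda>n. levy_approx z n (real k / 2 ^ m)) \<longlonglongrightarrow> dyadic_value z m k"
    by (rule LIMSEQ_offset)
  then show ?thesis using assms by (simp add: levy_path_def limI)
qed

lemma levy_path_0: "levy_path z 0 = 0"
  using levy_path_dyadic[of z 0 0] by (cases "tame_array z") (auto simp: levy_path_def)

section \<open>Independent standard normal variables and the dyadic increments made from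
  them\<close>

abbreviation gauss_space :: "(nat \<Rightarrow> real) measure" where
  "gauss_space \<equiv> \<Pi>\<^sub>M i\<in>(UNIV::nat set). std_normal_distribution"

interpretation std_normal: real_distribution std_normal_distribution
  by (rule real_dist_normal_dist)

interpretation gauss: product_prob_space "\<lambda>_::nat. std_normal_distribution" UNIV
  by unfold_locales

definition gauss_array :: "(nat \<Rightarrow> real) \<Rightarrow> nat \<times> nat \<Rightarrow> real" where
  "gauss_array \<omega> p = \<omega> (prod_encode p)"

lemma gauss_component_measurable [measurable]: "(\<lambda>\<omega>. \<omega> i) \<in> borel_measurable gauss_space"
proof -
  have "(\<lambda>\<omega>. \<omega> i) \<in> gauss_space \<rightarrow>\<^sub>M std_normal_distribution"
    by (rule measurable_component_singleton) simp
  then show ?thesis by (simp cong: measurable_cong_sets)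
qed

lemma gauss_array_measurable [measurable]: "(\<lambda>\<omega>. gauss_array \<omega> p) \<in> borel_measurable gauss_space"
  unfolding gauss_array_def by measurable

lemma gauss_component_distr: "distr gauss_space borel (\<lambda>\<omega>. \<omega> i) = std_normal_distribution"
proof -
  have "distr gauss_space borel (\<lambda>\<omega>. \<omega> i) = distr gauss_space std_normal_distribution (\<lambda>\<omega>. \<omega> i)"
    by (rule distr_cong) auto
  then show ?thesis using gauss.PiM_component[of i] by simp
qed

lemma gauss_indep: "gauss.indep_vars (\<lambda>_. borel) (\<lambda>i \<omega>. \<omega> i) UNIV"
proof (subst gauss.indep_vars_iff_distr_eq_PiM)
  have "distr gauss_space (Pi\<^sub>M UNIV (\<lambda>i::nat. borel)) (\<lambda>x. \<lambda>i\<in>UNIV. x i) = distr gauss_space gauss_space (\<lambda>x. x)"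
    by (rule distr_cong) (auto intro!: sets_PiM_cong)
  then show "distr gauss_space (Pi\<^sub>M UNIV (\<lambda>i::nat. borel)) (\<lambda>x. \<lambda>i\<in>UNIV. x i) = Pi\<^sub>M UNIV (\<lambda>i. distr gauss_space borel (\<lambda>\<omega>. \<omega> i))"
    by (simp add: gauss_component_distr)
qed auto

lemma gauss_cf:
  assumes "finite F"
  shows "(CLINT \<omega>|gauss_space. iexp (\<Sum>i\<in>F. b i * \<omega> i)) = exp (- (\<Sum>i\<in>F. (b i)\<^sup>2) / 2)"
proof -
  have ind: "gauss.indep_vars (\<lambda>_. borel) (\<lambda>i \<omega>. b i * \<omega> i) F"
    by (rule gauss.indep_vars_compose2[OF gauss.indep_vars_subset[OF gauss_indep]]) auto
  have "(CLINT \<omega>|gauss_space. iexp (\<Sum>i\<in>F. b i * \<omega> i)) = char (distr gauss_space borel (\<lambda>\<omega>. \<Sum>i\<in>F. b i * \<omega> i)) 1"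
    unfolding char_def by (subst integral_distr) auto
  also have "\<dots> = (\<Prod>i\<in>F. char (distr gauss_space borel (\<lambda>\<omega>. b i * \<omega> i)) 1)"
    by (rule gauss.char_distr_sum[OF ind])
  also have "\<dots> = (\<Prod>i\<in>F. char (distr gauss_space borel (\<lambda>\<omega>. \<omega> i)) (b i))"
    unfolding char_def by (intro prod.cong refl, subst (1 2) integral_distr) auto
  also have "\<dots> = (\<Prod>i\<in>F. complex_of_real (exp (- (b i)\<^sup>2 / 2)))"
    unfolding gauss_component_distr char_std_normal_distribution ..
  also have "\<dots> = complex_of_real (exp (\<Sum>i\<in>F. - (b i)\<^sup>2 / 2))"
    using assms by (simp add: exp_sum)
  also have "(\<Sum>i\<in>F. - (b i)\<^sup>2 / 2) = - (\<Sum>i\<in>F. (b i)\<^sup>2) / 2"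
    by (simp add: sum_divide_distrib sum_negf)
  finally show ?thesis .
qed

lemma gauss_array_cf:
  assumes "finite F"
  shows "(CLINT \<omega>|gauss_space. iexp (\<Sum>p\<in>F. b p * gauss_array \<omega> p)) = exp (- (\<Sum>p\<in>F. (b p)\<^sup>2) / 2)"
proof -
  have i: "inj_on prod_encode F" by (rule inj_prod_encode)
  show ?thesis
    using gauss_cf[of "prod_encode ` F" "\<lambda>i. b (prod_decode i)"] assms
    by (simp add: sum.reindex[OF i] gauss_array_def)
qed

lemma sum_even_odd: "(\<Sum>k<2*n. f k) = (\<Sum>k<n. f (2*k) + f (Suc (2*k)) :: real)"
  by (induction n) auto

text \<open>
  Halving an interval replaces an increment \<open>D\<close> by \<open>D / 2 \<plusminus> d z\<close> with an unused variable \<open>z\<close>; carrying the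
  unused variables along as the second sum makes the induction step purely algebraic.
\<close>

lemma dyadic_cf:
  assumes "finite F" "\<And>p. p \<in> F \<Longrightarrow> m < fst p"
  shows "(CLINT \<omega>|gauss_space. iexp ((\<Sum>k<K * 2^m. s k * (dyadic_value (gauss_array \<omega>) m (Suc k) - dyadic_value (gauss_array \<omega>) m k))
          + (\<Sum>p\<in>F. b p * gauss_array \<omega> p)))
       = exp (- ((\<Sum>k<K * 2^m. (s k)\<^sup>2) / 2^m + (\<Sum>p\<in>F. (b p)\<^sup>2)) / 2)"
  using assms
proof (induction m arbitrary: s F b)
  case 0
  define G where "G = Pair (0::nat) ` {..<K}"
  have fin: "finite G" "finite F" using 0 by (auto simp: G_def)
  have disj: "G \<inter> F = {}" using 0(2) by (force simp: G_def)
  define c where "c p = (if fst p = 0 then s (snd p) else b p)" for p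
  have G: "(\<Sum>p\<in>G. f (c p) p) = (\<Sum>k<K. f (s k) (0, k))" for f :: "real \<Rightarrow> nat \<times> nat \<Rightarrow> real"
    unfolding G_def by (subst sum.reindex) (auto simp: c_def inj_on_def)
  have F: "(\<Sum>p\<in>F. f (c p) p) = (\<Sum>p\<in>F. f (b p) p)" for f :: "real \<Rightarrow> nat \<times> nat \<Rightarrow> real"
    using 0(2) by (intro sum.cong refl) (simp add: c_def less_imp_neq[THEN not_sym])
  have "(CLINT \<omega>|gauss_space. iexp (\<Sum>p\<in>G\<union>F. c p * gauss_array \<omega> p)) = exp (- (\<Sum>p\<in>G\<union>F. (c p)\<^sup>2) / 2)"
    by (rule gauss_array_cf) (use fin in auto)
  then show ?case
    unfolding sum.union_disjoint[OF fin disj] G[of "\<lambda>x p. x * gauss_array _ p"] F[of "\<lambda>x p. x * gauss_array _ p"] G[of "\<lambda>x p. x^2"] F[of "\<lambda>x p. x^2"]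
    by simp
next
  case (Suc m)
  define n where "n = K * 2 ^ m"
  \<comment> \<open>The standard deviation of a midpoint displacement: given its values at the ends
    of an interval of length \<open>1 / 2 ^ m\<close>, Brownian motion has variance
    \<open>1 / 2 ^ m / 4\<close> at the middle.\<close>
  define d where "d = (1 / sqrt 2) ^ m / (2::real)"
  have d2: "d\<^sup>2 = 1 / 2 ^ m / 4"
  proof -
    have "((1 / sqrt 2) ^ m)\<^sup>2 = ((1 / sqrt 2 :: real)\<^sup>2) ^ m"
      by (simp only: power_mult[symmetric] mult.commute)
    then show ?thesis by (simp add: d_def power_divide)
  qed
  define G where "G = Pair (Suc m) ` {..<n}"
  have fin: "finite G" "finite F" using Suc.prems by (auto simp: G_def)
  have disj: "G \<inter> F = {}" using Suc.prems(2) by (force simp: G_def)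
  \<comment> \<open>In \<open>s (2 * k) * (D / 2 + d * z) + s (Suc (2 * k)) * (D / 2 - d *
    z)\<close> the coefficient of the coarse increment \<open>D\<close> is \<open>s' k\<close>, and
    that of the new variable \<open>z\<close> is \<open>c (Suc m, k)\<close>.\<close>
  define c where "c p = (if fst p = Suc m then d * (s (2 * snd p) - s (Suc (2 * snd p))) else b p)" for p
  define s' where "s' k = (s (2 * k) + s (Suc (2 * k))) / 2" for k
  have G: "(\<Sum>p\<in>G. f (c p) p) = (\<Sum>k<n. f (d * (s (2 * k) - s (Suc (2 * k)))) (Suc m, k))" for f :: "real \<Rightarrow> nat \<times> nat \<Rightarrow> real"
    unfolding G_def by (subst sum.reindex) (auto simp: c_def inj_on_def)
  have F: "(\<Sum>p\<in>F. f (c p) p) = (\<Sum>p\<in>F. f (b p) p)" for f :: "real \<Rightarrow> nat \<times> nat \<Rightarrow> real"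
    using Suc.prems(2) by (intro sum.cong refl) (simp add: c_def less_imp_neq[THEN not_sym])
  have n2: "K * 2 ^ Suc m = 2 * n" by (simp add: n_def)
  have "(\<Sum>k<K * 2^Suc m. s k * (dyadic_value z (Suc m) (Suc k) - dyadic_value z (Suc m) k)) =
    (\<Sum>k<n. s' k * (dyadic_value z m (Suc k) - dyadic_value z m k)) + (\<Sum>p\<in>G. c p * z p)" for z
  proof -
    have e: "dyadic_value z (Suc m) (Suc (Suc (2 * k))) = dyadic_value z m (Suc k)" for k
      using dyadic_value_even[of z m "Suc k"] by (simp del: dyadic_value.simps)
    show ?thesis
      unfolding n2 sum_even_odd G[of "\<lambda>x p. x * z p"] sum.distrib[symmetric]
      by (rule sum.cong[OF refl], unfold e dyadic_value_even dyadic_value_odd d_def[symmetric] s'_def)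
         (simp add: field_simps)
  qed
  then have "(CLINT \<omega>|gauss_space. iexp ((\<Sum>k<K * 2^Suc m. s k * (dyadic_value (gauss_array \<omega>) (Suc m) (Suc k) - dyadic_value (gauss_array \<omega>) (Suc m) k))
          + (\<Sum>p\<in>F. b p * gauss_array \<omega> p))) =
    (CLINT \<omega>|gauss_space. iexp ((\<Sum>k<n. s' k * (dyadic_value (gauss_array \<omega>) m (Suc k) - dyadic_value (gauss_array \<omega>) m k))
          + (\<Sum>p\<in>G\<union>F. c p * gauss_array \<omega> p)))"
    unfolding sum.union_disjoint[OF fin disj] F[of "\<lambda>x p. x * gauss_array _ p"] by (simp only: add.assoc)
  also have "\<dots> = exp (- ((\<Sum>k<n. (s' k)\<^sup>2) / 2^m + (\<Sum>p\<in>G\<union>F. (c p)\<^sup>2)) / 2)"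
    unfolding n_def by (rule Suc.IH) (use fin Suc.prems in \<open>auto simp: G_def\<close>, (metis Suc_lessD)+)
  also have "(\<Sum>k<n. (s' k)\<^sup>2) / 2^m + (\<Sum>p\<in>G\<union>F. (c p)\<^sup>2) = (\<Sum>k<K * 2^Suc m. (s k)\<^sup>2) / 2^Suc m + (\<Sum>p\<in>F. (b p)\<^sup>2)"
  proof -
    \<comment> \<open>Parallelogram identity: the squares of half the sum and of half the difference
      add up to half the sum of the squares.\<close>
    have "(\<Sum>k<n. (s' k)\<^sup>2) / 2^m + (\<Sum>p\<in>G. (c p)\<^sup>2) = (\<Sum>k<n. (s' k)\<^sup>2 / 2^m + (d * (s (2 * k) - s (Suc (2 * k))))\<^sup>2)"
      unfolding G[of "\<lambda>x p. x^2"] by (simp add: sum.distrib sum_divide_distrib)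
    also have "\<dots> = (\<Sum>k<n. ((s (2*k))\<^sup>2 + (s (Suc (2*k)))\<^sup>2) / 2^Suc m)"
      by (rule sum.cong[OF refl], simp only: s'_def power_mult_distrib d2 power_divide power_Suc)
         (simp add: field_simps power2_eq_square)
    also have "\<dots> = (\<Sum>k<K * 2^Suc m. (s k)\<^sup>2) / 2^Suc m"
      unfolding n2 sum_even_odd by (simp add: sum_divide_distrib)
    finally show ?thesis
      unfolding sum.union_disjoint[OF fin disj] F[of "\<lambda>x p. x^2"] by simp
  qed
  finally show ?case .
qed


section \<open>Gaussian tails and tameness of the array\<close>

lemma std_normal_exp_integral:
  "integrable lborel (\<lambda>x. std_normal_density x * exp (s * x))"
  "(LINT x|lborel. std_normal_density x * exp (s * x)) = exp (s\<^sup>2 / 2)"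
proof -
  have e: "std_normal_density x * exp (s * x) = exp (s\<^sup>2 / 2) * normal_density s 1 x" for x
    unfolding normal_density_def by (simp add: exp_add[symmetric] power2_eq_square field_simps)
  show "integrable lborel (\<lambda>x. std_normal_density x * exp (s * x))"
    unfolding e by simp
  show "(LINT x|lborel. std_normal_density x * exp (s * x)) = exp (s\<^sup>2 / 2)"
    unfolding e by simp
qed

text \<open>Chernoff's bound, with the exponential moment taken at \<open>s = x\<close> and
  \<open>s = - x\<close> for the two tails.\<close>

lemma std_normal_tail:
  assumes "x \<ge> 0"
  shows "measure std_normal_distribution {y. x \<le> \<bar>y\<bar>} \<le> 2 * exp (- x\<^sup>2 / 2)"
proof -
  have one: "measure std_normal_distribution {y. 1 \<le> exp (s * y - x\<^sup>2)} \<le> exp (- x\<^sup>2 / 2)" if "s\<^sup>2 = x\<^sup>2" for s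
  proof -
    have i: "integrable std_normal_distribution (\<lambda>y. exp (s * y))" "(LINT y|std_normal_distribution. exp (s * y)) = exp (x\<^sup>2 / 2)"
      using std_normal_exp_integral[of s] that by (simp_all add: integrable_density integral_density)
    have "measure std_normal_distribution {y\<in>space std_normal_distribution. 1 \<le> exp (s * y - x\<^sup>2)}
       \<le> (LINT y|std_normal_distribution. exp (s * y - x\<^sup>2)) / 1"
      by (rule integral_Markov_inequality_measure[where A="{}"]) (use i in \<open>auto simp: exp_diff\<close>)
    also have "\<dots> = exp (x\<^sup>2 / 2) / exp (x\<^sup>2)"
      using i by (simp add: exp_diff)
    also have "\<dots> = exp (- x\<^sup>2 / 2)" by (simp add: exp_diff[symmetric])
    finally show ?thesis by simp
  qed
  have "measure std_normal_distribution {y. x \<le> \<bar>y\<bar>} \<le>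
    measure std_normal_distribution ({y. 1 \<le> exp (x * y - x\<^sup>2)} \<union> {y. 1 \<le> exp ((-x) * y - x\<^sup>2)})"
  proof (rule std_normal.finite_measure_mono)
    show "{y. x \<le> \<bar>y\<bar>} \<subseteq> {y. 1 \<le> exp (x * y - x\<^sup>2)} \<union> {y. 1 \<le> exp ((-x) * y - x\<^sup>2)}"
    proof
      fix y assume "y \<in> {y. x \<le> \<bar>y\<bar>}"
      then have "x * x \<le> x * \<bar>y\<bar>" using assms by (intro mult_left_mono) auto
      then show "y \<in> {y. 1 \<le> exp (x * y - x\<^sup>2)} \<union> {y. 1 \<le> exp ((-x) * y - x\<^sup>2)}"
        by (cases "y \<ge> 0") (auto simp: power2_eq_square)
    qed
  qed simp
  also have "\<dots> \<le> measure std_normal_distribution {y. 1 \<le> exp (x * y - x\<^sup>2)} + measure std_normal_distribution {y. 1 \<le> exp ((-x) * y - x\<^sup>2)}"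
    by (rule measure_Un_le) simp_all
  also have "\<dots> \<le> 2 * exp (- x\<^sup>2 / 2)"
    using one[of x] one[of "-x"] by simp
  finally show ?thesis .
qed

lemma exp_neg_le_inverse_square:
  fixes y :: real assumes "y > 0" shows "exp (- y) \<le> 2 / y\<^sup>2"
proof -
  have "1 + y + y\<^sup>2 / 2 \<le> exp y"
    using exp_lower_Taylor_quadratic[of y] assms by simp
  then have "y\<^sup>2 / 2 \<le> exp y" using assms by linarith
  then show ?thesis using assms by (simp add: exp_minus field_simps)
qed

lemma AE_tame: "AE \<omega> in gauss_space. tame_array (gauss_array \<omega>)"
  unfolding tame_array_def AE_all_countable
proof
  fix K
  define E where "E m = {\<omega>\<in>space gauss_space. \<exists>k<K * 2^m. (5/4)^m < \<bar>gauss_array \<omega> (Suc m, k)\<bar>}" for m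
  have [measurable]: "E m \<in> sets gauss_space" for m unfolding E_def by measurable
  have "measure gauss_space (E m) \<le> 16 * real K * (512/625) ^ m" for m
  proof -
    define H where "H k = {\<omega>\<in>space gauss_space. (5/4)^m < \<bar>gauss_array \<omega> (Suc m, k)\<bar>}" for k
    have H: "H k \<in> sets gauss_space" for k unfolding H_def by measurable
    have "E m = (\<Union>k<K * 2^m. H k)"
      unfolding E_def H_def by blast
    also have "measure gauss_space \<dots> \<le> (\<Sum>k<K * 2^m. measure gauss_space (H k))"
      by (rule measure_UNION_le[OF finite_lessThan H])
    also have "\<dots> \<le> (\<Sum>k<K * 2^m. 16 / ((5/4)^m)^4)"
    proof (rule sum_mono)
      fix k
      define x where "x = (5/4 :: real)^m"
      have x: "x > 0" by (simp add: x_def)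
      have "{\<omega>\<in>space gauss_space. x < \<bar>gauss_array \<omega> (Suc m, k)\<bar>} =
        (\<lambda>\<omega>. \<omega> (prod_encode (Suc m, k))) -` {y. x < \<bar>y\<bar>} \<inter> space gauss_space"
        unfolding gauss_array_def by blast
      then have "measure gauss_space {\<omega>\<in>space gauss_space. x < \<bar>gauss_array \<omega> (Suc m, k)\<bar>} =
        measure (distr gauss_space borel (\<lambda>\<omega>. \<omega> (prod_encode (Suc m, k)))) {y. x < \<bar>y\<bar>}"
        by (subst measure_distr) simp_all
      also have "\<dots> \<le> measure std_normal_distribution {y. x \<le> \<bar>y\<bar>}"
        unfolding gauss_component_distr by (rule std_normal.finite_measure_mono) auto
      also have "\<dots> \<le> 2 * exp (- (x\<^sup>2 / 2))" using std_normal_tail[of x] x by simp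
      also have "\<dots> \<le> 2 * (2 / (x\<^sup>2 / 2)\<^sup>2)" using exp_neg_le_inverse_square[of "x\<^sup>2/2"] x by simp
      also have "\<dots> = 16 / x ^ 4" by (simp add: power_divide power_mult[symmetric])
      finally show "measure gauss_space (H k) \<le> 16 / ((5/4)^m)^4"
        unfolding H_def x_def .
    qed
    also have "\<dots> = 16 * real K * (2 ^ m / ((5/4)^m)^4)" by simp
    \<comment> \<open>The number of variables on a level grows like \<open>2 ^ m\<close>, the tail
      decays like \<open>(5/4) ^ (- 4 * m)\<close>, and \<open>2 / (5/4) ^ 4 = 512/625\<close> is
      less than 1.\<close>
    also have "2 ^ m / ((5/4)^m)^4 = (512/625 :: real)^m"
    proof -
      have "((5/4)^m)^4 = ((5/4 :: real)^4)^m"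
        by (simp only: power_mult[symmetric] mult.commute)
      moreover have "2 ^ m / ((5/4 :: real)^4)^m = (2 / (5/4)^4) ^ m"
        by (rule power_divide[symmetric])
      moreover have "2 / (5/4)^4 = (512/625 :: real)" by (simp add: power_divide)
      ultimately show ?thesis by (simp only:)
    qed
    finally show ?thesis .
  qed
  then have bound: "norm (measure gauss_space (E m)) \<le> 16 * real K * (512/625) ^ m" for m
    unfolding real_norm_def abs_of_nonneg[OF measure_nonneg] .
  have "summable (\<lambda>m. 16 * real K * (512/625) ^ m)"
    by (rule summable_mult, rule summable_geometric) simp
  then have "summable (\<lambda>m. measure gauss_space (E m))"
    by (rule summable_comparison_test'[where N=0]) (rule bound)
  then have "AE \<omega> in gauss_space. eventually (\<lambda>m. \<omega> \<in> space gauss_space - E m) sequentially"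
  proof (rule borel_cantelli_AE1[rotated 2])
    show "E m \<in> sets gauss_space" for m by measurable
    show "emeasure gauss_space (E m) < \<infinity>" for m
      by (simp add: gauss.emeasure_eq_measure)
  qed
  then show "AE \<omega> in gauss_space. \<forall>\<^sub>F m in sequentially. \<forall>k<K * 2 ^ m. \<bar>gauss_array \<omega> (Suc m, k)\<bar> \<le> (5 / 4) ^ m"
  proof (rule AE_mp, intro AE_I2 impI)
    fix \<omega> assume "\<forall>\<^sub>F m in sequentially. \<omega> \<in> space gauss_space - E m"
    then show "\<forall>\<^sub>F m in sequentially. \<forall>k<K * 2 ^ m. \<bar>gauss_array \<omega> (Suc m, k)\<bar> \<le> (5 / 4) ^ m"
    proof (rule eventually_mono)
      fix m assume "\<omega> \<in> space gauss_space - E m"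
      then show "\<forall>k<K * 2 ^ m. \<bar>gauss_array \<omega> (Suc m, k)\<bar> \<le> (5 / 4) ^ m"
        unfolding E_def by (metis (mono_tags, lifting) DiffD1 DiffD2 mem_Collect_eq not_le)
    qed
  qed
qed

text \<open>Increments over coarse intervals are combined into one sum over the fine grid with
  piecewise constant coefficients, the form that \<open>dyadic_cf\<close> expects. Intervals may be
  empty, because dyadic approximations of different times can coincide.\<close>

lemma step_coefficients:
  fixes \<kappa> :: "nat \<Rightarrow> nat" and u :: "nat \<Rightarrow> real"
  assumes "\<And>i. i < n \<Longrightarrow> \<kappa> i \<le> \<kappa> (Suc i)"
  shows "\<exists>s. (\<forall>k\<ge>\<kappa> n. s k = 0) \<and>
    (\<forall>V::nat\<Rightarrow>real. (\<Sum>k<\<kappa> n. s k * (V (Suc k) - V k)) = (\<Sum>i<n. u i * (V (\<kappa> (Suc i)) - V (\<kappa> i)))) \<and>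
    (\<Sum>k<\<kappa> n. (s k)\<^sup>2) = (\<Sum>i<n. (u i)\<^sup>2 * (real (\<kappa> (Suc i)) - real (\<kappa> i)))"
  using assms
proof (induction n)
  case 0
  show ?case by (rule exI[of _ "\<lambda>_. 0"]) auto
next
  case (Suc n)
  then obtain s where s: "\<forall>k\<ge>\<kappa> n. s k = 0"
    "\<And>V::nat\<Rightarrow>real. (\<Sum>k<\<kappa> n. s k * (V (Suc k) - V k)) = (\<Sum>i<n. u i * (V (\<kappa> (Suc i)) - V (\<kappa> i)))"
    "(\<Sum>k<\<kappa> n. (s k)\<^sup>2) = (\<Sum>i<n. (u i)\<^sup>2 * (real (\<kappa> (Suc i)) - real (\<kappa> i)))"
    by (meson less_SucI)
  have le: "\<kappa> n \<le> \<kappa> (Suc n)" using Suc.prems by simp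
  define s' where "s' k = (if \<kappa> n \<le> k \<and> k < \<kappa> (Suc n) then u n else s k)" for k
  have split: "(\<Sum>k<\<kappa> (Suc n). f (s' k) k) = (\<Sum>k<\<kappa> n. f (s k) k) + (\<Sum>k=\<kappa> n..<\<kappa> (Suc n). f (u n) k)"
    for f :: "real \<Rightarrow> nat \<Rightarrow> real"
  proof -
    have "{..<\<kappa> (Suc n)} = {..<\<kappa> n} \<union> {\<kappa> n..<\<kappa> (Suc n)}" using le by auto
    then have "(\<Sum>k<\<kappa> (Suc n). f (s' k) k) = (\<Sum>k<\<kappa> n. f (s' k) k) + (\<Sum>k=\<kappa> n..<\<kappa> (Suc n). f (s' k) k)"
      by (simp add: sum.union_disjoint disjoint_iff)
    then show ?thesis by (simp add: s'_def)
  qed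
  show ?case
  proof (intro exI[of _ s'] conjI allI impI)
    fix k assume "\<kappa> (Suc n) \<le> k" then show "s' k = 0" using s(1) le by (simp add: s'_def)
  next
    fix V :: "nat \<Rightarrow> real"
    have "(\<Sum>k=\<kappa> n..<\<kappa> (Suc n). u n * (V (Suc k) - V k)) = u n * (V (\<kappa> (Suc n)) - V (\<kappa> n))"
      unfolding sum_distrib_left[symmetric] sum_Suc_diff'[OF le] ..
    then show "(\<Sum>k<\<kappa> (Suc n). s' k * (V (Suc k) - V k)) = (\<Sum>i<Suc n. u i * (V (\<kappa> (Suc i)) - V (\<kappa> i)))"
      using split[of "\<lambda>x k. x * (V (Suc k) - V k)"] s(2)[of V] by simp
  next
    show "(\<Sum>k<\<kappa> (Suc n). (s' k)\<^sup>2) = (\<Sum>i<Suc n. (u i)\<^sup>2 * (real (\<kappa> (Suc i)) - real (\<kappa> i)))"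
      using split[of "\<lambda>x k. x^2"] s(3) le by (simp add: of_nat_diff mult.commute)
  qed
qed

lemma dyadic_value_measurable [measurable]: "(\<lambda>\<omega>. dyadic_value (gauss_array \<omega>) m k) \<in> borel_measurable gauss_space"
proof (induction m arbitrary: k)
  case (Suc m)
  note Suc [measurable]
  show ?case by (cases "even k") (simp_all del: dyadic_value.simps add: dyadic_value.simps(2))
qed simp

lemma levy_path_measurable [measurable]: "(\<lambda>\<omega>. levy_path (gauss_array \<omega>) t) \<in> borel_measurable gauss_space"
proof -
  have [measurable]: "Measurable.pred gauss_space (\<lambda>\<omega>. tame_array (gauss_array \<omega>))"
    unfolding tame_array_def eventually_sequentially by measurable
  have [measurable]: "(\<lambda>\<omega>. levy_approx (gauss_array \<omega>) m t) \<in> borel_measurable gauss_space" for m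
    unfolding levy_approx_def lerp_def by measurable
  show ?thesis unfolding levy_path_def
    by (intro measurable_If borel_measurable_lim_metric) auto
qed

lemma levy_path_dyadic_cf:
  fixes \<kappa> :: "nat \<Rightarrow> nat"
  assumes "\<And>i. i < n \<Longrightarrow> \<kappa> i \<le> \<kappa> (Suc i)"
  shows "(CLINT \<omega>|gauss_space. iexp (\<Sum>i<n. u i * (levy_path (gauss_array \<omega>) (\<kappa> (Suc i) / 2^m) - levy_path (gauss_array \<omega>) (\<kappa> i / 2^m))))
     = exp (- (\<Sum>i<n. (u i)\<^sup>2 * (\<kappa> (Suc i) / 2^m - \<kappa> i / 2^m)) / 2)"
proof -
  obtain s where s: "\<forall>k\<ge>\<kappa> n. s k = 0"
    "\<And>V::nat\<Rightarrow>real. (\<Sum>k<\<kappa> n. s k * (V (Suc k) - V k)) = (\<Sum>i<n. u i * (V (\<kappa> (Suc i)) - V (\<kappa> i)))"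
    "(\<Sum>k<\<kappa> n. (s k)\<^sup>2) = (\<Sum>i<n. (u i)\<^sup>2 * (real (\<kappa> (Suc i)) - real (\<kappa> i)))"
    using step_coefficients[of n \<kappa> u] assms by auto
  \<comment> \<open>Any \<open>K\<close> with \<open>\<kappa> n \<le> K * 2 ^ m\<close> would do:
    the coefficients beyond \<open>\<kappa> n\<close> vanish.\<close>
  define K where "K = \<kappa> n"
  have "\<kappa> n \<le> K * 2 ^ m" by (simp add: K_def)
  then have ext: "(\<Sum>k<K * 2 ^ m. f (s k) k) = (\<Sum>k<\<kappa> n. f (s k) k)" if "\<And>k. f 0 k = 0" for f :: "real \<Rightarrow> nat \<Rightarrow> real"
    using that s(1) by (intro sum.mono_neutral_right) auto
  have "(CLINT \<omega>|gauss_space. iexp (\<Sum>i<n. u i * (levy_path (gauss_array \<omega>) (\<kappa> (Suc i) / 2^m) - levy_path (gauss_array \<omega>) (\<kappa> i / 2^m))))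
     = (CLINT \<omega>|gauss_space. iexp ((\<Sum>k<K * 2^m. s k * (dyadic_value (gauss_array \<omega>) m (Suc k) - dyadic_value (gauss_array \<omega>) m k)) + (\<Sum>p\<in>{}. 0 * gauss_array \<omega> p)))"
  proof (rule integral_cong_AE)
    show "AE \<omega> in gauss_space. iexp (\<Sum>i<n. u i * (levy_path (gauss_array \<omega>) (\<kappa> (Suc i) / 2^m) - levy_path (gauss_array \<omega>) (\<kappa> i / 2^m)))
      = iexp ((\<Sum>k<K * 2^m. s k * (dyadic_value (gauss_array \<omega>) m (Suc k) - dyadic_value (gauss_array \<omega>) m k)) + (\<Sum>p\<in>{}. 0 * gauss_array \<omega> p))"
      using AE_tame
    proof eventually_elim
      case (elim \<omega>)
      show ?case
        unfolding ext[of "\<lambda>x k. x * (dyadic_value (gauss_array \<omega>) m (Suc k) - dyadic_value (gauss_array \<omega>) m k)", OF mult_zero_left] s(2)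
          levy_path_dyadic[OF elim] by simp
    qed
  qed measurable
  also have "\<dots> = exp (- ((\<Sum>k<K * 2^m. (s k)\<^sup>2) / 2^m + (\<Sum>p\<in>({}::(nat\<times>nat) set). (0::real)\<^sup>2)) / 2)"
    by (rule dyadic_cf) auto
  also have "(\<Sum>k<K * 2^m. (s k)\<^sup>2) / 2^m + (\<Sum>p\<in>({}::(nat\<times>nat) set). (0::real)\<^sup>2) = (\<Sum>i<n. (u i)\<^sup>2 * (\<kappa> (Suc i) / 2^m - \<kappa> i / 2^m))"
    using s(3) ext[of "\<lambda>x k. x^2"] by (simp add: sum_divide_distrib diff_divide_distrib right_diff_distrib)
  finally show ?thesis .
qed

text \<open>The times are approximated from below by dyadic ones; continuity of the paths and
  dominated convergence carry the formula over to the limit.\<close>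

lemma levy_path_cf:
  fixes t :: "nat \<Rightarrow> real"
  assumes "\<And>i. i < n \<Longrightarrow> t i \<le> t (Suc i)" "\<And>i. i \<le> n \<Longrightarrow> 0 \<le> t i"
  shows "(CLINT \<omega>|gauss_space. iexp (\<Sum>i<n. u i * (levy_path (gauss_array \<omega>) (t (Suc i)) - levy_path (gauss_array \<omega>) (t i))))
     = exp (- (\<Sum>i<n. (u i)\<^sup>2 * (t (Suc i) - t i)) / 2)"
proof -
  define \<kappa> where "\<kappa> m i = nat \<lfloor>2 ^ m * t i\<rfloor>" for m i
  have \<kappa>_mono: "\<kappa> m i \<le> \<kappa> m (Suc i)" if "i < n" for m i
    using assms(1)[OF that] unfolding \<kappa>_def by (intro nat_mono floor_mono mult_left_mono) auto
  have \<kappa>_lim: "(\<lambda>m. real (\<kappa> m i) / 2 ^ m) \<longlonglongrightarrow> t i" if "i \<le> n" for i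
  proof (rule tendsto_sandwich)
    have k: "real (\<kappa> m i) \<le> 2 ^ m * t i" "2 ^ m * t i - 1 \<le> real (\<kappa> m i)" for m
      using assms(2)[OF that] unfolding \<kappa>_def by (auto simp: of_nat_nat)
    show "\<forall>\<^sub>F m in sequentially. real (\<kappa> m i) / 2 ^ m \<le> t i"
      using k(1) by (simp add: field_simps)
    have "t i - (1/2)^m = (2 ^ m * t i - 1) / 2 ^ m" for m
      by (simp add: field_simps power_divide)
    then show "\<forall>\<^sub>F m in sequentially. t i - (1/2)^m \<le> real (\<kappa> m i) / 2 ^ m"
      using k(2) by (simp add: divide_right_mono)
    have "(\<lambda>m. t i - (1/2)^m) \<longlonglongrightarrow> t i - 0"
      by (intro tendsto_intros LIMSEQ_power_zero) auto
    then show "(\<lambda>m. t i - (1/2)^m) \<longlonglongrightarrow> t i" by simp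
  qed auto
  have B_lim: "(\<lambda>m. levy_path z (real (\<kappa> m i) / 2 ^ m)) \<longlonglongrightarrow> levy_path z (t i)" if "i \<le> n" for i z
    by (rule continuous_on_tendsto_compose[OF levy_path_continuous \<kappa>_lim[OF that]])
       (use assms(2)[OF that] in auto)
  have "(\<lambda>m. CLINT \<omega>|gauss_space. iexp (\<Sum>i<n. u i * (levy_path (gauss_array \<omega>) (\<kappa> m (Suc i) / 2^m) - levy_path (gauss_array \<omega>) (\<kappa> m i / 2^m))))
     \<longlonglongrightarrow> (CLINT \<omega>|gauss_space. iexp (\<Sum>i<n. u i * (levy_path (gauss_array \<omega>) (t (Suc i)) - levy_path (gauss_array \<omega>) (t i))))"
  proof (rule integral_dominated_convergence[where w="\<lambda>_. 1"])
    show "AE \<omega> in gauss_space. (\<lambda>m. iexp (\<Sum>i<n. u i * (levy_path (gauss_array \<omega>) (\<kappa> m (Suc i) / 2^m) - levy_path (gauss_array \<omega>) (\<kappa> m i / 2^m))))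
      \<longlonglongrightarrow> iexp (\<Sum>i<n. u i * (levy_path (gauss_array \<omega>) (t (Suc i)) - levy_path (gauss_array \<omega>) (t i)))"
      by (intro AE_I2 tendsto_intros B_lim) auto
  qed auto
  moreover have "(\<lambda>m. complex_of_real (exp (- (\<Sum>i<n. (u i)\<^sup>2 * (\<kappa> m (Suc i) / 2^m - \<kappa> m i / 2^m)) / 2)))
     \<longlonglongrightarrow> complex_of_real (exp (- (\<Sum>i<n. (u i)\<^sup>2 * (t (Suc i) - t i)) / 2))"
    by (intro tendsto_intros \<kappa>_lim) auto
  ultimately show ?thesis
    using levy_path_dyadic_cf[of n "\<kappa> _" u] \<kappa>_mono by (simp add: LIMSEQ_unique)
qed

abbreviation normal_measure :: "real \<Rightarrow> real measure" where
  "normal_measure \<sigma> \<equiv> density lborel (\<lambda>x. ennreal (normal_density 0 \<sigma> x))"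

lemma normal_measure_distr:
  assumes "\<sigma> > 0"
  shows "normal_measure \<sigma> = distr std_normal_distribution borel (\<lambda>x. \<sigma> * x)"
proof -
  have "distributed std_normal_distribution lborel (\<lambda>x. x) std_normal_density"
    by (auto simp: distributed_def intro!: measure_eqI simp: emeasure_distr)
  from std_normal.normal_density_affine[OF this, of \<sigma> 0] assms
  have "distributed std_normal_distribution lborel (\<lambda>x. \<sigma> * x) (normal_density 0 \<sigma>)" by simp
  then have "distr std_normal_distribution lborel (\<lambda>x. \<sigma> * x) = normal_measure \<sigma>"
    by (simp add: distributed_def)
  moreover have "distr std_normal_distribution lborel (\<lambda>x. \<sigma> * x) = distr std_normal_distribution borel (\<lambda>x. \<sigma> * x)"
    by (rule distr_cong) auto
  ultimately show ?thesis by simp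
qed

lemma real_distribution_normal_measure: "\<sigma> > 0 \<Longrightarrow> real_distribution (normal_measure \<sigma>)"
  by (subst normal_measure_distr) (simp_all add: std_normal.real_distribution_distr)

lemma char_normal_measure:
  assumes "\<sigma> > 0"
  shows "char (normal_measure \<sigma>) u = exp (- (u\<^sup>2 * \<sigma>\<^sup>2) / 2)"
proof -
  have "char (normal_measure \<sigma>) u = char std_normal_distribution (u * \<sigma>)"
    unfolding normal_measure_distr[OF assms] char_def by (subst integral_distr) (auto simp: mult.assoc)
  then show ?thesis by (simp add: char_std_normal_distribution power_mult_distrib)
qed

theorem standard_brownian_motion_exists:
  "standard_brownian_motion gauss_space (\<lambda>t \<omega>. levy_path (gauss_array \<omega>) t)"
  unfolding standard_brownian_motion_def
proof (intro conjI allI impI ballI)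
  show "prob_space gauss_space" by unfold_locales
  show "levy_path (gauss_array \<omega>) 0 = 0" for \<omega> by (rule levy_path_0)
  show "continuous_on {0..} (\<lambda>t. levy_path (gauss_array \<omega>) t)" for \<omega> by (rule levy_path_continuous)
  show "(\<lambda>\<omega>. levy_path (gauss_array \<omega>) t) \<in> borel_measurable gauss_space" for t by measurable
  \<comment> \<open>Both remaining clauses of the definition follow from this product formula: the
    normal law of an increment is the case \<open>n = 1\<close>, and independence is the general
    case.\<close>
  have fdd: "measure gauss_space {\<omega>\<in>space gauss_space. \<forall>i<n. levy_path (gauss_array \<omega>) (t (Suc i)) - levy_path (gauss_array \<omega>) (t i) \<in> A i}
    = (\<Prod>i<n. measure (normal_measure (sqrt (t (Suc i) - t i))) (A i))"
    if t: "0 \<le> t 0" "\<forall>i<n. t i < t (Suc i)" and A: "\<And>i. i < n \<Longrightarrow> A i \<in> sets borel" for n and t :: "nat \<Rightarrow> real" and A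
  proof (rule cf_product_measure)
    have pos: "0 \<le> t i" if "i \<le> n" for i
      using that by (induction i) (use t in \<open>auto intro: order_trans less_imp_le\<close>, smt (verit) Suc_le_lessD)
    fix u
    have "(CLINT \<omega>|gauss_space. iexp (\<Sum>i<n. u i * (levy_path (gauss_array \<omega>) (t (Suc i)) - levy_path (gauss_array \<omega>) (t i))))
      = exp (- (\<Sum>i<n. (u i)\<^sup>2 * (t (Suc i) - t i)) / 2)"
      by (rule levy_path_cf) (use t pos in \<open>auto intro: less_imp_le\<close>)
    also have "- (\<Sum>i<n. (u i)\<^sup>2 * (t (Suc i) - t i)) / 2 = (\<Sum>i<n. - ((u i)\<^sup>2 * (t (Suc i) - t i)) / 2)"
      by (simp add: sum_negf sum_divide_distrib)
    also have "complex_of_real (exp \<dots>) = (\<Prod>i<n. complex_of_real (exp (- ((u i)\<^sup>2 * (t (Suc i) - t i)) / 2)))"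
      by (simp add: exp_sum)
    also have "\<dots> = (\<Prod>i<n. char (normal_measure (sqrt (t (Suc i) - t i))) (u i))"
      by (rule prod.cong) (use t in \<open>simp_all add: char_normal_measure less_imp_le\<close>)
    finally show "(CLINT \<omega>|gauss_space. iexp (\<Sum>i<n. u i * (levy_path (gauss_array \<omega>) (t (Suc i)) - levy_path (gauss_array \<omega>) (t i)))) = \<dots>" .
  qed (use t A in \<open>auto intro!: real_distribution_normal_measure gauss.prob_space_axioms\<close>)
  have one: "measure gauss_space ((\<lambda>\<omega>. levy_path (gauss_array \<omega>) t - levy_path (gauss_array \<omega>) s) -` A \<inter> space gauss_space)
    = measure (normal_measure (sqrt (t - s))) A"
    if "0 \<le> s" "s < t" "A \<in> sets borel" for s t A
    using fdd[of "\<lambda>i. if i = 0 then s else t" 1 "\<lambda>_. A"] that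
    by (simp add: vimage_def Int_def conj_commute)
  show "distributed gauss_space lborel (\<lambda>\<omega>. levy_path (gauss_array \<omega>) t - levy_path (gauss_array \<omega>) s) (normal_density 0 (sqrt (t - s)))"
    if "0 \<le> s \<and> s < t" for s t
  proof -
    interpret nm: real_distribution "normal_measure (sqrt (t - s))"
      by (rule real_distribution_normal_measure) (use that in simp)
    have "distr gauss_space lborel (\<lambda>\<omega>. levy_path (gauss_array \<omega>) t - levy_path (gauss_array \<omega>) s) = normal_measure (sqrt (t - s))"
      by (rule measure_eqI)
         (use that one in \<open>auto simp: emeasure_distr gauss.emeasure_eq_measure nm.emeasure_eq_measure\<close>)
    then show ?thesis by (auto simp: distributed_def)
  qed
  show "gauss.indep_vars (\<lambda>_. borel) (\<lambda>i \<omega>. levy_path (gauss_array \<omega>) (t (Suc i)) - levy_path (gauss_array \<omega>) (t i)) {..<n}"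
    if t: "0 \<le> t 0 \<and> (\<forall>i<n. t i < t (Suc i))" for n and t :: "nat \<Rightarrow> real"
  proof (cases "n = 0")
    case True
    then show ?thesis by (simp add: gauss.indep_vars_def gauss.indep_sets_def)
  next
    case False
    have pos: "0 \<le> t i" if "i \<le> n" for i
      using that by (induction i) (use t in \<open>auto intro: order_trans less_imp_le\<close>, smt (verit) Suc_le_lessD)
    show ?thesis
    proof (subst gauss.indep_vars_finite[where E="\<lambda>_. sets borel"])
      show "\<forall>A\<in>{..<n} \<rightarrow> sets borel. gauss.prob (\<Inter>j\<in>{..<n}. (\<lambda>\<omega>. levy_path (gauss_array \<omega>) (t (Suc j)) - levy_path (gauss_array \<omega>) (t j)) -` A j \<inter> space gauss_space) =
        (\<Prod>j\<in>{..<n}. gauss.prob ((\<lambda>\<omega>. levy_path (gauss_array \<omega>) (t (Suc j)) - levy_path (gauss_array \<omega>) (t j)) -` A j \<inter> space gauss_space))"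
      proof
        fix A assume "A \<in> {..<n} \<rightarrow> sets (borel :: real measure)"
        then have A: "\<And>i. i < n \<Longrightarrow> A i \<in> sets borel" by auto
        define D where "D j \<omega> = levy_path (gauss_array \<omega>) (t (Suc j)) - levy_path (gauss_array \<omega>) (t j)" for j \<omega>
        have eq: "(\<Inter>j\<in>{..<n}. D j -` A j \<inter> space gauss_space) = {\<omega>\<in>space gauss_space. \<forall>i<n. D i \<omega> \<in> A i}"
        proof (intro set_eqI iffI)
          fix \<omega> assume "\<omega> \<in> (\<Inter>j\<in>{..<n}. D j -` A j \<inter> space gauss_space)"
          then have *: "\<omega> \<in> D j -` A j \<inter> space gauss_space" if "j < n" for j
            using that by blast
          show "\<omega> \<in> {\<omega>\<in>space gauss_space. \<forall>i<n. D i \<omega> \<in> A i}"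
            using * False by blast
        qed blast
        have "gauss.prob {\<omega>\<in>space gauss_space. \<forall>i<n. D i \<omega> \<in> A i} = (\<Prod>i<n. measure (normal_measure (sqrt (t (Suc i) - t i))) (A i))"
          unfolding D_def by (rule fdd) (use t A in blast)+
        also have "\<dots> = (\<Prod>j<n. gauss.prob (D j -` A j \<inter> space gauss_space))"
        proof (rule prod.cong[OF refl])
          fix j assume "j \<in> {..<n}"
          then show "measure (normal_measure (sqrt (t (Suc j) - t j))) (A j) = gauss.prob (D j -` A j \<inter> space gauss_space)"
            unfolding D_def using one[of "t j" "t (Suc j)" "A j"] t A pos by simp
        qed
        finally have F: "gauss.prob {\<omega>\<in>space gauss_space. \<forall>i<n. D i \<omega> \<in> A i} = (\<Prod>j<n. gauss.prob (D j -` A j \<inter> space gauss_space))" .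
        show "gauss.prob (\<Inter>j\<in>{..<n}. (\<lambda>\<omega>. levy_path (gauss_array \<omega>) (t (Suc j)) - levy_path (gauss_array \<omega>) (t j)) -` A j \<inter> space gauss_space) =
        (\<Prod>j\<in>{..<n}. gauss.prob ((\<lambda>\<omega>. levy_path (gauss_array \<omega>) (t (Suc j)) - levy_path (gauss_array \<omega>) (t j)) -` A j \<inter> space gauss_space))"
          unfolding eq[unfolded D_def] using F unfolding D_def .
      qed
    next
      show "{..<n} \<noteq> {}" using False by (simp add: lessThan_empty_iff)
    qed (simp, rule sets.sigma_sets_eq[symmetric], measurable, rule sets.Int_stable, rule sets.top, rule sets.space_closed)
  qed
qed

section \<open>Normal approximation for the chain\<close>

definition sgn_of :: "bool \<Rightarrow> real" where
  "sgn_of b = (if b then 1 else -1)"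

text \<open>
  \<open>incr p b c\<close> is \<open>(X - \<rho> X') / (1 - \<rho>)\<close> for consecutive signs \<open>X' = b\<close> and \<open>X = c\<close>, where \<open>\<rho> = 2p - 1\<close>. Its
  conditional variance given \<open>b\<close> is \<open>p / (1 - p)\<close> for both values of \<open>b\<close>.
\<close>

definition incr :: "real \<Rightarrow> bool \<Rightarrow> bool \<Rightarrow> real" where
  "incr p b c = (if c = b then sgn_of b else - (p / (1 - p)) * sgn_of b)"

text \<open>
  A path is the list of signs that follow a given initial sign \<open>b\<close>.
\<close>

fun path_weight :: "real \<Rightarrow> bool \<Rightarrow> bool list \<Rightarrow> real" where
  "path_weight p b [] = 1"
| "path_weight p b (c # l) = (if c = b then p else 1 - p) * path_weight p c l"

definition paths :: "nat \<Rightarrow> bool list set" where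
  "paths m = {l. length l = m}"

definition path_exp :: "real \<Rightarrow> bool \<Rightarrow> nat \<Rightarrow> (bool list \<Rightarrow> real) \<Rightarrow> real" where
  "path_exp p b m f = (\<Sum>l\<in>paths m. path_weight p b l * f l)"

fun path_sum :: "real \<Rightarrow> (nat \<Rightarrow> real) \<Rightarrow> bool \<Rightarrow> bool list \<Rightarrow> real" where
  "path_sum p a b [] = 0"
| "path_sum p a b (c # l) = a 0 * incr p b c + path_sum p (\<lambda>i. a (Suc i)) c l"

lemma finite_paths [simp]: "finite (paths m)"
  unfolding paths_def using finite_lists_length_eq[of "UNIV :: bool set" m] by simp

lemma paths_0 [simp]: "paths 0 = {[]}"
  by (auto simp: paths_def)

lemma sum_paths_Suc:
  "(\<Sum>l\<in>paths (Suc m). f l) = (\<Sum>l\<in>paths m. f (b # l)) + (\<Sum>l\<in>paths m. f ((\<not> b) # l) :: real)"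
proof -
  have *: "paths (Suc m) = (#) b ` paths m \<union> (#) (\<not> b) ` paths m"
  proof (intro set_eqI iffI)
    fix l assume "l \<in> paths (Suc m)"
    then obtain c l' where "l = c # l'" "l' \<in> paths m"
      by (auto simp: paths_def length_Suc_conv)
    then show "l \<in> (#) b ` paths m \<union> (#) (\<not> b) ` paths m" by (cases "c = b") auto
  qed (auto simp: paths_def)
  show ?thesis unfolding *
    by (subst sum.union_disjoint) (auto simp: sum.reindex)
qed

lemma path_exp_0 [simp]: "path_exp p b 0 f = f []"
  by (simp add: path_exp_def)

lemma path_exp_Suc:
  "path_exp p b (Suc m) f = p * path_exp p b m (\<lambda>l. f (b # l)) + (1 - p) * path_exp p (\<not> b) m (\<lambda>l. f ((\<not> b) # l))"
  unfolding path_exp_def sum_paths_Suc[of _ _ b] by (simp add: sum_distrib_left mult.assoc)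

lemma path_exp_diff: "path_exp p b m f - path_exp p b m g = path_exp p b m (\<lambda>l. f l - g l)"
  by (simp add: path_exp_def sum_subtractf algebra_simps)

lemma path_weight_nonneg: "0 \<le> p \<Longrightarrow> p \<le> 1 \<Longrightarrow> 0 \<le> path_weight p b l"
  by (induction l arbitrary: b) auto

lemma path_exp_const [simp]: "path_exp p b m (\<lambda>_. c) = c"
  by (induction m arbitrary: b) (auto simp: path_exp_Suc algebra_simps)

lemma path_exp_mono:
  assumes "0 \<le> p" "p \<le> 1" "\<And>l. length l = m \<Longrightarrow> f l \<le> g l"
  shows "path_exp p b m f \<le> path_exp p b m g"
  unfolding path_exp_def using assms by (intro sum_mono mult_left_mono path_weight_nonneg) (auto simp: paths_def)

lemma path_exp_abs_diff_le:
  assumes "0 \<le> p" "p \<le> 1" "\<And>l. \<bar>f l - g l\<bar> \<le> c"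
  shows "\<bar>path_exp p b m f - path_exp p b m g\<bar> \<le> c"
proof -
  have "f l - g l \<le> c" "- c \<le> f l - g l" for l using assms(3)[of l] by linarith+
  then have "path_exp p b m (\<lambda>l. f l - g l) \<le> path_exp p b m (\<lambda>_. c)"
    "path_exp p b m (\<lambda>_. - c) \<le> path_exp p b m (\<lambda>l. f l - g l)"
    by (intro path_exp_mono assms; simp)+
  then show ?thesis unfolding path_exp_diff by simp
qed

section \<open>Gaussian averages of functions\<close>

abbreviation std_gauss :: "real measure" where
  "std_gauss \<equiv> std_normal_distribution"

lemma std_gauss_moments:
  "integrable std_gauss (\<lambda>y. y)" "integrable std_gauss (\<lambda>y. y\<^sup>2)" "integrable std_gauss (\<lambda>y. \<bar>y\<bar>)" "integrable std_gauss (\<lambda>y. \<bar>y\<bar> ^ 3)"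
  "(LINT y|std_gauss. y) = 0" "(LINT y|std_gauss. y\<^sup>2) = 1"
proof -
  show "integrable std_gauss (\<lambda>y. y)" "integrable std_gauss (\<lambda>y. y\<^sup>2)"
    using integrable_std_normal_moment[of 1] integrable_std_normal_moment[of 2] by (simp_all add: integrable_density)
  show "integrable std_gauss (\<lambda>y. \<bar>y\<bar>)" "integrable std_gauss (\<lambda>y. \<bar>y\<bar> ^ 3)"
    using integrable_std_normal_moment_abs[of 1] integrable_std_normal_moment_abs[of 3] by (simp_all add: integrable_density)
  show "(LINT y|std_gauss. y) = 0"
    using integral_std_normal_moment_odd[of 0] by (simp add: integral_density)
  show "(LINT y|std_gauss. y\<^sup>2) = 1"
    using integral_std_normal_moment_even[of 1] by (simp add: integral_density fact_numeral)
qed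

text \<open>A class that contains the Lipschitz functions, consists of functions integrable against
  Gaussian laws, and is stable under affine substitution and Gaussian averaging.\<close>

definition linear_growth :: "(real \<Rightarrow> real) \<Rightarrow> bool" where
  "linear_growth f \<longleftrightarrow> f \<in> borel_measurable borel \<and> (\<exists>K. \<forall>x. \<bar>f x\<bar> \<le> K * (1 + \<bar>x\<bar>))"

lemma linear_growth_affine:
  assumes "linear_growth f"
  shows "linear_growth (\<lambda>y. f (x + s * y))"
proof -
  obtain K where [measurable]: "f \<in> borel_measurable borel" and K: "\<And>x. \<bar>f x\<bar> \<le> K * (1 + \<bar>x\<bar>)"
    using assms by (auto simp: linear_growth_def)
  have K0: "K \<ge> 0" using K[of 0] by simp
  have "\<bar>f (x + s * y)\<bar> \<le> (K * (1 + \<bar>x\<bar> + \<bar>s\<bar>)) * (1 + \<bar>y\<bar>)" for y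
  proof -
    have "\<bar>x + s * y\<bar> \<le> \<bar>x\<bar> + \<bar>s\<bar> * \<bar>y\<bar>" using abs_triangle_ineq[of x "s * y"] by (simp add: abs_mult)
    moreover have "0 \<le> \<bar>x\<bar> * \<bar>y\<bar>" "0 \<le> \<bar>s\<bar>" "0 \<le> \<bar>y\<bar>" by simp_all
    ultimately have "1 + \<bar>x + s * y\<bar> \<le> (1 + \<bar>x\<bar> + \<bar>s\<bar>) * (1 + \<bar>y\<bar>)" unfolding ring_distribs by linarith
    with K0 have "K * (1 + \<bar>x + s * y\<bar>) \<le> K * ((1 + \<bar>x\<bar> + \<bar>s\<bar>) * (1 + \<bar>y\<bar>))" by (intro mult_left_mono)
    with K[of "x + s * y"] show ?thesis by (simp add: mult.assoc)
  qed
  then show ?thesis unfolding linear_growth_def by auto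
qed

lemma linear_growth_integrable:
  assumes "linear_growth f"
  shows "integrable std_gauss f"
proof -
  obtain K where [measurable]: "f \<in> borel_measurable borel" and K: "\<And>x. \<bar>f x\<bar> \<le> K * (1 + \<bar>x\<bar>)"
    using assms by (auto simp: linear_growth_def)
  show ?thesis
  proof (rule Bochner_Integration.integrable_bound)
    show "integrable std_gauss (\<lambda>x. K * (1 + \<bar>x\<bar>))"
      using std_gauss_moments(3) by (intro integrable_mult_right Bochner_Integration.integrable_add) auto
    show "AE x in std_gauss. norm (f x) \<le> norm (K * (1 + \<bar>x\<bar>))"
      using K by (intro AE_I2) (simp, smt (verit) K)
  qed simp
qed

text \<open>Under the product measure, \<open>s * y + t * y'\<close> has the characteristic function
  of a centred normal variable with variance \<open>s ^ 2 + t ^ 2\<close>. Uniqueness and Fubini's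
  theorem give the identity.\<close>

lemma std_gauss_convolution:
  assumes "linear_growth f"
  shows "(LINT y|std_gauss. LINT y'|std_gauss. f (x + s * y + t * y')) = (LINT w|std_gauss. f (x + sqrt (s\<^sup>2 + t\<^sup>2) * w))"
proof -
  interpret P: pair_prob_space std_gauss std_gauss by unfold_locales
  let ?P = "std_gauss \<Otimes>\<^sub>M std_gauss"
  have [measurable]: "f \<in> borel_measurable borel" using assms by (simp add: linear_growth_def)
  have [measurable]: "(\<lambda>z. s * fst z + t * snd z) \<in> borel_measurable ?P"
    by (simp cong: measurable_cong_sets sets_pair_measure_cong)
  define D where "D = distr ?P borel (\<lambda>z. s * fst z + t * snd z)"
  define D' where "D' = distr std_gauss borel (\<lambda>w. sqrt (s\<^sup>2 + t\<^sup>2) * w)"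
  have "D = D'"
  proof (rule Levy_uniqueness)
    show "real_distribution D" unfolding D_def by (rule P.real_distribution_distr) simp
    show "real_distribution D'" unfolding D'_def by (rule std_normal.real_distribution_distr) simp
    show "char D = char D'"
    proof
      fix u
      have i: "integrable ?P (\<lambda>z. iexp (u * (s * fst z + t * snd z)))"
        by (rule P.integrable_iexp) auto
      have "char D u = (CLINT z|?P. iexp (u * (s * fst z + t * snd z)))"
        unfolding D_def char_def by (subst integral_distr) auto
      also have "\<dots> = (CLINT y|std_gauss. CLINT y'|std_gauss. iexp (u * (s * y + t * y')))"
        using P.integral_fst'[OF i] by simp
      also have "\<dots> = (CLINT y|std_gauss. CLINT y'|std_gauss. iexp ((u * s) * y) * iexp ((u * t) * y'))"
        by (simp add: exp_add[symmetric] algebra_simps)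
      also have "\<dots> = char std_gauss (u * s) * char std_gauss (u * t)"
        unfolding char_def by simp
      also have "\<dots> = char std_gauss (u * sqrt (s\<^sup>2 + t\<^sup>2))"
        unfolding char_std_normal_distribution of_real_mult[symmetric] exp_add[symmetric]
        by (simp add: power_mult_distrib field_simps)
      also have "\<dots> = char D' u"
        unfolding D'_def char_def by (subst integral_distr) (auto simp: mult.assoc)
      finally show "char D u = char D' u" .
    qed
  qed
  have lg: "linear_growth (\<lambda>w. f (x + 1 * w))" by (rule linear_growth_affine[OF assms])
  have "integrable D' (\<lambda>w. f (x + 1 * w))"
    unfolding D'_def using linear_growth_integrable[OF linear_growth_affine[OF assms, of x "sqrt (s\<^sup>2 + t\<^sup>2)"]]
    by (subst integrable_distr_eq) auto
  then have "integrable ?P (\<lambda>z. f (x + 1 * (s * fst z + t * snd z)))"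
    unfolding \<open>D = D'\<close>[symmetric] D_def by (subst (asm) integrable_distr_eq) auto
  from P.integral_fst'[OF this]
  have "(LINT y|std_gauss. LINT y'|std_gauss. f (x + s * y + t * y')) = (LINT z|?P. f (x + 1 * (s * fst z + t * snd z)))"
    by (simp add: add.assoc)
  also have "\<dots> = (LINT w|D. f (x + 1 * w))"
    unfolding D_def by (subst integral_distr) auto
  also have "\<dots> = (LINT w|std_gauss. f (x + sqrt (s\<^sup>2 + t\<^sup>2) * w))"
    unfolding \<open>D = D'\<close> D'_def by (subst integral_distr) auto
  finally show ?thesis .
qed

text \<open>The heat semigroup, indexed by the standard deviation instead of the variance.\<close>

definition gauss_avg :: "real \<Rightarrow> (real \<Rightarrow> real) \<Rightarrow> real \<Rightarrow> real" where
  "gauss_avg s f x = (LINT y|std_gauss. f (x + s * y))"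

lemma gauss_avg_semigroup:
  "linear_growth f \<Longrightarrow> gauss_avg s (gauss_avg t f) x = gauss_avg (sqrt (s\<^sup>2 + t\<^sup>2)) f x"
  unfolding gauss_avg_def by (rule std_gauss_convolution)

lemma linear_growth_gauss_avg:
  assumes "linear_growth f"
  shows "linear_growth (gauss_avg s f)"
proof -
  obtain K where [measurable]: "f \<in> borel_measurable borel" and K: "\<And>x. \<bar>f x\<bar> \<le> K * (1 + \<bar>x\<bar>)"
    using assms by (auto simp: linear_growth_def)
  have K0: "K \<ge> 0" using K[of 0] by simp
  define m where "m = (LINT y|std_gauss. \<bar>y\<bar>)"
  have m0: "m \<ge> 0" by (simp add: m_def)
  have [measurable]: "gauss_avg s f \<in> borel_measurable borel"
    unfolding gauss_avg_def by (rule std_normal.borel_measurable_lebesgue_integral) measurable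
  have "\<bar>gauss_avg s f x\<bar> \<le> (K * (1 + \<bar>s\<bar> * m)) * (1 + \<bar>x\<bar>)" for x
  proof -
    have "\<bar>gauss_avg s f x\<bar> \<le> (LINT y|std_gauss. \<bar>f (x + s * y)\<bar>)"
      unfolding gauss_avg_def by (rule integral_abs_bound)
    also have "\<dots> \<le> (LINT y|std_gauss. K * (1 + \<bar>x\<bar> + \<bar>s\<bar> * \<bar>y\<bar>))"
    proof (rule integral_mono)
      show "integrable std_gauss (\<lambda>y. \<bar>f (x + s * y)\<bar>)"
        by (intro integrable_abs linear_growth_integrable linear_growth_affine assms)
      show "integrable std_gauss (\<lambda>y. K * (1 + \<bar>x\<bar> + \<bar>s\<bar> * \<bar>y\<bar>))"
        using std_gauss_moments(3) by (intro integrable_mult_right Bochner_Integration.integrable_add) auto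
      fix y
      have "\<bar>x + s * y\<bar> \<le> \<bar>x\<bar> + \<bar>s\<bar> * \<bar>y\<bar>" using abs_triangle_ineq[of x "s * y"] by (simp add: abs_mult)
      then have "K * (1 + \<bar>x + s * y\<bar>) \<le> K * (1 + \<bar>x\<bar> + \<bar>s\<bar> * \<bar>y\<bar>)" using K0 by (intro mult_left_mono) auto
      with K[of "x + s * y"] show "\<bar>f (x + s * y)\<bar> \<le> K * (1 + \<bar>x\<bar> + \<bar>s\<bar> * \<bar>y\<bar>)" by linarith
    qed
    also have "\<dots> = K * (1 + \<bar>x\<bar> + \<bar>s\<bar> * m)"
      using std_gauss_moments(3) std_normal.prob_space by (simp add: m_def)
    also have "\<dots> \<le> (K * (1 + \<bar>s\<bar> * m)) * (1 + \<bar>x\<bar>)"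
    proof -
      have "0 \<le> K * (\<bar>s\<bar> * m * \<bar>x\<bar>)" using K0 m0 by simp
      then show ?thesis by (simp add: algebra_simps)
    qed
    finally show ?thesis .
  qed
  then show ?thesis unfolding linear_growth_def by auto
qed

text \<open>
  A third-order Taylor bound without any differentiability: this form is stable under averaging.
\<close>

definition taylor3 :: "real \<Rightarrow> (real \<Rightarrow> real) \<Rightarrow> (real \<Rightarrow> real) \<Rightarrow> (real \<Rightarrow> real) \<Rightarrow> bool" where
  "taylor3 L g g1 g2 \<longleftrightarrow> linear_growth g \<and> linear_growth g1 \<and> linear_growth g2 \<and>
     (\<forall>x d. \<bar>g (x + d) - g x - g1 x * d - g2 x * d\<^sup>2 / 2\<bar> \<le> L * \<bar>d\<bar> ^ 3)"

text \<open>The bound at the point \<open>x + s * y\<close> is integrated over \<open>y\<close>. The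
  constant survives because it does not depend on the point.\<close>

lemma taylor3_gauss_avg:
  assumes "taylor3 L g g1 g2"
  shows "taylor3 L (gauss_avg s g) (gauss_avg s g1) (gauss_avg s g2)"
proof -
  have lg: "linear_growth g" "linear_growth g1" "linear_growth g2"
    and T: "\<And>x d. \<bar>g (x + d) - g x - g1 x * d - g2 x * d\<^sup>2 / 2\<bar> \<le> L * \<bar>d\<bar> ^ 3"
    using assms by (auto simp: taylor3_def)
  have i: "integrable std_gauss (\<lambda>y. f (x + s * y))" if "linear_growth f" for f x
    by (rule linear_growth_integrable[OF linear_growth_affine[OF that]])
  have "\<bar>gauss_avg s g (x + d) - gauss_avg s g x - gauss_avg s g1 x * d - gauss_avg s g2 x * d\<^sup>2 / 2\<bar> \<le> L * \<bar>d\<bar> ^ 3" for x d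
  proof -
    have I: "integrable std_gauss (\<lambda>y. g (x + d + s * y))" "integrable std_gauss (\<lambda>y. g (x + s * y))"
      "integrable std_gauss (\<lambda>y. g1 (x + s * y) * d)" "integrable std_gauss (\<lambda>y. g2 (x + s * y) * d\<^sup>2 / 2)"
      by (intro i lg integrable_mult_left integrable_divide)+
    have e: "gauss_avg s g (x + d) - gauss_avg s g x - gauss_avg s g1 x * d - gauss_avg s g2 x * d\<^sup>2 / 2
      = (LINT y|std_gauss. g (x + d + s * y) - g (x + s * y) - g1 (x + s * y) * d - g2 (x + s * y) * d\<^sup>2 / 2)"
      unfolding gauss_avg_def
      by (simp only: Bochner_Integration.integral_diff I Bochner_Integration.integrable_diff integral_mult_left_zero integral_divide_zero)
    have "\<bar>LINT y|std_gauss. g (x + d + s * y) - g (x + s * y) - g1 (x + s * y) * d - g2 (x + s * y) * d\<^sup>2 / 2\<bar> \<le> (LINT y|std_gauss. \<bar>g (x + d + s * y) - g (x + s * y) - g1 (x + s * y) * d - g2 (x + s * y) * d\<^sup>2 / 2\<bar>)"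
      by (rule integral_abs_bound)
    also have "\<dots> \<le> (LINT y|std_gauss. L * \<bar>d\<bar> ^ 3)"
    proof (rule integral_mono)
      show "integrable std_gauss (\<lambda>y. \<bar>g (x + d + s * y) - g (x + s * y) - g1 (x + s * y) * d - g2 (x + s * y) * d\<^sup>2 / 2\<bar>)"
        by (intro integrable_abs Bochner_Integration.integrable_diff I)
      show "\<bar>g (x + d + s * y) - g (x + s * y) - g1 (x + s * y) * d - g2 (x + s * y) * d\<^sup>2 / 2\<bar> \<le> L * \<bar>d\<bar> ^ 3" for y
      proof -
        have e: "x + d + s * y = x + s * y + d" by simp
        show ?thesis unfolding e by (rule T)
      qed
    qed simp
    also have "\<dots> = L * \<bar>d\<bar> ^ 3" using std_normal.prob_space by simp
    finally show ?thesis unfolding e .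
  qed
  then show ?thesis unfolding taylor3_def by (intro conjI allI linear_growth_gauss_avg lg)
qed

definition gauss_third :: real where
  "gauss_third = (LINT y|std_gauss. \<bar>y\<bar> ^ 3)"

text \<open>The first-order term of the expansion has mean 0 and the second-order term has variance
  1 in it; the remainder is bounded by the third absolute moment.\<close>

lemma gauss_avg_taylor3:
  assumes "taylor3 L g g1 g2" "s \<ge> 0"
  shows "\<bar>gauss_avg s g x - g x - g2 x * s\<^sup>2 / 2\<bar> \<le> L * gauss_third * s ^ 3"
proof -
  have lg: "linear_growth g" and T: "\<And>x d. \<bar>g (x + d) - g x - g1 x * d - g2 x * d\<^sup>2 / 2\<bar> \<le> L * \<bar>d\<bar> ^ 3"
    using assms by (auto simp: taylor3_def)
  have i: "integrable std_gauss (\<lambda>y. g (x + s * y))"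
    by (rule linear_growth_integrable[OF linear_growth_affine[OF lg]])
  have e: "(LINT y|std_gauss. g (x + s * y) - g x - g1 x * (s * y) - g2 x * (s * y)\<^sup>2 / 2) = gauss_avg s g x - g x - g2 x * s\<^sup>2 / 2"
    using i std_gauss_moments std_normal.prob_space by (simp add: gauss_avg_def power_mult_distrib)
  have "\<bar>LINT y|std_gauss. g (x + s * y) - g x - g1 x * (s * y) - g2 x * (s * y)\<^sup>2 / 2\<bar>
     \<le> (LINT y|std_gauss. \<bar>g (x + s * y) - g x - g1 x * (s * y) - g2 x * (s * y)\<^sup>2 / 2\<bar>)"
    by (rule integral_abs_bound)
  also have "\<dots> \<le> (LINT y|std_gauss. L * s ^ 3 * \<bar>y\<bar> ^ 3)"
  proof (rule integral_mono)
    show "integrable std_gauss (\<lambda>y. \<bar>g (x + s * y) - g x - g1 x * (s * y) - g2 x * (s * y)\<^sup>2 / 2\<bar>)"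
      using i std_gauss_moments by (auto simp: power_mult_distrib)
    show "integrable std_gauss (\<lambda>y. L * s ^ 3 * \<bar>y\<bar> ^ 3)" using std_gauss_moments by simp
    show "\<bar>g (x + s * y) - g x - g1 x * (s * y) - g2 x * (s * y)\<^sup>2 / 2\<bar> \<le> L * s ^ 3 * \<bar>y\<bar> ^ 3" for y
      using T[of x "s * y"] assms(2) by (simp add: abs_mult power_mult_distrib mult.assoc)
  qed
  finally show ?thesis unfolding e by (simp add: gauss_third_def mult_ac)
qed

text \<open>The first two summands bound the third absolute moment of a step of the chain; the last
  one is that of the Gaussian step with the same variance.\<close>

definition lindeberg_const :: "real \<Rightarrow> real" where
  "lindeberg_const p = 1 + (p / (1 - p)) ^ 3 + gauss_third * sqrt (p / (1 - p)) ^ 3"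

lemma lindeberg_const_nonneg: "0 < p \<Longrightarrow> p < 1 \<Longrightarrow> 0 \<le> lindeberg_const p"
  unfolding lindeberg_const_def gauss_third_def by (intro add_nonneg_nonneg mult_nonneg_nonneg zero_le_power) auto

text \<open>A step has mean 0 and variance \<open>p / (1 - p)\<close> for either value of
  \<open>b\<close>. It therefore shares its second-order term with the Gaussian step of
  \<open>gauss_avg_taylor3\<close>, and their comparison leaves errors of third order only.\<close>

lemma two_point_taylor3:
  assumes T: "taylor3 L g g1 g2" and p: "0 < p" "p < 1" and L: "L \<ge> 0"
  shows "\<bar>p * g (x + a * incr p b b) + (1 - p) * g (x + a * incr p b (\<not> b)) - g x - g2 x * (p / (1 - p) * a\<^sup>2) / 2\<bar>
    \<le> L * (1 + (p / (1 - p)) ^ 3) * \<bar>a\<bar> ^ 3"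
proof -
  define r where "r = p / (1 - p)"
  have r: "r > 0" "(1 - p) * r = p" using p by (auto simp: r_def)
  define e where "e = a * sgn_of b"
  have e: "\<bar>e\<bar> = \<bar>a\<bar>" "e\<^sup>2 = a\<^sup>2" by (auto simp: e_def sgn_of_def)
  define R where "R d = g (x + d) - g x - g1 x * d - g2 x * d\<^sup>2 / 2" for d
  have R: "\<bar>R d\<bar> \<le> L * \<bar>d\<bar> ^ 3" for d using T by (simp add: taylor3_def R_def)
  have i: "a * incr p b b = e" "a * incr p b (\<not> b) = - r * e"
    by (auto simp: incr_def e_def r_def)
  have "p * g (x + e) + (1 - p) * g (x + - r * e) - g x - g2 x * (r * a\<^sup>2) / 2
      = p * R e + (1 - p) * R (- r * e)
        + g1 x * e * (p - (1 - p) * r) + g2 x * e\<^sup>2 / 2 * (p + ((1 - p) * r) * r - r)"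
    unfolding R_def e(2)[symmetric] by (simp add: power2_eq_square field_simps)
  also have "p + ((1 - p) * r) * r - r = 0"
    unfolding r(2) using r by (simp add: algebra_simps)
  also have "p - (1 - p) * r = 0" using r by simp
  finally have eq: "p * g (x + e) + (1 - p) * g (x + - r * e) - g x - g2 x * (r * a\<^sup>2) / 2 = p * R e + (1 - p) * R (- r * e)"
    by simp
  have "\<bar>p * R e + (1 - p) * R (- r * e)\<bar> \<le> p * \<bar>R e\<bar> + (1 - p) * \<bar>R (- r * e)\<bar>"
    using p abs_triangle_ineq[of "p * R e" "(1 - p) * R (- r * e)"] by (simp add: abs_mult)
  also have "\<dots> \<le> 1 * (L * \<bar>e\<bar> ^ 3) + 1 * (L * \<bar>- r * e\<bar> ^ 3)"
    using p by (intro add_mono mult_mono R) auto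
  also have "\<dots> = L * (1 + r ^ 3) * \<bar>a\<bar> ^ 3"
    using r e by (simp add: abs_mult power_mult_distrib algebra_simps)
  finally show ?thesis unfolding i eq r_def[symmetric] .
qed

text \<open>
  Because the conditional variances are deterministic, the rest of the path can be replaced by an
  independent Gaussian before the first step is compared with a Gaussian.
\<close>

theorem path_lindeberg:
  assumes T: "taylor3 L g g1 g2" and p: "0 < p" "p < 1" and L: "L \<ge> 0"
  shows "\<bar>path_exp p b m (\<lambda>l. g (z + path_sum p a b l)) - gauss_avg (sqrt (p / (1 - p) * (\<Sum>i<m. (a i)\<^sup>2))) g z\<bar>
    \<le> L * lindeberg_const p * (\<Sum>i<m. \<bar>a i\<bar> ^ 3)"
proof (induction m arbitrary: z a b)
  case 0
  have "gauss_avg 0 g z = g z" using std_normal.prob_space by (simp add: gauss_avg_def)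
  then show ?case by simp
next
  case (Suc m)
  define r where "r = p / (1 - p)"
  have r: "r > 0" using p by (auto simp: r_def)
  define a' where "a' i = a (Suc i)" for i
  define \<sigma> where "\<sigma> = sqrt (r * (\<Sum>i<m. (a' i)\<^sup>2))"
  define G where "G = gauss_avg \<sigma> g"
  have TG: "taylor3 L G (gauss_avg \<sigma> g1) (gauss_avg \<sigma> g2)" unfolding G_def by (rule taylor3_gauss_avg[OF T])
  define s where "s = sqrt r * \<bar>a 0\<bar>"
  have s: "s \<ge> 0" "s\<^sup>2 = r * (a 0)\<^sup>2" "s ^ 3 = sqrt r ^ 3 * \<bar>a 0\<bar> ^ 3"
    using r by (simp_all add: s_def power_mult_distrib)
  have \<sigma>2: "\<sigma>\<^sup>2 = r * (\<Sum>i<m. (a' i)\<^sup>2)" using r by (simp add: \<sigma>_def sum_nonneg)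
  have sum: "(\<Sum>i<Suc m. f (a i)) = f (a 0) + (\<Sum>i<m. f (a' i))" for f :: "real \<Rightarrow> real"
    unfolding a'_def by (rule sum.lessThan_Suc_shift)
  \<comment> \<open>The semigroup law splits the full Gaussian average into a first step of
    deviation \<open>s\<close> and the later steps, which are already contained in
    \<open>G\<close>.\<close>
  have "gauss_avg s G z = gauss_avg (sqrt (s\<^sup>2 + \<sigma>\<^sup>2)) g z"
    unfolding G_def using T by (intro gauss_avg_semigroup) (simp add: taylor3_def)
  also have "s\<^sup>2 + \<sigma>\<^sup>2 = r * (\<Sum>i<Suc m. (a i)\<^sup>2)"
    unfolding s \<sigma>2 sum[of "\<lambda>x. x\<^sup>2"] by (simp add: algebra_simps)
  finally have avg: "gauss_avg (sqrt (r * (\<Sum>i<Suc m. (a i)\<^sup>2))) g z = gauss_avg s G z" by simp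
  define E where "E = L * lindeberg_const p * (\<Sum>i<m. \<bar>a' i\<bar> ^ 3)"
  define U where "U c = path_exp p c m (\<lambda>l. g (z + a 0 * incr p b c + path_sum p a' c l))" for c
  have U: "\<bar>U c - G (z + a 0 * incr p b c)\<bar> \<le> E" for c
    unfolding U_def G_def \<sigma>_def E_def r_def by (rule Suc.IH)
  have ex: "path_exp p b (Suc m) (\<lambda>l. g (z + path_sum p a b l)) = p * U b + (1 - p) * U (\<not> b)"
    unfolding path_exp_Suc U_def a'_def by (simp add: add.assoc)
  have "\<bar>(p * U b + (1 - p) * U (\<not> b)) - (p * G (z + a 0 * incr p b b) + (1 - p) * G (z + a 0 * incr p b (\<not> b)))\<bar> \<le> E"
  proof -
    have "p * U b + (1 - p) * U (\<not> b) - (p * G (z + a 0 * incr p b b) + (1 - p) * G (z + a 0 * incr p b (\<not> b)))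
      = p * (U b - G (z + a 0 * incr p b b)) + (1 - p) * (U (\<not> b) - G (z + a 0 * incr p b (\<not> b)))"
      by (simp add: algebra_simps)
    also have "\<bar>\<dots>\<bar> \<le> p * E + (1 - p) * E"
    proof (rule order_trans[OF abs_triangle_ineq add_mono])
      show "\<bar>p * (U b - G (z + a 0 * incr p b b))\<bar> \<le> p * E"
        using p U[of b] by (simp add: abs_mult)
      show "\<bar>(1 - p) * (U (\<not> b) - G (z + a 0 * incr p b (\<not> b)))\<bar> \<le> (1 - p) * E"
        using p U[of "\<not> b"] by (simp add: abs_mult)
    qed
    finally show ?thesis by (simp add: algebra_simps)
  qed
  moreover have "\<bar>p * G (z + a 0 * incr p b b) + (1 - p) * G (z + a 0 * incr p b (\<not> b)) - G z - gauss_avg \<sigma> g2 z * (r * (a 0)\<^sup>2) / 2\<bar>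
      \<le> L * (1 + r ^ 3) * \<bar>a 0\<bar> ^ 3"
    unfolding r_def by (rule two_point_taylor3[OF TG p L])
  moreover have "\<bar>gauss_avg s G z - G z - gauss_avg \<sigma> g2 z * (r * (a 0)\<^sup>2) / 2\<bar> \<le> L * gauss_third * (sqrt r ^ 3 * \<bar>a 0\<bar> ^ 3)"
    using gauss_avg_taylor3[OF TG s(1), of z] unfolding s by simp
  ultimately have "\<bar>p * U b + (1 - p) * U (\<not> b) - gauss_avg s G z\<bar> \<le> E + L * (1 + r ^ 3) * \<bar>a 0\<bar> ^ 3 + L * gauss_third * (sqrt r ^ 3 * \<bar>a 0\<bar> ^ 3)"
    by linarith
  also have "\<dots> = L * lindeberg_const p * (\<Sum>i<Suc m. \<bar>a i\<bar> ^ 3)"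
    unfolding E_def sum[of "\<lambda>x. \<bar>x\<bar> ^ 3"] lindeberg_const_def r_def[symmetric] by (simp add: algebra_simps)
  finally show ?case unfolding ex r_def[symmetric] avg .
qed

section \<open>Smoothing of Lipschitz test functions\<close>

lemma continuous_antiderivative:
  fixes f :: "real \<Rightarrow> real"
  assumes "\<And>x. isCont f x"
  shows "\<exists>F. \<forall>x. (F has_real_derivative f x) (at x)"
  using einterval_antiderivative[of "-\<infinity>" "\<infinity>" f] assms
  by (auto simp: has_real_derivative_iff_has_vector_derivative)

lemma lipschitz_isCont:
  fixes f :: "real \<Rightarrow> real"
  assumes "\<And>x y. \<bar>f x - f y\<bar> \<le> \<bar>x - y\<bar>"
  shows "isCont f x"
  unfolding isCont_def LIM_eq using assms by (metis order_le_less_trans real_norm_def)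

lemma linear_growth_lipschitz:
  assumes "\<And>x y. \<bar>f x - f y\<bar> \<le> \<bar>x - y\<bar>"
  shows "linear_growth f"
proof -
  have [measurable]: "f \<in> borel_measurable borel"
    by (intro borel_measurable_continuous_onI continuous_at_imp_continuous_on ballI lipschitz_isCont assms)
  have "\<bar>f x\<bar> \<le> (1 + \<bar>f 0\<bar>) * (1 + \<bar>x\<bar>)" for x
  proof -
    have "\<bar>f x\<bar> \<le> \<bar>f 0\<bar> + \<bar>x\<bar>" using assms[of x 0] by simp
    moreover have "0 \<le> \<bar>f 0\<bar> * \<bar>x\<bar>" by simp
    ultimately show ?thesis unfolding ring_distribs by linarith
  qed
  then show ?thesis unfolding linear_growth_def by auto
qed

text \<open>The difference quotient of an antiderivative is the moving average of \<open>f\<close>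
  over \<open>[x, x + h]\<close>. It is again Lipschitz with constant 1, so that the averaging can
  be repeated.\<close>

lemma average_lipschitz:
  fixes f F :: "real \<Rightarrow> real"
  assumes F: "\<And>x. (F has_real_derivative f x) (at x)" and h: "h > 0"
    and f: "\<And>x y. \<bar>f x - f y\<bar> \<le> \<bar>x - y\<bar>"
  shows "\<bar>(F (x + h) - F x) / h - f x\<bar> \<le> h"
    "\<bar>(F (x + h) - F x) / h - (F (y + h) - F y) / h\<bar> \<le> \<bar>x - y\<bar>"
    "((\<lambda>x. (F (x + h) - F x) / h) has_real_derivative (f (x + h) - f x) / h) (at x)"
    "\<bar>(f (x + h) - f x) / h\<bar> \<le> 1"
proof -
  obtain z where "z > x" "z < x + h" "F (x + h) - F x = (x + h - x) * f z"
    using MVT2[of x "x + h" F f] h F by auto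
  then show "\<bar>(F (x + h) - F x) / h - f x\<bar> \<le> h" using f[of z x] h by simp
  show D: "((\<lambda>x. (F (x + h) - F x) / h) has_real_derivative (f (x + h) - f x) / h) (at x)" for x
    using h by (auto intro!: derivative_eq_intros DERIV_shift[THEN iffD1, OF F] F)
  show b: "\<bar>(f (x + h) - f x) / h\<bar> \<le> 1" for x
    using f[of "x + h" x] h by (simp add: field_simps)
  have *: "\<bar>(F (v + h) - F v) / h - (F (u + h) - F u) / h\<bar> \<le> \<bar>v - u\<bar>" if uv: "u < v" for u v
  proof -
    obtain z where "(F (v + h) - F v) / h - (F (u + h) - F u) / h = (v - u) * ((f (z + h) - f z) / h)"
      using MVT2[OF uv, of "\<lambda>x. (F (x + h) - F x) / h" "\<lambda>x. (f (x + h) - f x) / h"] D by auto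
    then have "\<bar>(F (v + h) - F v) / h - (F (u + h) - F u) / h\<bar> = \<bar>v - u\<bar> * \<bar>(f (z + h) - f z) / h\<bar>"
      by (simp only: abs_mult)
    also have "\<dots> \<le> \<bar>v - u\<bar> * 1" by (intro mult_left_mono b) simp
    finally show ?thesis by simp
  qed
  show "\<bar>(F (x + h) - F x) / h - (F (y + h) - F y) / h\<bar> \<le> \<bar>x - y\<bar>"
    using *[of x y] *[of y x] by (cases x y rule: linorder_cases) (simp_all add: abs_minus_commute)
qed

text \<open>
  Averaging twice over intervals of length \<open>h\<close> is enough: a Lipschitz second derivative suffices for the
  Taylor bound.
\<close>

lemma lipschitz_smoothing:
  fixes f :: "real \<Rightarrow> real"
  assumes f: "\<And>x y. \<bar>f x - f y\<bar> \<le> \<bar>x - y\<bar>" and h: "h > 0"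
  shows "\<exists>g g1 g2. taylor3 (2 / h\<^sup>2) g g1 g2 \<and> (\<forall>x. \<bar>g x - f x\<bar> \<le> 2 * h) \<and> linear_growth g"
proof -
  obtain F where F: "\<And>x. (F has_real_derivative f x) (at x)"
    using continuous_antiderivative[of f] lipschitz_isCont[of f] f by blast
  define f1 where "f1 x = (F (x + h) - F x) / h" for x
  define f1' where "f1' x = (f (x + h) - f x) / h" for x
  note avf = average_lipschitz[OF F h f, folded f1_def f1'_def]
  obtain F1 where F1: "\<And>x. (F1 has_real_derivative f1 x) (at x)"
    using continuous_antiderivative[of f1] lipschitz_isCont[of f1] avf(2) by blast
  define g where "g x = (F1 (x + h) - F1 x) / h" for x
  define g1 where "g1 x = (f1 (x + h) - f1 x) / h" for x
  note avg = average_lipschitz[OF F1 h avf(2), folded g_def g1_def]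
  define g2 where "g2 x = (f1' (x + h) - f1' x) / h" for x
  have Dg1: "(g1 has_real_derivative g2 x) (at x)" for x
    unfolding g1_def g2_def using h
    by (auto intro!: derivative_eq_intros DERIV_shift[THEN iffD1, OF avf(3)] avf(3))
  have f1'_lip: "\<bar>f1' x - f1' y\<bar> \<le> 2 / h * \<bar>x - y\<bar>" for x y
  proof -
    have "\<bar>f1' x - f1' y\<bar> = \<bar>(f (x + h) - f (y + h)) - (f x - f y)\<bar> / h"
      unfolding f1'_def diff_divide_distrib[symmetric] using h by (simp add: algebra_simps)
    also have "\<dots> \<le> (\<bar>x - y\<bar> + \<bar>x - y\<bar>) / h"
    proof (rule divide_right_mono)
      have "\<bar>f (x + h) - f (y + h)\<bar> \<le> \<bar>x - y\<bar>" using f[of "x + h" "y + h"] by simp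
      then show "\<bar>(f (x + h) - f (y + h)) - (f x - f y)\<bar> \<le> \<bar>x - y\<bar> + \<bar>x - y\<bar>" using f[of x y] by linarith
    qed (use h in simp)
    finally show ?thesis by simp
  qed
  \<comment> \<open>Each difference quotient multiplies the Lipschitz constant by
    \<open>2 / h\<close>. The factor 1/2 of the second-order Taylor term then gives the constant
    \<open>2 / h ^ 2\<close> of the claim.\<close>
  have g2_lip: "\<bar>g2 x - g2 y\<bar> \<le> 4 / h\<^sup>2 * \<bar>x - y\<bar>" for x y
  proof -
    have "\<bar>g2 x - g2 y\<bar> = \<bar>(f1' (x + h) - f1' (y + h)) - (f1' x - f1' y)\<bar> / h"
      unfolding g2_def diff_divide_distrib[symmetric] using h by (simp add: algebra_simps)
    also have "\<dots> \<le> (2 / h * \<bar>x - y\<bar> + 2 / h * \<bar>x - y\<bar>) / h"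
    proof (rule divide_right_mono)
      have "\<bar>f1' (x + h) - f1' (y + h)\<bar> \<le> 2 / h * \<bar>x - y\<bar>" using f1'_lip[of "x + h" "y + h"] by simp
      then show "\<bar>(f1' (x + h) - f1' (y + h)) - (f1' x - f1' y)\<bar> \<le> 2 / h * \<bar>x - y\<bar> + 2 / h * \<bar>x - y\<bar>"
        using f1'_lip[of x y] by linarith
    qed (use h in simp)
    finally show ?thesis by (simp add: power2_eq_square)
  qed
  have g2_bd: "\<bar>g2 x\<bar> \<le> 2 / h" for x
    using f1'_lip[of "x + h" x] h by (simp add: g2_def field_simps)
  have lg: "linear_growth g" by (rule linear_growth_lipschitz) (rule avg(2))
  have bounded_growth: "linear_growth u" if "\<And>x. \<bar>u x\<bar> \<le> K" "\<And>x. isCont u x" for u :: "real \<Rightarrow> real" and K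
  proof -
    have K: "K \<ge> 0" using that(1)[of 0] by simp
    have "u \<in> borel_measurable borel"
      by (intro borel_measurable_continuous_onI continuous_at_imp_continuous_on ballI that)
    moreover have "\<bar>u x\<bar> \<le> K * (1 + \<bar>x\<bar>)" for x
      unfolding ring_distribs using that(1)[of x] mult_nonneg_nonneg[OF K abs_ge_zero[of x]] by linarith
    ultimately show ?thesis unfolding linear_growth_def by blast
  qed
  have g2_cont: "isCont g2 x" for x
  proof -
    have sh: "isCont (\<lambda>x. u (x + h)) x" if "\<And>x. isCont u x" for u :: "real \<Rightarrow> real" and x
      by (rule isCont_o2[where g=u]) (simp_all add: that)
    have cf: "isCont f x" for x by (rule lipschitz_isCont) (rule f)
    have c1: "isCont f1' x" for x unfolding f1'_def[abs_def]
      by (rule isCont_divide[OF isCont_diff[OF sh[OF cf] cf] continuous_const]) (use h in simp)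
    show ?thesis unfolding g2_def[abs_def]
      by (rule isCont_divide[OF isCont_diff[OF sh[OF c1] c1] continuous_const]) (use h in simp)
  qed
  have lg1: "linear_growth g1"
    by (rule bounded_growth[of _ 1]) (rule avg(4), rule DERIV_isCont[OF Dg1])
  have lg2: "linear_growth g2" by (rule bounded_growth[OF g2_bd g2_cont])
  have T: "\<bar>g (x + d) - g x - g1 x * d - g2 x * d\<^sup>2 / 2\<bar> \<le> 2 / h\<^sup>2 * \<bar>d\<bar> ^ 3" for x d
  proof -
    define diff where "diff m t = (if m = 0 then g (x + t) else if m = 1 then g1 (x + t) else g2 (x + t))" for m :: nat and t
    have H: "\<forall>m t. m < 2 \<and> \<bar>t\<bar> \<le> \<bar>d\<bar> \<longrightarrow> (diff m has_real_derivative diff (Suc m) t) (at t)"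
    proof (intro allI impI)
      fix m :: nat and t :: real assume "m < 2 \<and> \<bar>t\<bar> \<le> \<bar>d\<bar>"
      then consider "m = 0" | "m = 1" by linarith
      then show "(diff m has_real_derivative diff (Suc m) t) (at t)"
      proof cases
        case 1
        have "((\<lambda>t. g (x + t)) has_real_derivative g1 (x + t)) (at t)"
          using DERIV_shift[of g "g1 (t + x)" t x] avg(3)[of "t + x"] by (simp add: add.commute)
        then show ?thesis using 1 unfolding diff_def by simp
      next
        case 2
        have "((\<lambda>t. g1 (x + t)) has_real_derivative g2 (x + t)) (at t)"
          using DERIV_shift[of g1 "g2 (t + x)" t x] Dg1[of "t + x"] by (simp add: add.commute)
        then show ?thesis using 2 unfolding diff_def by simp
      qed
    qed
    have d0: "diff 0 = (\<lambda>t. g (x + t))" by (simp add: diff_def fun_eq_iff)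
    have "\<exists>t. \<bar>t\<bar> \<le> \<bar>d\<bar> \<and> g (x + d) = (\<Sum>m<2. diff m 0 / fact m * d ^ m) + diff 2 t / fact 2 * d ^ 2"
      by (rule Maclaurin_bi_le[OF d0 H])
    then obtain t where t: "\<bar>t\<bar> \<le> \<bar>d\<bar>" "g (x + d) = (\<Sum>m<2. diff m 0 / fact m * d ^ m) + diff 2 t / fact 2 * d ^ 2"
      by blast
    have "g (x + d) - g x - g1 x * d - g2 x * d\<^sup>2 / 2 = (g2 (x + t) - g2 x) * d\<^sup>2 / 2"
      using t(2) by (simp add: diff_def numeral_2_eq_2 algebra_simps)
    also have "\<bar>\<dots>\<bar> = \<bar>g2 (x + t) - g2 x\<bar> * (d\<^sup>2 / 2)" by (simp add: abs_mult)
    also have "\<dots> \<le> (4 / h\<^sup>2 * \<bar>d\<bar>) * (d\<^sup>2 / 2)"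
      using g2_lip[of "x + t" x] t(1) h
      by (intro mult_right_mono) (auto intro!: order_trans[OF g2_lip] divide_right_mono)
    also have "\<dots> = 2 / h\<^sup>2 * \<bar>d\<bar> ^ 3"
      by (simp add: power3_eq_cube power2_eq_square abs_mult_self_eq mult.assoc)
    finally show ?thesis .
  qed
  have "taylor3 (2 / h\<^sup>2) g g1 g2" unfolding taylor3_def by (intro conjI allI lg lg1 lg2 T)
  moreover have "\<forall>x. \<bar>g x - f x\<bar> \<le> 2 * h"
  proof
    show "\<bar>g x - f x\<bar> \<le> 2 * h" for x using avg(1)[of x] avf(1)[of x] by linarith
  qed
  ultimately have "taylor3 (2 / h\<^sup>2) g g1 g2 \<and> (\<forall>x. \<bar>g x - f x\<bar> \<le> 2 * h) \<and> linear_growth g"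
    using lg by (intro conjI)
  then show ?thesis
    by - (rule exI[of _ g], rule exI[of _ g1], rule exI[of _ g2])
qed

text \<open>Passing from \<open>f\<close> to its smoothing costs \<open>2 * h\<close> on the side of
  the paths and again on the Gaussian side. The scale \<open>h\<close> stays free, to be balanced
  against the Lindeberg error later.\<close>

theorem path_clt:
  fixes f :: "real \<Rightarrow> real"
  assumes f: "\<And>x y. \<bar>f x - f y\<bar> \<le> \<bar>x - y\<bar>" and h: "h > 0" and p: "0 < p" "p < 1"
  shows "\<bar>path_exp p b m (\<lambda>l. f (path_sum p a b l)) - gauss_avg (sqrt (p / (1 - p) * (\<Sum>i<m. (a i)\<^sup>2))) f 0\<bar>
    \<le> 4 * h + 2 / h\<^sup>2 * lindeberg_const p * (\<Sum>i<m. \<bar>a i\<bar> ^ 3)"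
proof -
  obtain g g1 g2 where g: "taylor3 (2 / h\<^sup>2) g g1 g2" "\<And>x. \<bar>g x - f x\<bar> \<le> 2 * h" "linear_growth g"
    using lipschitz_smoothing[OF f h] by blast
  define \<sigma> where "\<sigma> = sqrt (p / (1 - p) * (\<Sum>i<m. (a i)\<^sup>2))"
  have "\<bar>path_exp p b m (\<lambda>l. g (0 + path_sum p a b l)) - gauss_avg \<sigma> g 0\<bar> \<le> 2 / h\<^sup>2 * lindeberg_const p * (\<Sum>i<m. \<bar>a i\<bar> ^ 3)"
    unfolding \<sigma>_def by (rule path_lindeberg[OF g(1) p]) simp
  moreover have "\<bar>path_exp p b m (\<lambda>l. f (path_sum p a b l)) - path_exp p b m (\<lambda>l. g (0 + path_sum p a b l))\<bar> \<le> 2 * h"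
    using p g(2) by (intro path_exp_abs_diff_le) (auto simp: abs_minus_commute)
  moreover have "\<bar>gauss_avg \<sigma> g 0 - gauss_avg \<sigma> f 0\<bar> \<le> 2 * h"
  proof -
    have i: "integrable std_gauss (\<lambda>y. u (0 + \<sigma> * y))" if "linear_growth u" for u
      by (rule linear_growth_integrable[OF linear_growth_affine[OF that]])
    have lf: "linear_growth f" by (rule linear_growth_lipschitz) (rule f)
    have e: "gauss_avg \<sigma> g 0 - gauss_avg \<sigma> f 0 = (LINT y|std_gauss. g (0 + \<sigma> * y) - f (0 + \<sigma> * y))"
      unfolding gauss_avg_def by (rule Bochner_Integration.integral_diff[symmetric]) (rule i g(3) lf)+
    have "\<bar>LINT y|std_gauss. g (0 + \<sigma> * y) - f (0 + \<sigma> * y)\<bar> \<le> (LINT y|std_gauss. \<bar>g (0 + \<sigma> * y) - f (0 + \<sigma> * y)\<bar>)"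
      by (rule integral_abs_bound)
    also have "\<dots> \<le> (LINT y|std_gauss. 2 * h)"
      by (rule integral_mono) (intro integrable_abs Bochner_Integration.integrable_diff i g(3) lf, simp, rule g(2))
    also have "\<dots> = 2 * h" using std_normal.prob_space by simp
    finally show ?thesis unfolding e .
  qed
  ultimately show ?thesis unfolding \<sigma>_def[symmetric] by linarith
qed

section \<open>Quantile coupling\<close>

text \<open>
  The potential has slope \<open>1\<close> on the set \<open>U\<close> of points that are transported over to the right and slope \<open>-1\<close>
  elsewhere; monotonicity of \<open>T\<close> ensures that no point of \<open>U\<close> is transported over to the left.
\<close>

lemma monotone_transport_potential:
  fixes T :: "real \<Rightarrow> real"
  assumes "mono T"
  shows "\<exists>f. (\<forall>x y. \<bar>f x - f y\<bar> \<le> \<bar>x - y\<bar>) \<and> (\<forall>g. f (T g) - f g = \<bar>T g - g\<bar>)"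
proof -
  define U where "U = (\<Union>g. {g<..<T g})"
  have U [measurable]: "U \<in> sets borel" unfolding U_def by (intro borel_open open_UN) auto
  define m where "m a b = measure lborel (U \<inter> {a..<b})" for a b
  have fin: "emeasure lborel (U \<inter> {a..<b}) \<noteq> \<infinity>" for a b
  proof -
    have "emeasure lborel (U \<inter> {a..<b}) \<le> emeasure lborel {a..b}" by (rule emeasure_mono) auto
    also have "\<dots> < \<infinity>" by (simp add: emeasure_lborel_Icc_eq)
    finally show ?thesis by simp
  qed
  have add: "m a c = m a b + m b c" if "a \<le> b" "b \<le> c" for a b c
  proof -
    have "U \<inter> {a..<c} = (U \<inter> {a..<b}) \<union> (U \<inter> {b..<c})" using that by auto
    then show ?thesis unfolding m_def using fin by (simp add: measure_Union disjoint_iff)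
  qed
  have m0: "0 \<le> m a b" for a b by (simp add: m_def)
  have m1: "m a b \<le> b - a" if "a \<le> b" for a b
  proof -
    have "m a b \<le> measure lborel {a..b}" unfolding m_def
      by (rule measure_mono_fmeasurable) (auto simp: fmeasurable_def emeasure_lborel_Icc_eq)
    then show ?thesis using that by simp
  qed
  \<comment> \<open>A primitive of the indicator function of \<open>U\<close>, which produces the
    two slopes of \<open>2 * u x - x\<close>.\<close>
  define u where "u x = (if 0 \<le> x then m 0 x else - m x 0)" for x
  have u: "u b - u a = m a b" if "a \<le> b" for a b
    using that add[of 0 a b] add[of a 0 b] add[of a b 0] by (auto simp: u_def)
  define f where "f x = 2 * u x - x" for x
  have f: "f b - f a = 2 * m a b - (b - a)" if "a \<le> b" for a b
    using u[OF that] by (simp add: f_def)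
  have lip: "\<bar>f x - f y\<bar> \<le> \<bar>x - y\<bar>" for x y
  proof (cases "x \<le> y")
    case True
    then show ?thesis using f[OF True] m0[of x y] m1[OF True] by (simp add: abs_le_iff)
  next
    case False
    then have "y \<le> x" by simp
    then show ?thesis using f[of y x] m0[of y x] m1[of y x] by (simp add: abs_le_iff)
  qed
  have "f (T g) - f g = \<bar>T g - g\<bar>" for g
  proof (cases "g < T g")
    case True
    have "{g<..<T g} \<subseteq> U \<inter> {g..<T g}" unfolding U_def by auto
    then have "measure lborel {g<..<T g} \<le> m g (T g)" unfolding m_def
      by (rule measure_mono_fmeasurable) (use fin in \<open>auto simp: fmeasurable_def less_top\<close>)
    then have "m g (T g) = T g - g" using m1[of g "T g"] True by simp
    then show ?thesis using f[of g "T g"] True by simp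
  next
    case False
    \<comment> \<open>A point \<open>x > T g\<close> of this set would satisfy
      \<open>g' < x < T g'\<close> for some \<open>g' < g\<close>, against
      \<open>T g' \<le> T g\<close>. Only the endpoint can remain, and it is a null set.\<close>
    have "U \<inter> {T g..<g} \<subseteq> {T g}"
    proof
      fix x assume x: "x \<in> U \<inter> {T g..<g}"
      then obtain g' where g': "g' < x" "x < T g'" unfolding U_def by auto
      have "T g' \<le> T g" using assms g' x by (auto simp: mono_def)
      then show "x \<in> {T g}" using g' x by auto
    qed
    then have "m (T g) g \<le> measure lborel {T g}" unfolding m_def
      by (rule measure_mono_fmeasurable) (auto simp: fmeasurable_def)
    then have "m (T g) g = 0" using m0[of "T g" g] by simp
    then show ?thesis using f[of "T g" g] False by simp
  qed
  then show ?thesis using lip by blast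
qed


section \<open>Quantile transforms of a normal law\<close>

context
  fixes \<sigma> :: real
  assumes \<sigma>: "\<sigma> > 0"
begin

interpretation nm: real_distribution "normal_measure \<sigma>"
  by (rule real_distribution_normal_measure[OF \<sigma>])

lemma normal_cdf_strict_mono:
  assumes "x < y"
  shows "cdf (normal_measure \<sigma>) x < cdf (normal_measure \<sigma>) y"
proof -
  have "nm.prob {x<..y} \<noteq> 0"
  proof
    assume "nm.prob {x<..y} = 0"
    then have "(\<integral>\<^sup>+z. ennreal (normal_density 0 \<sigma> z) * indicator {x<..y} z \<partial>lborel) = 0"
      by (simp add: nm.emeasure_eq_measure emeasure_density[symmetric])
    then have "AE z in lborel. ennreal (normal_density 0 \<sigma> z) * indicator {x<..y} z = 0"
      by (subst (asm) nn_integral_0_iff_AE) auto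
    then have "AE z in lborel. z \<notin> {x<..y}"
    proof (rule AE_mp, intro AE_I2 impI)
      fix z assume "ennreal (normal_density 0 \<sigma> z) * indicator {x<..y} z = 0"
      then show "z \<notin> {x<..y}" using normal_density_pos[OF \<sigma>, of 0 z] by (auto simp: indicator_def)
    qed
    then have "{x<..y} \<in> null_sets lborel"
      by (subst AE_iff_null_sets) auto
    then show False using assms by (simp add: null_sets_def)
  qed
  then have "nm.prob {x<..y} > 0" using measure_nonneg[of "normal_measure \<sigma>" "{x<..y}"] by linarith
  moreover have "cdf (normal_measure \<sigma>) y - cdf (normal_measure \<sigma>) x = nm.prob {x<..y}"
    by (rule nm.cdf_diff_eq[OF assms])
  ultimately show ?thesis by linarith
qed

lemma normal_cdf_surj:
  assumes "0 < c" "c < 1"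
  shows "\<exists>x. cdf (normal_measure \<sigma>) x = c"
proof -
  have "eventually (\<lambda>x. cdf (normal_measure \<sigma>) x < c) at_bot"
    using nm.cdf_lim_at_bot assms(1) by (rule order_tendstoD)
  then obtain x1 where x1: "cdf (normal_measure \<sigma>) x1 < c" by (auto simp: eventually_at_bot_linorder)
  have "eventually (\<lambda>x. c < cdf (normal_measure \<sigma>) x) at_top"
    using nm.cdf_lim_at_top_prob assms(2) by (rule order_tendstoD)
  then obtain x2 where x2: "c < cdf (normal_measure \<sigma>) x2" by (auto simp: eventually_at_top_linorder)
  have "x1 \<le> x2"
    using x1 x2 normal_cdf_strict_mono[of x2 x1] by (cases "x1 \<le> x2") auto
  have "nm.prob {x} = 0" for x
  proof -
    have "emeasure (normal_measure \<sigma>) {x} = 0"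
      by (subst emeasure_density) (auto intro!: nn_integral_null_set)
    then show ?thesis by (simp add: measure_def)
  qed
  then have "isCont (cdf (normal_measure \<sigma>)) x" for x by (simp add: nm.isCont_cdf)
  then show ?thesis
    using IVT[of "cdf (normal_measure \<sigma>)" x1 c x2] x1 x2 \<open>x1 \<le> x2\<close> by auto
qed

lemma normal_cdf_bounds: "0 < cdf (normal_measure \<sigma>) x" "cdf (normal_measure \<sigma>) x < 1"
  using normal_cdf_strict_mono[of "x - 1" x] nm.cdf_nonneg[of "x - 1"]
    normal_cdf_strict_mono[of x "x + 1"] nm.cdf_bounded_prob[of "x + 1"] by auto

text \<open>The probability integral transform: a normal variable inserted into its own distribution
  function is uniform. The levels 0 and 1 are separate cases because the function does not attain
  them.\<close>

lemma normal_cdf_uniform: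
  assumes "0 \<le> c" "c \<le> 1"
  shows "{x. cdf (normal_measure \<sigma>) x \<le> c} \<in> sets borel" (is "?S \<in> _")
    "measure (normal_measure \<sigma>) {x. cdf (normal_measure \<sigma>) x \<le> c} = c"
proof -
  consider "c = 0" | "c = 1" | "0 < c" "c < 1" using assms by linarith
  then have "?S \<in> sets borel \<and> nm.prob ?S = c"
  proof cases
    case 1
    then have "?S = {}" using normal_cdf_bounds(1) by (auto simp: not_le)
    then show ?thesis using 1 by simp
  next
    case 2
    then have "?S = UNIV" using normal_cdf_bounds(2) by (auto intro: less_imp_le)
    then show ?thesis using 2 nm.prob_space by simp
  next
    case 3
    then obtain \<tau> where \<tau>: "cdf (normal_measure \<sigma>) \<tau> = c" using normal_cdf_surj by blast
    have "?S = {..\<tau>}"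
    proof (intro set_eqI iffI)
      fix x assume "x \<in> ?S" then show "x \<in> {..\<tau>}"
        using normal_cdf_strict_mono[of \<tau> x] \<tau> by (cases "x \<le> \<tau>") auto
    next
      fix x assume "x \<in> {..\<tau>}" then show "x \<in> ?S"
        using normal_cdf_strict_mono[of x \<tau>] \<tau> by (cases "x = \<tau>") auto
    qed
    then show ?thesis using \<tau> by (simp add: cdf_def)
  qed
  then show "?S \<in> sets borel" "nm.prob ?S = c" by auto
qed

text \<open>The elements of \<open>S\<close> are sorted by \<open>Y\<close>, and the line is cut at
  the normal quantiles of the cumulated weights. Every single element of \<open>S\<close> receives
  its weight, not only every value of \<open>Y\<close>, so a whole path can be recovered from one
  real number even if \<open>Y\<close> has ties.\<close>

lemma quantile_map:
  fixes Y :: "'b \<Rightarrow> real" and w :: "'b \<Rightarrow> real"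
  assumes "finite S" "S \<noteq> {}" "\<And>l. l \<in> S \<Longrightarrow> 0 \<le> w l" "(\<Sum>l\<in>S. w l) = 1"
  shows "\<exists>Q. (\<forall>x. Q x \<in> S) \<and> mono (\<lambda>x. Y (Q x)) \<and>
    (\<forall>l\<in>S. {x. Q x = l} \<in> sets borel \<and> measure (normal_measure \<sigma>) {x. Q x = l} = w l)"
proof -
  define F where "F = cdf (normal_measure \<sigma>)"
  obtain ys where ys: "set ys = S" "distinct ys" using finite_distinct_list[OF assms(1)] by blast
  define xs where "xs = sort_key Y ys"
  have xs: "set xs = S" "distinct xs" "sorted (map Y xs)" using ys by (simp_all add: xs_def)
  define n where "n = length xs"
  define c where "c k = (\<Sum>i<k. w (xs ! i))" for k
  have w0: "0 \<le> w (xs ! i)" if "i < n" for i by (rule assms(3)) (use that xs(1) n_def nth_mem in auto)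
  have c_mono: "c i \<le> c j" if "i \<le> j" "j \<le> n" for i j
    unfolding c_def using that w0 by (intro sum_mono2) auto
  have cn: "c n = 1"
  proof -
    have "bij_betw (\<lambda>i. xs ! i) {..<n} S"
      using bij_betw_nth[OF xs(2), of "{..<n}" S] xs(1) n_def by auto
    then have "(\<Sum>i<n. w (xs ! i)) = (\<Sum>l\<in>S. w l)" by (rule sum.reindex_bij_betw)
    then show ?thesis by (simp add: c_def assms(4))
  qed
  have n0: "n > 0" using assms(2) xs(1) n_def by (cases xs) auto
  define k where "k x = (LEAST k. F x \<le> c (Suc k))" for x
  have ex: "F x \<le> c (Suc (n - 1))" for x
    using n0 cn normal_cdf_bounds(2)[of x] by (simp add: F_def)
  have k1: "F x \<le> c (Suc (k x))" "k x \<le> n - 1" for x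
    unfolding k_def by (rule LeastI[of _ "n - 1"], rule ex) (rule Least_le[of _ "n - 1"], rule ex)
  have k2: "c (Suc j) < F x" if "j < k x" for j x
    using not_less_Least[of j "\<lambda>k. F x \<le> c (Suc k)"] that unfolding k_def by auto
  have kn: "k x < n" for x using k1(2)[of x] n0 by simp
  define Q where "Q x = xs ! k x" for x
  have QS: "Q x \<in> S" for x unfolding Q_def using kn xs(1) n_def by auto
  have k_mono: "k x \<le> k y" if "x \<le> y" for x y
  proof -
    have "F x \<le> F y" using that normal_cdf_strict_mono[of x y] unfolding F_def by (cases "x = y") auto
    then have "F x \<le> c (Suc (k y))" using k1(1)[of y] by linarith
    then show ?thesis unfolding k_def[of x] by (rule Least_le)
  qed
  have mono: "mono (\<lambda>x. Y (Q x))"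
  proof (rule monoI)
    fix x y :: real assume "x \<le> y"
    then have "map Y xs ! k x \<le> map Y xs ! k y"
      using sorted_nth_mono[OF xs(3) k_mono] kn[of y] by (simp add: n_def)
    then show "Y (Q x) \<le> Y (Q y)" using kn[of x] kn[of y] by (simp add: Q_def n_def)
  qed
  have law: "{x. Q x = l} \<in> sets borel \<and> measure (normal_measure \<sigma>) {x. Q x = l} = w l" if "l \<in> S" for l
  proof -
    have "l \<in> set xs" using that xs(1) by simp
    then obtain j where "j < length xs" "xs ! j = l" unfolding in_set_conv_nth by blast
    then have j: "j < n" "l = xs ! j" by (simp_all add: n_def)
    have c01: "0 \<le> c i" "c i \<le> 1" if "i \<le> n" for i
      using c_mono[of 0 i] c_mono[of i n] that cn by (auto simp: c_def)
    have "{x. Q x = l} = {x. k x = j}"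
      using kn j nth_eq_iff_index_eq[OF xs(2)] by (auto simp: Q_def n_def)
    also have "\<dots> = {x. F x \<le> c (Suc j)} - {x. F x \<le> c j}"
    proof (intro set_eqI iffI)
      fix x assume "x \<in> {x. k x = j}"
      then have kx: "k x = j" by simp
      have "c j < F x"
      proof (cases j)
        case 0
        then show ?thesis using normal_cdf_bounds(1)[of x] by (simp add: c_def F_def)
      next
        case (Suc i)
        then show ?thesis using k2[of i x] kx by simp
      qed
      then show "x \<in> {x. F x \<le> c (Suc j)} - {x. F x \<le> c j}" using k1(1)[of x] kx by simp
    next
      fix x assume x: "x \<in> {x. F x \<le> c (Suc j)} - {x. F x \<le> c j}"
      then have "k x \<le> j" unfolding k_def by (auto intro: Least_le)
      moreover have "\<not> k x < j"
      proof
        assume "k x < j"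
        then have "c (Suc (k x)) \<le> c j" using c_mono[of "Suc (k x)" j] j by simp
        then show False using k1(1)[of x] x by simp
      qed
      ultimately show "x \<in> {x. k x = j}" by simp
    qed
    finally have eq: "{x. Q x = l} = {x. F x \<le> c (Suc j)} - {x. F x \<le> c j}" .
    have s: "{x. F x \<le> c i} \<in> sets borel" "nm.prob {x. F x \<le> c i} = c i" if "i \<le> n" for i
      unfolding F_def using normal_cdf_uniform[OF c01[OF that]] by auto
    have "nm.prob ({x. F x \<le> c (Suc j)} - {x. F x \<le> c j}) = c (Suc j) - c j"
    proof -
      have "{x. F x \<le> c j} \<subseteq> {x. F x \<le> c (Suc j)}"
        using c_mono[of j "Suc j"] j by auto
      then show ?thesis
        using nm.finite_measure_Diff[of "{x. F x \<le> c (Suc j)}" "{x. F x \<le> c j}"] s[of j] s[of "Suc j"] j by simp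
    qed
    moreover have "c (Suc j) - c j = w l" by (simp add: c_def j(2))
    moreover have "{x. F x \<le> c (Suc j)} - {x. F x \<le> c j} \<in> sets borel"
      by (rule sets.Diff[OF s(1) s(1)]) (use j(1) in simp_all)
    ultimately show ?thesis unfolding eq by simp
  qed
  show ?thesis by (intro exI[of _ Q] conjI allI ballI QS mono law[THEN conjunct1] law[THEN conjunct2])
qed

lemma integrable_normal_measure:
  assumes "linear_growth f"
  shows "integrable (normal_measure \<sigma>) f" "(LINT x|normal_measure \<sigma>. f x) = gauss_avg \<sigma> f 0"
proof -
  have [measurable]: "f \<in> borel_measurable borel" using assms by (simp add: linear_growth_def)
  have "integrable std_gauss (\<lambda>y. f (0 + \<sigma> * y))"
    by (rule linear_growth_integrable[OF linear_growth_affine[OF assms]])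
  then show "integrable (normal_measure \<sigma>) f"
    unfolding normal_measure_distr[OF \<sigma>] by (subst integrable_distr_eq) auto
  show "(LINT x|normal_measure \<sigma>. f x) = gauss_avg \<sigma> f 0"
    unfolding normal_measure_distr[OF \<sigma>] gauss_avg_def by (subst integral_distr) auto
qed

text \<open>The potential of the monotone map \<open>Y \<circ> Q\<close> turns the transport cost
  into a difference of two expectations of one Lipschitz function. This is the attained case of
  Kantorovich duality: a bound uniform over Lipschitz test functions becomes a bound for the
  coupling.\<close>

theorem wasserstein_coupling:
  fixes Y :: "'b \<Rightarrow> real" and w :: "'b \<Rightarrow> real"
  assumes S: "finite S" "S \<noteq> {}" "\<And>l. l \<in> S \<Longrightarrow> 0 \<le> w l" "(\<Sum>l\<in>S. w l) = 1"
  shows "\<exists>Q. (\<forall>x. Q x \<in> S) \<and>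
    (\<forall>l\<in>S. {x. Q x = l} \<in> sets borel \<and> measure (normal_measure \<sigma>) {x. Q x = l} = w l) \<and>
    integrable (normal_measure \<sigma>) (\<lambda>x. \<bar>Y (Q x) - x\<bar>) \<and>
    (\<exists>f. (\<forall>x y. \<bar>f x - f y\<bar> \<le> \<bar>x - y\<bar>) \<and>
       (LINT x|normal_measure \<sigma>. \<bar>Y (Q x) - x\<bar>) = (\<Sum>l\<in>S. w l * f (Y l)) - gauss_avg \<sigma> f 0)"
proof -
  from quantile_map[OF S, of Y] obtain Q where Q': "(\<forall>x. Q x \<in> S) \<and> mono (\<lambda>x. Y (Q x)) \<and>
    (\<forall>l\<in>S. {x. Q x = l} \<in> sets borel \<and> measure (normal_measure \<sigma>) {x. Q x = l} = w l)" ..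
  then have Q: "\<And>x. Q x \<in> S" "mono (\<lambda>x. Y (Q x))"
    "\<And>l. l \<in> S \<Longrightarrow> {x. Q x = l} \<in> sets borel" "\<And>l. l \<in> S \<Longrightarrow> measure (normal_measure \<sigma>) {x. Q x = l} = w l"
    by simp_all
  from monotone_transport_potential[OF Q(2)] obtain f where
    "(\<forall>x y. \<bar>f x - f y\<bar> \<le> \<bar>x - y\<bar>) \<and> (\<forall>g. f (Y (Q g)) - f g = \<bar>Y (Q g) - g\<bar>)" ..
  then have f: "\<And>x y. \<bar>f x - f y\<bar> \<le> \<bar>x - y\<bar>" "\<And>g. f (Y (Q g)) - f g = \<bar>Y (Q g) - g\<bar>"
    by (auto dest: spec)
  have lf: "linear_growth f" by (rule linear_growth_lipschitz) (rule f(1))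
  have e: "f (Y (Q x)) = (\<Sum>l\<in>S. f (Y l) * indicator {x. Q x = l} x)" for x
  proof -
    have "(\<Sum>l\<in>S. f (Y l) * indicator {x. Q x = l} x) = (\<Sum>l\<in>S. if l = Q x then f (Y l) else 0)"
      by (rule sum.cong) (auto simp: indicator_def)
    then show ?thesis using Q(1) S(1) by (simp add: sum.delta)
  qed
  have ind: "integrable (normal_measure \<sigma>) (\<lambda>x. f (Y l) * indicator {x. Q x = l} x)" if "l \<in> S" for l
    using Q(3)[OF that] by (intro integrable_mult_right integrable_real_indicator) (auto simp: nm.emeasure_eq_measure)
  have i1: "integrable (normal_measure \<sigma>) (\<lambda>x. f (Y (Q x)))"
    unfolding e by (intro Bochner_Integration.integrable_sum ind)
  have "(LINT x|normal_measure \<sigma>. f (Y (Q x))) = (\<Sum>l\<in>S. LINT x|normal_measure \<sigma>. f (Y l) * indicator {x. Q x = l} x)"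
    unfolding e by (rule Bochner_Integration.integral_sum) (rule ind)
  also have "\<dots> = (\<Sum>l\<in>S. w l * f (Y l))"
    by (rule sum.cong) (simp_all add: Q(4))
  finally have I1: "(LINT x|normal_measure \<sigma>. f (Y (Q x))) = (\<Sum>l\<in>S. w l * f (Y l))" .
  note i2 = integrable_normal_measure[OF lf]
  have A: "integrable (normal_measure \<sigma>) (\<lambda>x. \<bar>Y (Q x) - x\<bar>)"
    unfolding f(2)[symmetric] by (rule Bochner_Integration.integrable_diff[OF i1 i2(1)])
  have B: "(LINT x|normal_measure \<sigma>. \<bar>Y (Q x) - x\<bar>) = (\<Sum>l\<in>S. w l * f (Y l)) - gauss_avg \<sigma> f 0"
    unfolding f(2)[symmetric] I1[symmetric] i2(2)[symmetric] by (rule Bochner_Integration.integral_diff[OF i1 i2(1)])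
  show ?thesis
  proof (intro exI[of _ Q] conjI A)
    show "\<forall>x. Q x \<in> S" using Q(1) by simp
    show "\<forall>l\<in>S. {x. Q x = l} \<in> sets borel \<and> measure (normal_measure \<sigma>) {x. Q x = l} = w l" using Q(3,4) by simp
    show "\<exists>f. (\<forall>x y. \<bar>f x - f y\<bar> \<le> \<bar>x - y\<bar>) \<and>
       (LINT x|normal_measure \<sigma>. \<bar>Y (Q x) - x\<bar>) = (\<Sum>l\<in>S. w l * f (Y l)) - gauss_avg \<sigma> f 0"
      by (intro exI[of _ f] conjI allI f(1) B)
  qed
qed

end

text \<open>The map \<open>Q\<close> is found before \<open>h\<close> is chosen, so one coupling
  satisfies the bound at every smoothing scale.\<close>

theorem path_coupling:
  assumes p: "0 < p" "p < 1" and V: "(\<Sum>i<m. (a i)\<^sup>2) > 0"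
  defines "\<sigma> \<equiv> sqrt (p / (1 - p) * (\<Sum>i<m. (a i)\<^sup>2))"
  shows "\<exists>Q. (\<forall>x. length (Q x) = m) \<and>
    (\<forall>l. length l = m \<longrightarrow> {x. Q x = l} \<in> sets borel \<and> measure (normal_measure \<sigma>) {x. Q x = l} = path_weight p b l) \<and>
    integrable (normal_measure \<sigma>) (\<lambda>x. \<bar>path_sum p a b (Q x) - x\<bar>) \<and>
    (\<forall>h>0. (LINT x|normal_measure \<sigma>. \<bar>path_sum p a b (Q x) - x\<bar>)
       \<le> 4 * h + 2 / h\<^sup>2 * lindeberg_const p * (\<Sum>i<m. \<bar>a i\<bar> ^ 3))"
proof -
  have \<sigma>: "\<sigma> > 0" using p V by (simp add: \<sigma>_def)
  have ne: "paths m \<noteq> {}" unfolding paths_def using Ex_list_of_length[of m] by auto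
  have w: "(\<Sum>l\<in>paths m. path_weight p b l) = 1"
    using path_exp_const[of p b m 1] unfolding path_exp_def by simp
  have w0: "0 \<le> path_weight p b l" for l using path_weight_nonneg[of p b l] p by simp
  have "\<exists>Q. (\<forall>x. Q x \<in> paths m) \<and>
    (\<forall>l\<in>paths m. {x. Q x = l} \<in> sets borel \<and> measure (normal_measure \<sigma>) {x. Q x = l} = path_weight p b l) \<and>
    integrable (normal_measure \<sigma>) (\<lambda>x. \<bar>path_sum p a b (Q x) - x\<bar>) \<and>
    (\<exists>f. (\<forall>x y. \<bar>f x - f y\<bar> \<le> \<bar>x - y\<bar>) \<and>
       (LINT x|normal_measure \<sigma>. \<bar>path_sum p a b (Q x) - x\<bar>) = (\<Sum>l\<in>paths m. path_weight p b l * f (path_sum p a b l)) - gauss_avg \<sigma> f 0)"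
    by (rule wasserstein_coupling[OF \<sigma> finite_paths ne w0 w])
  then obtain Q where Q': "(\<forall>x. Q x \<in> paths m) \<and>
    (\<forall>l\<in>paths m. {x. Q x = l} \<in> sets borel \<and> measure (normal_measure \<sigma>) {x. Q x = l} = path_weight p b l) \<and>
    integrable (normal_measure \<sigma>) (\<lambda>x. \<bar>path_sum p a b (Q x) - x\<bar>) \<and>
    (\<exists>f. (\<forall>x y. \<bar>f x - f y\<bar> \<le> \<bar>x - y\<bar>) \<and>
       (LINT x|normal_measure \<sigma>. \<bar>path_sum p a b (Q x) - x\<bar>) = (\<Sum>l\<in>paths m. path_weight p b l * f (path_sum p a b l)) - gauss_avg \<sigma> f 0)" ..
  note Q = conjunct1[OF Q'] conjunct1[OF conjunct2[OF Q']] conjunct1[OF conjunct2[OF conjunct2[OF Q']]]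
  note ex = conjunct2[OF conjunct2[OF conjunct2[OF Q']]]
  from ex obtain f where F: "(\<forall>x y. \<bar>f x - f y\<bar> \<le> \<bar>x - y\<bar>) \<and>
       (LINT x|normal_measure \<sigma>. \<bar>path_sum p a b (Q x) - x\<bar>) = (\<Sum>l\<in>paths m. path_weight p b l * f (path_sum p a b l)) - gauss_avg \<sigma> f 0" ..
  note f = conjunct1[OF F, THEN spec, THEN spec] and I = conjunct2[OF F]
  have "(LINT x|normal_measure \<sigma>. \<bar>path_sum p a b (Q x) - x\<bar>) \<le> 4 * h + 2 / h\<^sup>2 * lindeberg_const p * (\<Sum>i<m. \<bar>a i\<bar> ^ 3)"
    if "h > 0" for h
    using path_clt[OF f that p, of b m a, folded \<sigma>_def] unfolding I path_exp_def by linarith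
  then show ?thesis
    using Q by (intro exI[of _ Q]) (simp add: paths_def)
qed

section \<open>Maximal inequalities\<close>

text \<open>Meant for centred variables: the linear term disappears in the mean, and what is left is
  a sub-Gaussian bound valid for all exponents.\<close>

lemma exp_le_add_exp_square: "exp x \<le> x + exp (x\<^sup>2)" for x :: real
proof (cases "x \<ge> 1")
  case True
  then have "x \<le> x\<^sup>2" by (simp add: power2_eq_square)
  then have "exp x \<le> exp (x\<^sup>2)" by simp
  with True show ?thesis by linarith
next
  case False
  have "exp x \<le> 1 + x + x\<^sup>2"
  proof (cases "x \<ge> 0")
    case True
    then show ?thesis using False exp_bound[of x] by simp
  next
    case neg: False
    define y where "y = - x"
    have y: "y > 0" using neg by (simp add: y_def)
    have e: "1 + y + y\<^sup>2 / 2 \<le> exp y" using exp_lower_Taylor_quadratic[of y] y by simp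
    \<comment> \<open>For a negative argument \<open>- y\<close>, the upper bound of
      \<open>exp (- y)\<close> is the reciprocal of the quadratic lower bound of
      \<open>exp y\<close>, once this product is at least 1.\<close>
    have "1 \<le> (1 - y + y\<^sup>2) * (1 + y + y\<^sup>2 / 2)"
    proof -
      have "(1 - y + y\<^sup>2) * (1 + y + y\<^sup>2 / 2) = 1 + y\<^sup>2 / 2 + y ^ 3 / 2 + y ^ 4 / 2"
        by (simp add: field_simps power2_eq_square power3_eq_cube power4_eq_xxxx)
      then show ?thesis using y by simp
    qed
    also have "\<dots> \<le> (1 - y + y\<^sup>2) * exp y"
    proof (rule mult_left_mono[OF e])
      have "1 - y + y\<^sup>2 = (y - 1/2)\<^sup>2 + 3/4" by (simp add: power2_eq_square algebra_simps)
      then show "0 \<le> 1 - y + y\<^sup>2" by simp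
    qed
    finally have "1 / exp y \<le> 1 - y + y\<^sup>2" by (simp add: field_simps)
    then show ?thesis by (simp add: y_def exp_minus divide_inverse)
  qed
  moreover have "1 + x\<^sup>2 \<le> exp (x\<^sup>2)" by simp
  ultimately show ?thesis by linarith
qed

text \<open>Dominates the squares of both possible moduli of a step, \<open>1\<close> and
  \<open>p / (1 - p)\<close>.\<close>

definition mgf_const :: "real \<Rightarrow> real" where
  "mgf_const p = 1 + (p / (1 - p))\<^sup>2"

lemma mgf_const_ge_1: "1 \<le> mgf_const p"
  by (simp add: mgf_const_def)

lemma incr_exp_step:
  assumes p: "0 < p" "p < 1"
  shows "p * exp (s * (z + a * incr p b b)) + (1 - p) * exp (s * (z + a * incr p b (\<not> b)))
    \<le> exp (mgf_const p * s\<^sup>2 * a\<^sup>2) * exp (s * z)"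
proof -
  define r where "r = p / (1 - p)"
  have r: "(1 - p) * r = p" using p by (auto simp: r_def)
  define x where "x = s * a * sgn_of b"
  have x2: "x\<^sup>2 = s\<^sup>2 * a\<^sup>2" by (simp add: x_def sgn_of_def power_mult_distrib)
  have le: "exp u \<le> u + exp (mgf_const p * x\<^sup>2)" if "u\<^sup>2 \<le> mgf_const p * x\<^sup>2" for u
  proof -
    have "exp (u\<^sup>2) \<le> exp (mgf_const p * x\<^sup>2)" using that by simp
    then show ?thesis using exp_le_add_exp_square[of u] by linarith
  qed
  have a: "exp x \<le> x + exp (mgf_const p * x\<^sup>2)"
    by (rule le) (simp add: mgf_const_def algebra_simps)
  have b: "exp (- r * x) \<le> - r * x + exp (mgf_const p * x\<^sup>2)"
    by (rule le) (simp add: mgf_const_def r_def[symmetric] algebra_simps power_mult_distrib)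
  have "p * exp x + (1 - p) * exp (- r * x) \<le> p * (x + exp (mgf_const p * x\<^sup>2)) + (1 - p) * (- r * x + exp (mgf_const p * x\<^sup>2))"
    using p a b by (intro add_mono mult_left_mono) auto
  also have "\<dots> = exp (mgf_const p * x\<^sup>2) + x * (p - (1 - p) * r)" by (simp add: algebra_simps)
  finally have "p * exp x + (1 - p) * exp (- r * x) \<le> exp (mgf_const p * x\<^sup>2)" using r by simp
  then have "(p * exp x + (1 - p) * exp (- r * x)) * exp (s * z) \<le> exp (mgf_const p * x\<^sup>2) * exp (s * z)"
    by (rule mult_right_mono) simp
  moreover have e1: "s * (z + a * incr p b b) = x + s * z" and e2: "s * (z + a * incr p b (\<not> b)) = - r * x + s * z"
    by (simp_all add: incr_def x_def r_def algebra_simps)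
  ultimately show ?thesis unfolding e1 e2 exp_add x2 by (simp add: algebra_simps)
qed

text \<open>Since \<open>cosh\<close> is even, the two directions in which a threshold can be
  crossed are treated together.\<close>

lemma incr_cosh_step:
  assumes p: "0 < p" "p < 1"
  shows "p * cosh (s * (z + a * incr p b b)) + (1 - p) * cosh (s * (z + a * incr p b (\<not> b)))
    \<le> exp (mgf_const p * s\<^sup>2 * a\<^sup>2) * cosh (s * z)"
proof -
  have c: "cosh u = (exp u + exp (- u)) / 2" for u :: real by (simp add: cosh_def)
  have "p * exp (- s * (z + a * incr p b b)) + (1 - p) * exp (- s * (z + a * incr p b (\<not> b)))
    \<le> exp (mgf_const p * s\<^sup>2 * a\<^sup>2) * exp (- s * z)"
    using incr_exp_step[OF p, of "- s" z a b] by simp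
  moreover note incr_exp_step[OF p, of s z a b]
  ultimately show ?thesis unfolding c by (simp add: field_simps)
qed

text \<open>The recursion carries the current position \<open>z\<close> along and follows that of
  \<open>path_exp\<close>, so that both unfold together in an induction; \<open>path_hit_iff\<close>
  recovers the usual description by partial sums.\<close>

fun path_hit :: "real \<Rightarrow> (nat \<Rightarrow> real) \<Rightarrow> real \<Rightarrow> real \<Rightarrow> bool \<Rightarrow> bool list \<Rightarrow> bool" where
  "path_hit p a \<theta> z b [] \<longleftrightarrow> \<theta> \<le> \<bar>z\<bar>"
| "path_hit p a \<theta> z b (c # l) \<longleftrightarrow> \<theta> \<le> \<bar>z\<bar> \<or> path_hit p (\<lambda>i. a (Suc i)) \<theta> (z + a 0 * incr p b c) c l"

lemma path_hit_iff: "path_hit p a \<theta> z b l \<longleftrightarrow> (\<exists>k\<le>length l. \<theta> \<le> \<bar>z + path_sum p a b (take k l)\<bar>)"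
proof (induction l arbitrary: a z b)
  case (Cons c l)
  have "(\<exists>k\<le>length (c # l). \<theta> \<le> \<bar>z + path_sum p a b (take k (c # l))\<bar>) \<longleftrightarrow>
    \<theta> \<le> \<bar>z\<bar> \<or> (\<exists>k\<le>length l. \<theta> \<le> \<bar>z + path_sum p a b (take (Suc k) (c # l))\<bar>)"
    (is "?L \<longleftrightarrow> ?R")
  proof
    assume ?L
    then obtain k where k: "k \<le> length (c # l)" "\<theta> \<le> \<bar>z + path_sum p a b (take k (c # l))\<bar>" by blast
    then show ?R by (cases k) auto
  next
    assume ?R
    then show ?L
    proof
      assume "\<theta> \<le> \<bar>z\<bar>" then show ?L by (intro exI[of _ 0]) simp
    next
      assume "\<exists>k\<le>length l. \<theta> \<le> \<bar>z + path_sum p a b (take (Suc k) (c # l))\<bar>"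
      then obtain k where "k \<le> length l" "\<theta> \<le> \<bar>z + path_sum p a b (take (Suc k) (c # l))\<bar>" by blast
      then show ?L by (intro exI[of _ "Suc k"]) simp
    qed
  qed
  then show ?case using Cons.IH by (simp add: add.assoc)
qed simp

text \<open>
  Once the threshold is reached the probability is \<open>1\<close> and the bound is trivial, so a plain induction over the
  path replaces the optional stopping argument.
\<close>

lemma path_hit_cosh:
  assumes p: "0 < p" "p < 1" and s: "s \<ge> 0" "\<theta> \<ge> 0"
  shows "path_exp p b m (\<lambda>l. if path_hit p a \<theta> z b l then 1 else 0) * cosh (s * \<theta>)
    \<le> exp (mgf_const p * s\<^sup>2 * (\<Sum>i<m. (a i)\<^sup>2)) * cosh (s * z)"
proof (induction m arbitrary: a z b)
  case base: 0
  show ?case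
  proof (cases "\<theta> \<le> \<bar>z\<bar>")
    case True
    then have "s * \<theta> \<le> \<bar>s * z\<bar>" using s by (simp add: abs_mult mult_left_mono)
    then have "cosh (s * \<theta>) \<le> cosh (s * z)"
      using s cosh_real_nonneg_le_iff[of "s * \<theta>" "\<bar>s * z\<bar>"] by simp
    then show ?thesis using True by simp
  qed simp
next
  case (Suc m)
  have K: "0 \<le> mgf_const p" using mgf_const_ge_1[of p] by linarith
  define a' where "a' i = a (Suc i)" for i
  define E where "E = exp (mgf_const p * s\<^sup>2 * (\<Sum>i<m. (a' i)\<^sup>2))"
  have sum: "(\<Sum>i<Suc m. (a i)\<^sup>2) = (a 0)\<^sup>2 + (\<Sum>i<m. (a' i)\<^sup>2)"
    unfolding a'_def by (rule sum.lessThan_Suc_shift)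
  have exp_sum: "exp (mgf_const p * s\<^sup>2 * (\<Sum>i<Suc m. (a i)\<^sup>2)) = E * exp (mgf_const p * s\<^sup>2 * (a 0)\<^sup>2)"
    unfolding sum E_def exp_add[symmetric] by (simp add: algebra_simps)
  show ?case
  proof (cases "\<theta> \<le> \<bar>z\<bar>")
    case True
    then have "s * \<theta> \<le> \<bar>s * z\<bar>" using s by (simp add: abs_mult mult_left_mono)
    then have c: "cosh (s * \<theta>) \<le> cosh (s * z)"
      using s cosh_real_nonneg_le_iff[of "s * \<theta>" "\<bar>s * z\<bar>"] by simp
    have "path_hit p a \<theta> z b l" for l using True by (cases l) auto
    then have one: "path_exp p b (Suc m) (\<lambda>l. if path_hit p a \<theta> z b l then 1 else 0) = 1"
      using path_exp_const[of p b "Suc m" 1] by simp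
    have "1 * cosh (s * z) \<le> exp (mgf_const p * s\<^sup>2 * (\<Sum>i<Suc m. (a i)\<^sup>2)) * cosh (s * z)"
      using K by (intro mult_right_mono one_le_exp_iff[THEN iffD2] mult_nonneg_nonneg sum_nonneg) auto
    then show ?thesis unfolding one using c by linarith
  next
    case False
    define U where "U c = path_exp p c m (\<lambda>l. if path_hit p a' \<theta> (z + a 0 * incr p b c) c l then 1 else 0)" for c
    have U: "U c * cosh (s * \<theta>) \<le> E * cosh (s * (z + a 0 * incr p b c))" for c
      unfolding U_def E_def by (rule Suc.IH)
    have ex: "path_exp p b (Suc m) (\<lambda>l. if path_hit p a \<theta> z b l then 1 else 0) = p * U b + (1 - p) * U (\<not> b)"
      unfolding path_exp_Suc U_def a'_def using False by simp
    have "path_exp p b (Suc m) (\<lambda>l. if path_hit p a \<theta> z b l then 1 else 0) * cosh (s * \<theta>)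
      = p * (U b * cosh (s * \<theta>)) + (1 - p) * (U (\<not> b) * cosh (s * \<theta>))"
      unfolding ex by (simp add: algebra_simps)
    also have "\<dots> \<le> p * (E * cosh (s * (z + a 0 * incr p b b))) + (1 - p) * (E * cosh (s * (z + a 0 * incr p b (\<not> b))))"
      using p U by (intro add_mono mult_left_mono) auto
    also have "\<dots> = E * (p * cosh (s * (z + a 0 * incr p b b)) + (1 - p) * cosh (s * (z + a 0 * incr p b (\<not> b))))"
      by (simp add: algebra_simps)
    also have "\<dots> \<le> E * (exp (mgf_const p * s\<^sup>2 * (a 0)\<^sup>2) * cosh (s * z))"
      by (rule mult_left_mono[OF incr_cosh_step[OF p]]) (simp add: E_def)
    finally show ?thesis unfolding exp_sum by (simp add: mult.assoc)
  qed
qed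

theorem path_maximal_inequality:
  assumes p: "0 < p" "p < 1" and \<theta>: "\<theta> \<ge> 0" and V: "(\<Sum>i<m. (a i)\<^sup>2) \<le> V" "V > 0"
  shows "path_exp p b m (\<lambda>l. if \<exists>k\<le>length l. \<theta> \<le> \<bar>path_sum p a b (take k l)\<bar> then 1 else 0)
    \<le> 2 * exp (- \<theta>\<^sup>2 / (4 * mgf_const p * V))"
proof -
  define K where "K = mgf_const p"
  have K: "K > 0" using mgf_const_ge_1[of p] unfolding K_def by linarith
  \<comment> \<open>This value minimises the exponent
    \<open>K * s ^ 2 * V - s * \<theta>\<close>.\<close>
  define s where "s = \<theta> / (2 * K * V)"
  have s: "s \<ge> 0" using \<theta> K V by (simp add: s_def)
  define P where "P = path_exp p b m (\<lambda>l. if path_hit p a \<theta> 0 b l then 1 else 0)"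
  have P0: "P \<ge> 0" unfolding P_def path_exp_def using p by (intro sum_nonneg mult_nonneg_nonneg path_weight_nonneg) auto
  have "P * (exp (s * \<theta>) / 2) \<le> P * cosh (s * \<theta>)"
    by (rule mult_left_mono[OF _ P0]) (simp add: cosh_def)
  also have "\<dots> \<le> exp (K * s\<^sup>2 * (\<Sum>i<m. (a i)\<^sup>2))"
    using path_hit_cosh[OF p s \<theta>, of b m a 0] by (simp add: P_def K_def)
  also have "\<dots> \<le> exp (K * s\<^sup>2 * V)"
    using K V by (simp add: mult_left_mono)
  finally have "P \<le> 2 * (exp (K * s\<^sup>2 * V) / exp (s * \<theta>))" by (simp add: field_simps)
  also have "exp (K * s\<^sup>2 * V) / exp (s * \<theta>) = exp (K * s\<^sup>2 * V - s * \<theta>)" by (simp add: exp_diff)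
  also have "K * s\<^sup>2 * V - s * \<theta> = - \<theta>\<^sup>2 / (4 * K * V)"
    using K V by (simp add: s_def power2_eq_square field_simps)
  finally show ?thesis unfolding P_def K_def path_hit_iff by simp
qed


section \<open>Passing between sums of signs and martingale sums\<close>

lemma path_sum_eq: "path_sum p a b l = (\<Sum>i<length l. a i * incr p ((b # l) ! i) (l ! i))"
proof (induction l arbitrary: a b)
  case (Cons c l)
  have "(\<Sum>i<length (c # l). a i * incr p ((b # c # l) ! i) ((c # l) ! i)) =
    a 0 * incr p b c + (\<Sum>i<length l. a (Suc i) * incr p ((c # l) ! i) (l ! i))"
    by (simp only: length_Cons sum.lessThan_Suc_shift nth_Cons_0 nth_Cons_Suc)
  then show ?case using Cons.IH by simp
qed simp

text \<open>With \<open>\<rho> = 2 * p - 1\<close> the coefficient is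
  \<open>\<rho> / (1 - \<rho>)\<close>. A sign plus a multiple of a difference of consecutive signs
  is the shape to which summation by parts applies.\<close>

lemma incr_eq:
  assumes "p < 1"
  shows "incr p b c = sgn_of c + (2 * p - 1) / (2 * (1 - p)) * (sgn_of c - sgn_of b)"
  using assms by (cases b; cases c) (simp_all add: incr_def sgn_of_def field_simps)

lemma incr_eq':
  assumes "p < 1"
  shows "sgn_of c - (2 * p - 1) * sgn_of b = 2 * (1 - p) * incr p b c"
  using assms by (cases b; cases c) (simp_all add: incr_def sgn_of_def field_simps)

text \<open>
  With this solution, \<open>\<Sum> \<beta>\<^sub>k X\<^sub>k\<close> becomes the martingale \<open>\<Sum> c\<^sub>k (X\<^sub>k - \<rho> X\<^sub>k\<^sub>-\<^sub>1)\<close> up to bounded boundary terms.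
\<close>

lemma geometric_backward_solution:
  fixes \<beta> :: "nat \<Rightarrow> real"
  assumes \<beta>: "summable (\<lambda>k. (\<beta> k)\<^sup>2)" and \<rho>: "\<bar>\<rho>\<bar> < 1"
  shows "\<exists>c V B. (\<forall>k. \<beta> k = c k - \<rho> * c (Suc k)) \<and> (\<forall>k. \<bar>c k\<bar> \<le> B) \<and> 0 < V \<and> (\<forall>n. (\<Sum>i<n. (c i)\<^sup>2) \<le> V)"
proof -
  define q where "q = \<bar>\<rho>\<bar>"
  have q: "0 \<le> q" "q < 1" using \<rho> by (auto simp: q_def)
  define W where "W = (\<Sum>k. (\<beta> k)\<^sup>2)"
  have W: "(\<Sum>i\<in>I. (\<beta> i)\<^sup>2) \<le> W" if "finite I" for I
    unfolding W_def by (rule sum_le_suminf[OF \<beta> that]) simp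
  have W0: "W \<ge> 0" using W[of "{}"] by simp
  have b: "\<bar>\<beta> k\<bar> \<le> sqrt W" for k
    using W[of "{k}"] by (simp add: real_le_rsqrt)
  have nb: "norm (\<rho> ^ j * \<beta> (k + j)) \<le> sqrt W * q ^ j" for j k
    using mult_left_mono[OF b[of "k + j"], of "q ^ j"] q by (simp add: abs_mult power_abs q_def mult.commute)
  have sg: "summable (\<lambda>j. sqrt W * q ^ j)" using q by (intro summable_mult) (simp add: summable_geometric)
  have sm: "summable (\<lambda>j. \<rho> ^ j * \<beta> (k + j))" for k
    by (rule summable_comparison_test'[OF sg, of 0]) (rule nb)
  \<comment> \<open>The recursion is solved from infinity: \<open>c k\<close> is expressed by the
    later values of \<open>\<beta>\<close>, with geometrically decaying weights.\<close>
  define c where "c k = (\<Sum>j. \<rho> ^ j * \<beta> (k + j))" for k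
  have rec: "\<beta> k = c k - \<rho> * c (Suc k)" for k
  proof -
    have "c k = (\<Sum>j. \<rho> ^ Suc j * \<beta> (k + Suc j)) + \<beta> k"
      using suminf_split_head[OF sm[of k]] by (simp add: c_def)
    also have "(\<lambda>j. \<rho> ^ Suc j * \<beta> (k + Suc j)) = (\<lambda>j. \<rho> * (\<rho> ^ j * \<beta> (Suc k + j)))"
      by (simp add: mult.assoc)
    also have "suminf \<dots> = \<rho> * c (Suc k)"
      unfolding c_def by (rule suminf_mult[OF sm])
    finally show ?thesis by simp
  qed
  define B where "B = sqrt W * (1 / (1 - q))"
  have cB: "\<bar>c k\<bar> \<le> B" for k
  proof -
    have "norm (c k) \<le> (\<Sum>j. sqrt W * q ^ j)"
      unfolding c_def by (rule norm_suminf_le[OF _ sg]) (rule nb)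
    also have "\<dots> = B"
      unfolding B_def using q by (subst suminf_mult) (simp_all add: summable_geometric suminf_geometric)
    finally show ?thesis by simp
  qed
  \<comment> \<open>Convexity of the square with the weights \<open>1 - q\<close> and
    \<open>q\<close>, at the points \<open>x / (1 - q)\<close> and \<open>y\<close>.\<close>
  have step: "(c i)\<^sup>2 \<le> (\<beta> i)\<^sup>2 / (1 - q) + q * (c (Suc i))\<^sup>2" for i
  proof -
    define x where "x = \<bar>\<beta> i\<bar>"
    define y where "y = \<bar>c (Suc i)\<bar>"
    have "\<bar>c i\<bar> \<le> x + q * y"
      using rec[of i] abs_triangle_ineq[of "\<beta> i" "\<rho> * c (Suc i)"] by (simp add: x_def y_def q_def abs_mult)
    then have "\<bar>c i\<bar>\<^sup>2 \<le> (x + q * y)\<^sup>2" by (rule power_mono) simp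
    also have "\<dots> = x\<^sup>2 / (1 - q) + q * y\<^sup>2 - q / (1 - q) * (x - (1 - q) * y)\<^sup>2"
    proof -
      define w where "w = 1 - q"
      have w: "w > 0" "q = 1 - w" using q by (simp_all add: w_def)
      have "x\<^sup>2 / w + q * y\<^sup>2 - q / w * (x - w * y)\<^sup>2 = (x\<^sup>2 + q * y\<^sup>2 * w - q * (x - w * y)\<^sup>2) / w"
        using w(1) by (simp add: diff_divide_distrib add_divide_distrib)
      also have "x\<^sup>2 + q * y\<^sup>2 * w - q * (x - w * y)\<^sup>2 = (x + q * y)\<^sup>2 * w"
        unfolding w(2) by (simp add: algebra_simps power2_eq_square)
      finally show ?thesis using w(1) by (simp add: w_def)
    qed
    also have "\<dots> \<le> x\<^sup>2 / (1 - q) + q * y\<^sup>2"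
      using q by simp
    finally show ?thesis by (simp add: x_def y_def)
  qed
  define V where "V = (W / (1 - q) + q * B\<^sup>2) / (1 - q) + 1"
  have "(\<Sum>i<n. (c i)\<^sup>2) \<le> V" for n
  proof -
    define T where "T = (\<Sum>i<n. (c i)\<^sup>2)"
    have "T \<le> (\<Sum>i<n. (\<beta> i)\<^sup>2 / (1 - q) + q * (c (Suc i))\<^sup>2)"
      unfolding T_def by (rule sum_mono) (rule step)
    also have "\<dots> = (\<Sum>i<n. (\<beta> i)\<^sup>2) / (1 - q) + q * (\<Sum>i<n. (c (Suc i))\<^sup>2)"
      by (simp add: sum.distrib sum_divide_distrib sum_distrib_left)
    \<comment> \<open>The index shift costs one boundary term, at most \<open>B ^ 2\<close>. As
      \<open>q < 1\<close>, the sum \<open>T\<close> on the right can then be absorbed on the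
      left.\<close>
    also have "\<dots> \<le> W / (1 - q) + q * (T + B\<^sup>2)"
    proof (rule add_mono)
      show "(\<Sum>i<n. (\<beta> i)\<^sup>2) / (1 - q) \<le> W / (1 - q)"
        using W[of "{..<n}"] q by (simp add: divide_right_mono)
      have "(c 0)\<^sup>2 + (\<Sum>i<n. (c (Suc i))\<^sup>2) = T + (c n)\<^sup>2"
        using sum.lessThan_Suc_shift[of "\<lambda>i. (c i)\<^sup>2" n] by (simp add: T_def)
      moreover have "(c n)\<^sup>2 \<le> B\<^sup>2" using power_mono[OF cB[of n], of 2] by simp
      ultimately have "(\<Sum>i<n. (c (Suc i))\<^sup>2) \<le> T + B\<^sup>2" using zero_le_power2[of "c 0"] by linarith
      then show "q * (\<Sum>i<n. (c (Suc i))\<^sup>2) \<le> q * (T + B\<^sup>2)" using q by (intro mult_left_mono) auto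
    qed
    finally have "T * (1 - q) \<le> W / (1 - q) + q * B\<^sup>2" by (simp add: algebra_simps)
    then have "T \<le> (W / (1 - q) + q * B\<^sup>2) / (1 - q)" using q by (simp add: pos_le_divide_eq)
    then show ?thesis by (simp add: T_def V_def)
  qed
  moreover have "V > 0" unfolding V_def using q W0 by (intro add_nonneg_pos divide_nonneg_pos add_nonneg_nonneg) auto
  ultimately show ?thesis using rec cB
    by - (rule exI[of _ c], rule exI[of _ V], rule exI[of _ B], simp)
qed

text \<open>When the partial sums first reach \<open>2 * \<theta>\<close>, the rest of the sum is
  independent of the past and smaller than \<open>\<theta>\<close> with probability at least 1/2; in
  that case the final sum still reaches \<open>\<theta>\<close>. In the proof \<open>A k\<close> is
  the first passage at \<open>k\<close> and \<open>R k\<close> the event that the rest is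
  small.\<close>

lemma (in prob_space) ottaviani:
  fixes D :: "nat \<Rightarrow> 'a \<Rightarrow> real"
  assumes ind: "indep_vars (\<lambda>_. borel) D {..<m}"
    and half: "\<And>k. k \<le> m \<Longrightarrow> prob {\<omega>\<in>space M. \<theta> \<le> \<bar>\<Sum>i=k..<m. D i \<omega>\<bar>} \<le> 1 / 2"
  shows "prob {\<omega>\<in>space M. \<exists>k\<le>m. 2 * \<theta> \<le> \<bar>\<Sum>i<k. D i \<omega>\<bar>} \<le> 2 * prob {\<omega>\<in>space M. \<theta> \<le> \<bar>\<Sum>i<m. D i \<omega>\<bar>}"
proof -
  have D: "D i \<in> borel_measurable M" if "i < m" for i
    using ind that by (auto simp: indep_vars_def)
  have Sm: "(\<lambda>\<omega>. \<Sum>i\<in>I. D i \<omega>) \<in> borel_measurable M" if "I \<subseteq> {..<m}" for I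
    by (rule borel_measurable_sum) (use that D in auto)
  define S where "S k \<omega> = (\<Sum>i<k. D i \<omega>)" for k \<omega>
  have S [measurable]: "S k \<in> borel_measurable M" if "k \<le> m" for k
    unfolding S_def by (rule Sm) (use that in auto)
  define A where "A k = {\<omega>\<in>space M. 2 * \<theta> \<le> \<bar>S k \<omega>\<bar> \<and> (\<forall>j<k. \<bar>S j \<omega>\<bar> < 2 * \<theta>)}" for k
  define R where "R k = {\<omega>\<in>space M. \<bar>\<Sum>i=k..<m. D i \<omega>\<bar> < \<theta>}" for k
  have A: "A k \<in> events" if "k \<le> m" for k
  proof -
    have [measurable]: "S j \<in> borel_measurable M" if "j \<in> {..k}" for j using that \<open>k \<le> m\<close> by simp
    have "A k = {\<omega>\<in>space M. 2 * \<theta> \<le> \<bar>S k \<omega>\<bar> \<and> (\<forall>j\<in>{..<k}. \<bar>S j \<omega>\<bar> < 2 * \<theta>)}" by (auto simp: A_def)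
    moreover have "\<dots> \<in> events" by measurable (use \<open>k \<le> m\<close> in auto)
    ultimately show ?thesis by simp
  qed
  have R: "R k \<in> events" if "k \<le> m" for k
    unfolding R_def using Sm[of "{k..<m}"] by measurable auto
  have indAR: "prob (A k \<inter> R k) = prob (A k) * prob (R k)" if k: "k \<le> m" for k
  proof -
    let ?X = "\<lambda>\<omega>. restrict (\<lambda>i. D i \<omega>) {..<k}" and ?Y = "\<lambda>\<omega>. restrict (\<lambda>i. D i \<omega>) {k..<m}"
    have iv: "indep_var (PiM {..<k} (\<lambda>_. borel)) ?X (PiM {k..<m} (\<lambda>_. borel)) ?Y"
      by (rule indep_var_restrict[OF ind]) (use k in auto)
    define XA where "XA = {f\<in>space (PiM {..<k} (\<lambda>_. borel)). 2 * \<theta> \<le> \<bar>\<Sum>i<k. f i :: real\<bar> \<and> (\<forall>j\<in>{..<k}. \<bar>\<Sum>i<j. f i\<bar> < 2 * \<theta>)}"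
    define YR where "YR = {f\<in>space (PiM {k..<m} (\<lambda>_. borel)). \<bar>\<Sum>i=k..<m. f i :: real\<bar> < \<theta>}"
    have s: "(\<lambda>f. \<Sum>i\<in>J. f i :: real) \<in> borel_measurable (PiM I (\<lambda>_. borel))" if "J \<subseteq> I" for I J :: "nat set"
      by (rule borel_measurable_sum) (use that in auto)
    have XA: "XA \<in> sets (PiM {..<k} (\<lambda>_. borel))"
      unfolding XA_def
    proof (intro sets.sets_Collect_conj sets.sets_Collect_finite_All)
      have [measurable]: "(\<lambda>f. \<Sum>i<k. f i :: real) \<in> borel_measurable (PiM {..<k} (\<lambda>_. borel))" by (rule s) simp
      show "{f\<in>space (PiM {..<k} (\<lambda>_. borel)). 2 * \<theta> \<le> \<bar>\<Sum>i<k. f i :: real\<bar>} \<in> sets (PiM {..<k} (\<lambda>_. borel))"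
        by measurable
      fix j assume "j \<in> {..<k}"
      then have [measurable]: "(\<lambda>f. \<Sum>i<j. f i :: real) \<in> borel_measurable (PiM {..<k} (\<lambda>_. borel))"
        by (intro s) auto
      show "{f\<in>space (PiM {..<k} (\<lambda>_. borel)). \<bar>\<Sum>i<j. f i :: real\<bar> < 2 * \<theta>} \<in> sets (PiM {..<k} (\<lambda>_. borel))"
        by measurable
    qed simp
    have YR: "YR \<in> sets (PiM {k..<m} (\<lambda>_. borel))"
    proof -
      have [measurable]: "(\<lambda>f. \<Sum>i=k..<m. f i :: real) \<in> borel_measurable (PiM {k..<m} (\<lambda>_. borel))" by (rule s) simp
      show ?thesis unfolding YR_def by measurable
    qed
    have mX: "?X \<in> M \<rightarrow>\<^sub>M PiM {..<k} (\<lambda>_. borel)" and mY: "?Y \<in> M \<rightarrow>\<^sub>M PiM {k..<m} (\<lambda>_. borel)"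
      using indep_var_rv1[OF iv] indep_var_rv2[OF iv] by auto
    have sr: "(\<Sum>i<j. restrict (\<lambda>i. D i \<omega>) {..<k} i) = S j \<omega>" if "j \<le> k" for j \<omega>
      unfolding S_def by (rule sum.cong) (use that in auto)
    have eA: "?X -` XA \<inter> space M = A k"
    proof -
      have "?X \<omega> \<in> XA \<longleftrightarrow> \<omega> \<in> A k" if "\<omega> \<in> space M" for \<omega>
        using measurable_space[OF mX that] that sr[of _ \<omega>] unfolding XA_def A_def by (simp add: less_imp_le Ball_def)
      moreover have "A k \<subseteq> space M" by (auto simp: A_def)
      ultimately show ?thesis by blast
    qed
    have eR: "?Y -` YR \<inter> space M = R k"
      using measurable_space[OF mY] by (auto simp: YR_def R_def)
    have "prob ((\<lambda>x. (?X x, ?Y x)) -` (XA \<times> YR) \<inter> space M) = prob (A k) * prob (R k)"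
      using indep_varD[OF iv XA YR] unfolding eA eR .
    moreover have "(\<lambda>x. (?X x, ?Y x)) -` (XA \<times> YR) \<inter> space M = (?X -` XA \<inter> space M) \<inter> (?Y -` YR \<inter> space M)" by auto
    ultimately show ?thesis unfolding eA eR by simp
  qed
  have Rhalf: "1 / 2 \<le> prob (R k)" if "k \<le> m" for k
  proof -
    have "{\<omega>\<in>space M. \<theta> \<le> \<bar>\<Sum>i=k..<m. D i \<omega>\<bar>} = space M - R k" unfolding R_def by auto
    then show ?thesis using half[OF that] prob_compl[OF R[OF that]] by simp
  qed
  have disjA: "disjoint_family_on A {..m}"
    unfolding disjoint_family_on_def
  proof (intro ballI impI)
    fix i j :: nat assume "i \<noteq> j"
    then consider "i < j" | "j < i" by linarith
    then show "A i \<inter> A j = {}" by cases (fastforce simp: A_def)+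
  qed
  have disj: "disjoint_family_on (\<lambda>k. A k \<inter> R k) {..m}"
    using disjA by (auto simp: disjoint_family_on_def)
  have "{\<omega>\<in>space M. \<exists>k\<le>m. 2 * \<theta> \<le> \<bar>S k \<omega>\<bar>} = (\<Union>k\<le>m. A k)"
  proof (intro set_eqI iffI)
    fix \<omega> assume "\<omega> \<in> {\<omega>\<in>space M. \<exists>k\<le>m. 2 * \<theta> \<le> \<bar>S k \<omega>\<bar>}"
    then obtain k where k: "\<omega> \<in> space M" "k \<le> m" "2 * \<theta> \<le> \<bar>S k \<omega>\<bar>" by blast
    define j where "j = (LEAST j. 2 * \<theta> \<le> \<bar>S j \<omega>\<bar>)"
    have j: "2 * \<theta> \<le> \<bar>S j \<omega>\<bar>" "j \<le> k" unfolding j_def by (rule LeastI[of _ k], rule k(3)) (rule Least_le, rule k(3))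
    have "\<bar>S i \<omega>\<bar> < 2 * \<theta>" if "i < j" for i
      using not_less_Least[of i "\<lambda>j. 2 * \<theta> \<le> \<bar>S j \<omega>\<bar>"] that unfolding j_def by simp
    then have "\<omega> \<in> A j" using j(1) k(1) by (simp add: A_def)
    then show "\<omega> \<in> (\<Union>k\<le>m. A k)" using j(2) k(2) by auto
  qed (auto simp: A_def)
  then have "prob {\<omega>\<in>space M. \<exists>k\<le>m. 2 * \<theta> \<le> \<bar>S k \<omega>\<bar>} = (\<Sum>k\<le>m. prob (A k))"
    using finite_measure_finite_Union[OF _ _ disjA] A by auto
  also have "\<dots> \<le> (\<Sum>k\<le>m. 2 * prob (A k \<inter> R k))"
  proof (rule sum_mono)
    fix k assume "k \<in> {..m}"
    then have k: "k \<le> m" by simp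
    have "prob (A k) * (1 / 2) \<le> prob (A k) * prob (R k)" by (rule mult_left_mono[OF Rhalf[OF k]]) simp
    then show "prob (A k) \<le> 2 * prob (A k \<inter> R k)" unfolding indAR[OF k] by simp
  qed
  also have "\<dots> = 2 * prob (\<Union>k\<le>m. A k \<inter> R k)"
  proof -
    have "(\<lambda>k. A k \<inter> R k) ` {..m} \<subseteq> events" using A R by auto
    from finite_measure_finite_Union[OF _ this disj] show ?thesis by (simp add: sum_distrib_left)
  qed
  also have "\<dots> \<le> 2 * prob {\<omega>\<in>space M. \<theta> \<le> \<bar>S m \<omega>\<bar>}"
  proof (intro mult_left_mono finite_measure_mono)
    show "(\<Union>k\<le>m. A k \<inter> R k) \<subseteq> {\<omega>\<in>space M. \<theta> \<le> \<bar>S m \<omega>\<bar>}"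
    proof
      fix \<omega> assume "\<omega> \<in> (\<Union>k\<le>m. A k \<inter> R k)"
      then obtain k where k: "k \<le> m" "\<omega> \<in> A k" "\<omega> \<in> R k" by blast
      have "{..<m} = {..<k} \<union> {k..<m}" using k(1) by auto
      then have "S m \<omega> = S k \<omega> + (\<Sum>i=k..<m. D i \<omega>)"
        unfolding S_def by (simp add: sum.union_disjoint disjoint_iff)
      then show "\<omega> \<in> {\<omega>\<in>space M. \<theta> \<le> \<bar>S m \<omega>\<bar>}"
        using k(2,3) unfolding A_def R_def by auto
    qed
    show "{\<omega>\<in>space M. \<theta> \<le> \<bar>S m \<omega>\<bar>} \<in> events" using S[of m] by measurable
  qed simp
  finally show ?thesis unfolding S_def .
qed


section \<open>The maximal inequality for Brownian motion\<close>

lemma normal_measure_tail: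
  assumes "\<sigma> > 0" "x \<ge> 0"
  shows "measure (normal_measure \<sigma>) {y. x \<le> \<bar>y\<bar>} \<le> 2 * exp (- x\<^sup>2 / (2 * \<sigma>\<^sup>2))"
proof -
  have "measure (normal_measure \<sigma>) {y. x \<le> \<bar>y\<bar>} = measure std_gauss {y. x \<le> \<bar>\<sigma> * y\<bar>}"
    unfolding normal_measure_distr[OF assms(1)] by (subst measure_distr) (auto simp: vimage_def)
  also have "{y. x \<le> \<bar>\<sigma> * y\<bar>} = {y. x / \<sigma> \<le> \<bar>y\<bar>}"
    using assms(1) by (auto simp: abs_mult field_simps)
  also have "measure std_gauss {y. x / \<sigma> \<le> \<bar>y\<bar>} \<le> 2 * exp (- (x / \<sigma>)\<^sup>2 / 2)"
    by (rule std_normal_tail) (use assms in simp)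
  finally show ?thesis by (simp add: power_divide mult.commute)
qed

context
  fixes N :: "'b measure" and B :: "real \<Rightarrow> 'b \<Rightarrow> real"
  assumes B: "standard_brownian_motion N B"
begin

interpretation prob_space N using B by (simp add: standard_brownian_motion_def)

lemma bm_measurable: "t \<ge> 0 \<Longrightarrow> B t \<in> borel_measurable N"
  using B by (simp add: standard_brownian_motion_def)

lemma bm_increment_law:
  assumes "0 \<le> s" "s < t"
  shows "distr N borel (\<lambda>\<omega>. B t \<omega> - B s \<omega>) = normal_measure (sqrt (t - s))"
proof -
  have "distributed N lborel (\<lambda>\<omega>. B t \<omega> - B s \<omega>) (normal_density 0 (sqrt (t - s)))"
    using B assms by (simp add: standard_brownian_motion_def)
  then have "distr N lborel (\<lambda>\<omega>. B t \<omega> - B s \<omega>) = normal_measure (sqrt (t - s))"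
    by (simp add: distributed_def)
  moreover have "distr N lborel (\<lambda>\<omega>. B t \<omega> - B s \<omega>) = distr N borel (\<lambda>\<omega>. B t \<omega> - B s \<omega>)"
    by (rule distr_cong) auto
  ultimately show ?thesis by simp
qed

lemma bm_increment_tail:
  assumes "0 \<le> s" "s \<le> t" "t - s \<le> V" "0 < x"
  shows "prob {\<omega>\<in>space N. x \<le> \<bar>B t \<omega> - B s \<omega>\<bar>} \<le> 2 * exp (- x\<^sup>2 / (2 * V))"
proof (cases "s = t")
  case True
  then have "{\<omega>\<in>space N. x \<le> \<bar>B t \<omega> - B s \<omega>\<bar>} = {}" using assms by auto
  then show ?thesis by (simp only:) simp
next
  case False
  then have st: "s < t" using assms by simp
  have m: "(\<lambda>\<omega>. B t \<omega> - B s \<omega>) \<in> borel_measurable N"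
    using bm_measurable assms by (intro borel_measurable_diff) auto
  have "{\<omega>\<in>space N. x \<le> \<bar>B t \<omega> - B s \<omega>\<bar>} = (\<lambda>\<omega>. B t \<omega> - B s \<omega>) -` {y. x \<le> \<bar>y\<bar>} \<inter> space N" by auto
  then have "prob {\<omega>\<in>space N. x \<le> \<bar>B t \<omega> - B s \<omega>\<bar>} = measure (distr N borel (\<lambda>\<omega>. B t \<omega> - B s \<omega>)) {y. x \<le> \<bar>y\<bar>}"
    using m by (simp add: measure_distr)
  also have "\<dots> \<le> 2 * exp (- x\<^sup>2 / (2 * (sqrt (t - s))\<^sup>2))"
    unfolding bm_increment_law[OF assms(1) st] by (rule normal_measure_tail) (use st assms in auto)
  also have "\<dots> \<le> 2 * exp (- x\<^sup>2 / (2 * V))"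
    using st assms by (simp add: frac_le)
  finally show ?thesis .
qed

text \<open>A finite set of times is enough, as the path is inspected only at the values of
  \<open>square_sum a\<close> within one block. If the Gaussian tail at \<open>x / 2\<close> is at
  most 1/2, then \<open>ottaviani\<close> applies with \<open>\<theta> = x / 2\<close>; otherwise
  the asserted bound is at least 1.\<close>

theorem bm_maximal_inequality:
  assumes s: "0 \<le> s" "s < e" and T: "finite T" "T \<subseteq> {s..e}" and x: "x > 0"
  shows "prob {\<omega>\<in>space N. \<exists>t\<in>T. x \<le> \<bar>B t \<omega> - B s \<omega>\<bar>} \<le> 4 * exp (- x\<^sup>2 / (8 * (e - s)))"
proof -
  define q where "q = exp (- x\<^sup>2 / (8 * (e - s)))"
  have tail: "prob {\<omega>\<in>space N. x / 2 \<le> \<bar>B v \<omega> - B u \<omega>\<bar>} \<le> 2 * q" if "s \<le> u" "u \<le> v" "v \<le> e" for u v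
    using bm_increment_tail[of u v "e - s" "x / 2"] that s x by (simp add: q_def power_divide)
  show ?thesis
  proof (cases "2 * q \<le> 1 / 2")
    case False
    then have "1 \<le> 4 * q" by simp
    then show ?thesis using prob_le_1 order_trans unfolding q_def by blast
  next
    case True
    define xs where "xs = sorted_list_of_set (insert s (insert e T))"
    have fin: "finite (insert s (insert e T))" using T by simp
    have xs: "set xs = insert s (insert e T)" "sorted_wrt (<) xs"
      unfolding xs_def by (rule set_sorted_list_of_set[OF fin], rule strict_sorted_list_of_set)
    have sub: "set xs \<subseteq> {s..e}" using xs(1) T s by auto
    define m where "m = length xs - 1"
    have len: "length xs = Suc m" using xs(1) by (cases xs) (auto simp: m_def)
    define t where "t i = xs ! i" for i
    have tin: "t i \<in> {s..e}" if "i \<le> m" for i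
    proof -
      have "xs ! i \<in> set xs" by (rule nth_mem) (use that len in simp)
      then show ?thesis unfolding t_def using sub by blast
    qed
    have tmono: "t i < t j" if "i < j" "j \<le> m" for i j
      using sorted_wrt_nth_less[OF xs(2) that(1)] that(2) len by (simp add: t_def)
    have ex_t: "\<exists>i\<le>m. t i = u" if u: "u \<in> insert s (insert e T)" for u
    proof -
      have "u \<in> set xs" using xs(1) u by simp
      then obtain i where "i < length xs" "xs ! i = u" unfolding in_set_conv_nth by blast
      then show ?thesis using len by (intro exI[of _ i]) (simp add: t_def)
    qed
    have t0: "t 0 = s"
    proof -
      obtain i where i: "i \<le> m" "t i = s" using ex_t[of s] by auto
      show ?thesis using tmono[of 0 i] tin[of 0] i by (cases "i = 0") auto
    qed
    define D where "D i \<omega> = B (t (Suc i)) \<omega> - B (t i) \<omega>" for i \<omega>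
    have ind: "indep_vars (\<lambda>_. borel) D {..<m}"
      using B tmono s t0 unfolding standard_brownian_motion_def D_def[abs_def] by simp
    have tele: "(\<Sum>i=j..<k. D i \<omega>) = B (t k) \<omega> - B (t j) \<omega>" if "j \<le> k" for j k \<omega>
      unfolding D_def by (rule sum_Suc_diff'[OF that])
    have tele0: "(\<Sum>i<k. D i \<omega>) = B (t k) \<omega> - B s \<omega>" for k \<omega>
      using tele[of 0 k \<omega>] t0 by (simp add: atLeast0LessThan)
    have tle: "t k \<le> t m" if "k \<le> m" for k using tmono[of k m] that by (cases "k = m") auto
    have half: "prob {\<omega>\<in>space N. x / 2 \<le> \<bar>\<Sum>i=k..<m. D i \<omega>\<bar>} \<le> 1 / 2" if "k \<le> m" for k
      unfolding tele[OF that] using tail[of "t k" "t m"] tin[of k] tin[of m] tle[OF that] that True by simp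
    have "prob {\<omega>\<in>space N. \<exists>k\<le>m. 2 * (x / 2) \<le> \<bar>\<Sum>i<k. D i \<omega>\<bar>} \<le> 2 * prob {\<omega>\<in>space N. x / 2 \<le> \<bar>\<Sum>i<m. D i \<omega>\<bar>}"
      by (rule ottaviani[OF ind half])
    also have "\<dots> \<le> 2 * (2 * q)"
      unfolding tele0 using tail[of s "t m"] tin[of m] by simp
    finally have main: "prob {\<omega>\<in>space N. \<exists>k\<le>m. x \<le> \<bar>B (t k) \<omega> - B s \<omega>\<bar>} \<le> 4 * q"
      unfolding tele0 by simp
    have "prob {\<omega>\<in>space N. \<exists>t\<in>T. x \<le> \<bar>B t \<omega> - B s \<omega>\<bar>} \<le> prob {\<omega>\<in>space N. \<exists>k\<le>m. x \<le> \<bar>B (t k) \<omega> - B s \<omega>\<bar>}"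
    proof (rule finite_measure_mono)
      show "{\<omega>\<in>space N. \<exists>t\<in>T. x \<le> \<bar>B t \<omega> - B s \<omega>\<bar>} \<subseteq> {\<omega>\<in>space N. \<exists>k\<le>m. x \<le> \<bar>B (t k) \<omega> - B s \<omega>\<bar>}"
      proof
        fix \<omega> assume "\<omega> \<in> {\<omega>\<in>space N. \<exists>t\<in>T. x \<le> \<bar>B t \<omega> - B s \<omega>\<bar>}"
        then obtain u where u: "\<omega> \<in> space N" "u \<in> T" "x \<le> \<bar>B u \<omega> - B s \<omega>\<bar>" by blast
        obtain i where "i \<le> m" "t i = u" using ex_t[of u] u(2) by blast
        then show "\<omega> \<in> {\<omega>\<in>space N. \<exists>k\<le>m. x \<le> \<bar>B (t k) \<omega> - B s \<omega>\<bar>}" using u by blast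
      qed
      have "{\<omega>\<in>space N. x \<le> \<bar>B (t k) \<omega> - B s \<omega>\<bar>} \<in> events" if "k \<le> m" for k
      proof -
        have [measurable]: "B (t k) \<in> borel_measurable N" "B s \<in> borel_measurable N"
          using bm_measurable tin[OF that] s by auto
        show ?thesis by measurable
      qed
      then have "(\<Union>k\<le>m. {\<omega>\<in>space N. x \<le> \<bar>B (t k) \<omega> - B s \<omega>\<bar>}) \<in> events" by (intro sets.finite_UN) auto
      also have "(\<Union>k\<le>m. {\<omega>\<in>space N. x \<le> \<bar>B (t k) \<omega> - B s \<omega>\<bar>}) = {\<omega>\<in>space N. \<exists>k\<le>m. x \<le> \<bar>B (t k) \<omega> - B s \<omega>\<bar>}" by blast
      finally show "{\<omega>\<in>space N. \<exists>k\<le>m. x \<le> \<bar>B (t k) \<omega> - B s \<omega>\<bar>} \<in> events" .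
    qed
    with main show ?thesis unfolding q_def by linarith
  qed
qed

end

section \<open>The block structure\<close>

lemma powr_one_plus_le:
  fixes u \<kappa> :: real
  assumes "0 \<le> u" "u \<le> 1" "\<kappa> \<ge> 0"
  shows "(1 + u) powr \<kappa> \<le> 1 + \<kappa> * exp \<kappa> * u"
proof -
  define x where "x = \<kappa> * u"
  have x: "0 \<le> x" "x \<le> \<kappa>" using assms mult_left_mono[of u 1 \<kappa>] by (simp_all add: x_def)
  have "(1 + u) powr \<kappa> = exp (\<kappa> * ln (1 + u))" using assms by (simp add: powr_def)
  also have "\<dots> \<le> exp x" unfolding x_def using assms ln_add_one_self_le_self[of u] by (simp add: mult_left_mono)
  also have "exp x \<le> 1 + x * exp x"
  proof -
    have "1 - x \<le> exp (- x)" using exp_ge_add_one_self[of "- x"] by simp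
    then have "(1 - x) * exp x \<le> exp (- x) * exp x" by (rule mult_right_mono) simp
    then show ?thesis by (simp add: algebra_simps exp_minus)
  qed
  also have "\<dots> \<le> 1 + x * exp \<kappa>" using x by (simp add: mult_left_mono)
  finally show ?thesis by (simp add: x_def algebra_simps)
qed

lemma square_sum_mono: "m \<le> n \<Longrightarrow> square_sum a m \<le> square_sum a n"
  unfolding square_sum_def by (rule sum_mono2) auto

lemma square_sum_Suc: "square_sum a (Suc n) = square_sum a n + (a (Suc n))\<^sup>2"
  by (simp add: square_sum_def)

text \<open>All bounds refer to the left end of a block, so that a block has a single scale. The
  bound by \<open>real j\<close> makes series over the blocks comparable with series in powers of
  \<open>j\<close>, the bound on the length controls variance and oscillation, and the bound on the
  coefficients controls third moments.\<close>

theorem block_structure: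
  fixes a :: "nat \<Rightarrow> real" and \<beta> \<delta> :: real
  assumes A: "filterlim (square_sum a) at_top sequentially"
    and \<delta>: "0 < \<delta>" "\<delta> \<le> 1" and \<beta>: "0 < \<beta>" "\<beta> \<le> \<delta>"
    and O: "(\<lambda>n. (a n)\<^sup>2) \<in> O(\<lambda>n. square_sum a n powr (1 - \<delta>))"
  shows "\<exists>nb C. strict_mono nb \<and> 1 \<le> nb 0 \<and> 0 < C \<and> (\<forall>j. 1 \<le> square_sum a (nb j)) \<and>
    (\<forall>j. real j \<le> square_sum a (nb j) powr \<beta>) \<and>
    (\<forall>j. square_sum a (nb j) < square_sum a (nb (Suc j))) \<and>
    (\<forall>j. square_sum a (nb (Suc j)) - square_sum a (nb j) \<le> C * square_sum a (nb j) powr (1 - \<beta>)) \<and>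
    (\<forall>j k. nb j < k \<and> k \<le> nb (Suc j) \<longrightarrow> \<bar>a k\<bar> \<le> C * square_sum a (nb j) powr ((1 - \<delta>) / 2))"
proof -
  define A where "A = square_sum a"
  have A_lim: "filterlim A at_top sequentially" using A by (simp add: A_def)
  have A_mono: "m \<le> n \<Longrightarrow> A m \<le> A n" for m n by (simp add: A_def square_sum_mono)
  obtain c0 where c0: "c0 > 0" "\<forall>\<^sub>F n in sequentially. (a n)\<^sup>2 \<le> c0 * A n powr (1 - \<delta>)"
    using landau_o.bigE[OF O] unfolding A_def by (auto simp: norm_power)
  have pd: "filterlim (\<lambda>n. A n powr e) at_top sequentially" if "e > 0" for e
    by (rule filterlim_compose[OF _ A_lim]) (use that in real_asymp)
  have "\<forall>\<^sub>F n in sequentially. 2 * c0 \<le> A n powr \<delta>" "\<forall>\<^sub>F n in sequentially. 1 \<le> A n"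
    using pd[OF \<delta>(1)] A_lim by (auto simp: filterlim_at_top)
  with c0(2) have "\<forall>\<^sub>F n in sequentially. (a n)\<^sup>2 \<le> c0 * A n powr (1 - \<delta>) \<and> 2 * c0 \<le> A n powr \<delta> \<and> 1 \<le> A n"
    by eventually_elim auto
  then obtain n1 where n1: "\<And>n. n \<ge> n1 \<Longrightarrow> (a n)\<^sup>2 \<le> c0 * A n powr (1 - \<delta>)"
    "\<And>n. n \<ge> n1 \<Longrightarrow> 2 * c0 \<le> A n powr \<delta>" "\<And>n. n \<ge> n1 \<Longrightarrow> 1 \<le> A n"
    unfolding eventually_sequentially by blast
  \<comment> \<open>The successor guarantees \<open>1 \<le> nb 0\<close>.\<close>
  define n0 where "n0 = Suc n1"
  define next_b where "next_b m = (LEAST n. n > m \<and> A m powr \<beta> + 1 \<le> A n powr \<beta>)" for m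
  have ex: "\<exists>n. n > m \<and> A m powr \<beta> + 1 \<le> A n powr \<beta>" for m
  proof -
    have "\<forall>\<^sub>F n in sequentially. A m powr \<beta> + 1 \<le> A n powr \<beta>" using pd[OF \<beta>(1)] by (simp add: filterlim_at_top)
    then have "\<forall>\<^sub>F n in sequentially. n > m \<and> A m powr \<beta> + 1 \<le> A n powr \<beta>"
      using eventually_gt_at_top[of m] by eventually_elim simp
    then show ?thesis by (auto dest: eventually_happens)
  qed
  have nx: "next_b m > m" "A m powr \<beta> + 1 \<le> A (next_b m) powr \<beta>" for m
    using LeastI_ex[OF ex[of m]] unfolding next_b_def by auto
  have nx_least: "A n powr \<beta> < A m powr \<beta> + 1" if "m < n" "n < next_b m" for m n
    using not_less_Least[of n "\<lambda>n. n > m \<and> A m powr \<beta> + 1 \<le> A n powr \<beta>"] that unfolding next_b_def by auto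
  define nb where "nb j = (next_b ^^ j) n0" for j
  have nb_Suc: "nb (Suc j) = next_b (nb j)" and nb_0: "nb 0 = n0" for j by (simp_all add: nb_def)
  have sm: "strict_mono nb" by (rule strict_monoI_Suc) (simp add: nb_Suc nx)
  have nb_ge: "nb j \<ge> n0" for j using strict_mono_less_eq[OF sm, of 0 j] nb_0 by simp
  have A1: "1 \<le> A (nb j)" for j using n1(3)[of "nb j"] nb_ge[of j] by (simp add: n0_def)
  have jle: "real j \<le> A (nb j) powr \<beta>" for j
  proof (induction j)
    case (Suc j)
    then show ?case using nx(2)[of "nb j"] by (simp add: nb_Suc)
  qed simp
  have inc: "A (nb j) < A (nb (Suc j))" for j
  proof (rule ccontr)
    assume "\<not> A (nb j) < A (nb (Suc j))"
    then have "A (nb (Suc j)) powr \<beta> \<le> A (nb j) powr \<beta>"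
      using A1[of "Suc j"] \<beta> by (intro powr_mono2) auto
    then show False using nx(2)[of "nb j"] by (simp add: nb_Suc)
  qed
  define \<kappa> where "\<kappa> = 1 / \<beta>"
  have \<kappa>: "\<kappa> > 0" "\<beta> * \<kappa> = 1" using \<beta> by (auto simp: \<kappa>_def)
  define c1 where "c1 = \<kappa> * exp \<kappa>"
  have c1: "c1 > 0" using \<kappa> by (simp add: c1_def)
  \<comment> \<open>Up to the last index but one of a step, \<open>A powr \<beta>\<close> grows by
    at most 1. Taking the power \<open>\<kappa> = 1 / \<beta>\<close> turns this into growth of
    \<open>A\<close> by at most the order of \<open>A powr (1 - \<beta>)\<close>. The final index,
    which may overshoot, is added in \<open>V\<close> below.\<close>
  have last: "A (nb (Suc j) - 1) \<le> A (nb j) + c1 * A (nb j) powr (1 - \<beta>)" for j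
  proof -
    define t where "t = A (nb j)"
    have t: "t \<ge> 1" using A1 by (simp add: t_def)
    define u where "u = t powr (- \<beta>)"
    have u: "0 \<le> u" "u \<le> 1" using t \<beta> powr_mono[of "- \<beta>" 0 t] by (auto simp: u_def)
    define n where "n = nb (Suc j) - 1"
    have n: "nb j \<le> n" "n < next_b (nb j)" using nx(1)[of "nb j"] by (auto simp: n_def nb_Suc)
    have An: "A n \<ge> 1" using A_mono[OF n(1)] t by (simp add: t_def)
    have "A n powr \<beta> \<le> t powr \<beta> + 1"
      using nx_least[of "nb j" n] n by (cases "nb j = n") (auto simp: t_def)
    then have "(A n powr \<beta>) powr \<kappa> \<le> (t powr \<beta> + 1) powr \<kappa>"
      using \<kappa> by (intro powr_mono2) auto
    then have "A n \<le> (t powr \<beta> + 1) powr \<kappa>"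
      using An \<kappa> by (simp add: powr_powr)
    also have "t powr \<beta> + 1 = t powr \<beta> * (1 + u)"
      using t by (simp add: u_def algebra_simps powr_add[symmetric])
    also have "\<dots> powr \<kappa> = t * (1 + u) powr \<kappa>"
      using t u \<kappa> by (simp add: powr_mult powr_powr)
    also have "\<dots> \<le> t * (1 + c1 * u)"
      unfolding c1_def using powr_one_plus_le[OF u, of \<kappa>] \<kappa> t by (intro mult_left_mono) auto
    also have "\<dots> = t + c1 * t powr (1 - \<beta>)"
      using t by (simp add: u_def algebra_simps powr_diff powr_minus divide_inverse)
    finally show ?thesis by (simp add: n_def t_def)
  qed
  \<comment> \<open>A single square is at most half of the sum because
    \<open>2 * c0 \<le> A n powr \<delta>\<close>. The overshoot at the end of a block therefore at
    most doubles \<open>A\<close>, and bounds in terms of \<open>A k\<close> can be referred to the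
    left end.\<close>
  have half: "(a n)\<^sup>2 \<le> A n / 2" if "n \<ge> n1" for n
  proof -
    have An: "A n \<ge> 1" using n1(3)[OF that] .
    have "(a n)\<^sup>2 \<le> c0 * A n powr (1 - \<delta>)" using n1(1)[OF that] .
    also have "\<dots> = A n / 2 * (2 * c0 / A n powr \<delta>)"
      using An by (simp add: powr_diff)
    also have "\<dots> \<le> A n / 2 * 1"
      using An n1(2)[OF that] by (intro mult_left_mono) auto
    finally show ?thesis by simp
  qed
  define c2 where "c2 = 2 * (1 + c1)"
  have c2: "c2 \<ge> 1" using c1 by (simp add: c2_def)
  have ratio: "A (nb (Suc j)) \<le> c2 * A (nb j)" for j
  proof -
    define n where "n = nb (Suc j)"
    have n: "n \<ge> n1" "n \<ge> 1" using nb_ge[of "Suc j"] by (auto simp: n_def n0_def)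
    have "A n = A (n - 1) + (a n)\<^sup>2"
      using square_sum_Suc[of a "n - 1"] n(2) by (simp add: A_def)
    then have "A n \<le> 2 * A (n - 1)" using half[OF n(1)] by simp
    also have "\<dots> \<le> 2 * (A (nb j) + c1 * A (nb j) powr (1 - \<beta>))" using last[of j] by (simp add: n_def)
    also have "\<dots> \<le> 2 * (A (nb j) + c1 * A (nb j))"
      using c1 A1[of j] \<beta> powr_mono[of "1 - \<beta>" 1 "A (nb j)"] by (simp add: mult_left_mono)
    finally show ?thesis by (simp add: n_def c2_def algebra_simps)
  qed
  define c3 where "c3 = c0 * c2"
  have c3: "c3 > 0" using c0 c2 by (simp add: c3_def)
  have asq: "(a k)\<^sup>2 \<le> c3 * A (nb j) powr (1 - \<delta>)" if "nb j < k" "k \<le> nb (Suc j)" for j k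
  proof -
    have k: "k \<ge> n1" using nb_ge[of j] that by (simp add: n0_def)
    have "A k \<le> c2 * A (nb j)" using A_mono[OF that(2)] ratio[of j] by linarith
    then have "A k powr (1 - \<delta>) \<le> (c2 * A (nb j)) powr (1 - \<delta>)"
      using n1(3)[OF k] \<delta> by (intro powr_mono2) auto
    also have "\<dots> = c2 powr (1 - \<delta>) * A (nb j) powr (1 - \<delta>)"
      using c2 A1[of j] by (simp add: powr_mult)
    also have "\<dots> \<le> c2 powr 1 * A (nb j) powr (1 - \<delta>)"
      using c2 \<delta> by (intro mult_right_mono powr_mono) auto
    finally have "c0 * A k powr (1 - \<delta>) \<le> c0 * (c2 * A (nb j) powr (1 - \<delta>))"
      using c0 c2 by (intro mult_left_mono) auto
    then show ?thesis using n1(1)[OF k] by (simp add: c3_def mult.assoc)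
  qed
  have V: "A (nb (Suc j)) - A (nb j) \<le> (c1 + c3) * A (nb j) powr (1 - \<beta>)" for j
  proof -
    have n: "nb (Suc j) \<ge> 1" using nb_ge[of "Suc j"] by (simp add: n0_def)
    have "A (nb (Suc j)) = A (nb (Suc j) - 1) + (a (nb (Suc j)))\<^sup>2"
      using square_sum_Suc[of a "nb (Suc j) - 1"] n by (simp add: A_def)
    also have "\<dots> \<le> (A (nb j) + c1 * A (nb j) powr (1 - \<beta>)) + c3 * A (nb j) powr (1 - \<delta>)"
      using last[of j] asq[of j "nb (Suc j)"] strict_monoD[OF sm, of j "Suc j"] by (intro add_mono) auto
    also have "c3 * A (nb j) powr (1 - \<delta>) \<le> c3 * A (nb j) powr (1 - \<beta>)"
      using c3 \<beta> A1[of j] by (intro mult_left_mono powr_mono) auto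
    finally show ?thesis by (simp add: algebra_simps)
  qed
  have abound: "\<bar>a k\<bar> \<le> sqrt c3 * A (nb j) powr ((1 - \<delta>) / 2)" if "nb j < k" "k \<le> nb (Suc j)" for j k
  proof -
    have "\<bar>a k\<bar> = sqrt ((a k)\<^sup>2)" by simp
    also have "\<dots> \<le> sqrt (c3 * A (nb j) powr (1 - \<delta>))" by (rule real_sqrt_le_mono[OF asq[OF that]])
    also have "\<dots> = sqrt c3 * A (nb j) powr ((1 - \<delta>) / 2)"
      using A1[of j] by (simp add: real_sqrt_mult powr_half_sqrt[symmetric] powr_powr)
    finally show ?thesis .
  qed
  define C where "C = c1 + c3 + sqrt c3"
  have C: "C > 0" "c1 + c3 \<le> C" "sqrt c3 \<le> C" using c1 c3 by (auto simp: C_def add_pos_pos)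
  show ?thesis
  proof (rule exI[of _ nb], rule exI[of _ C], unfold A_def[symmetric], intro conjI allI impI)
    show "A (nb (Suc j)) - A (nb j) \<le> C * A (nb j) powr (1 - \<beta>)" for j
      using V[of j] mult_right_mono[OF C(2), of "A (nb j) powr (1 - \<beta>)"] by simp
    show "\<bar>a k\<bar> \<le> C * A (nb j) powr ((1 - \<delta>) / 2)" if "nb j < k \<and> k \<le> nb (Suc j)" for j k
      using abound[of j k] that mult_right_mono[OF C(3), of "A (nb j) powr ((1 - \<delta>) / 2)"] by simp
  qed (use sm nb_0 C A1 jle inc in \<open>auto simp: n0_def\<close>)
qed

section \<open>Laws of sign processes\<close>

lemma path_weight_append: "path_weight p b (l1 @ l2) = path_weight p b l1 * path_weight p (last (b # l1)) l2"
  by (induction l1 arbitrary: b) auto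

text \<open>
  The law of the first signs of the chain, whose initial sign is uniform.
\<close>

fun chain_weight :: "real \<Rightarrow> bool list \<Rightarrow> real" where
  "chain_weight p [] = 1"
| "chain_weight p (b # l) = path_weight p b l / 2"

lemma chain_weight_append: "l1 \<noteq> [] \<Longrightarrow> chain_weight p (l1 @ l2) = chain_weight p l1 * path_weight p (last l1) l2"
  by (cases l1) (auto simp: path_weight_append)

lemma path_weight_pos: "0 < p \<Longrightarrow> p < 1 \<Longrightarrow> 0 < path_weight p b l"
  by (induction l arbitrary: b) auto

lemma chain_weight_pos: "0 < p \<Longrightarrow> p < 1 \<Longrightarrow> 0 < chain_weight p l"
  by (cases l) (auto simp: path_weight_pos)

lemma sum_chain_weight:
  "(\<Sum>l\<in>paths n. chain_weight p l) = 1"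
proof (cases n)
  case (Suc m)
  have "(\<Sum>l\<in>paths m. path_weight p b l) = 1" for b
    using path_exp_const[of p b m 1] unfolding path_exp_def by simp
  then show ?thesis
    unfolding Suc sum_paths_Suc[of _ _ True] by (simp flip: sum_divide_distrib)
qed simp

text \<open>The list starts at index 0 and the chain at index 1, hence the shift by
  \<open>Suc\<close>.\<close>

definition sign_code :: "(nat \<Rightarrow> 'a \<Rightarrow> real) \<Rightarrow> nat \<Rightarrow> 'a \<Rightarrow> bool list" where
  "sign_code X n \<omega> = map (\<lambda>i. 0 < X (Suc i) \<omega>) [0..<n]"

lemma length_sign_code [simp]: "length (sign_code X n \<omega>) = n"
  by (simp add: sign_code_def)

lemma sign_code_Suc: "sign_code X (Suc n) \<omega> = sign_code X n \<omega> @ [0 < X (Suc n) \<omega>]"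
  by (simp add: sign_code_def)

text \<open>What the given chain and the constructed signs have in common before their laws are
  compared.\<close>

definition sign_process :: "'a measure \<Rightarrow> (nat \<Rightarrow> 'a \<Rightarrow> real) \<Rightarrow> bool" where
  "sign_process M X \<longleftrightarrow> prob_space M \<and> (\<forall>k\<ge>1. X k \<in> borel_measurable M) \<and> (\<forall>k\<ge>1. \<forall>\<omega>\<in>space M. X k \<omega> \<in> {1, -1})"

lemma sign_process_code:
  assumes "sign_process M X" "\<omega> \<in> space M" "1 \<le> k" "k \<le> n"
  shows "X k \<omega> = sgn_of (sign_code X n \<omega> ! (k - 1))"
proof -
  have "X k \<omega> \<in> {1, -1}" using assms by (auto simp: sign_process_def)
  moreover obtain i where "k = Suc i" using assms(3) by (cases k) auto
  then have "sign_code X n \<omega> ! (k - 1) = (0 < X k \<omega>)" using assms by (simp add: sign_code_def)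
  ultimately show ?thesis by (auto simp: sgn_of_def)
qed

lemma sign_code_event:
  assumes "sign_process M X"
  shows "{\<omega>\<in>space M. sign_code X n \<omega> = l} \<in> sets M"
proof (cases "length l = n")
  case True
  have "{\<omega>\<in>space M. sign_code X n \<omega> = l} = {\<omega>\<in>space M. \<forall>i\<in>{..<n}. (0 < X (Suc i) \<omega>) = l ! i}"
    using True by (auto simp: sign_code_def list_eq_iff_nth_eq)
  also have "\<dots> \<in> sets M"
  proof (rule sets.sets_Collect_finite_All)
    fix i
    have [measurable]: "X (Suc i) \<in> borel_measurable M" using assms by (simp add: sign_process_def)
    show "{\<omega>\<in>space M. (0 < X (Suc i) \<omega>) = l ! i} \<in> sets M" by measurable
  qed simp
  finally show ?thesis .
next
  case False
  then have "{\<omega>\<in>space M. sign_code X n \<omega> = l} = {}" by auto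
  then show ?thesis by (simp only: sets.empty_sets)
qed

lemma sign_code_event_prob:
  assumes X: "sign_process M X"
  shows "{\<omega>\<in>space M. P (sign_code X n \<omega>)} \<in> sets M"
    "measure M {\<omega>\<in>space M. P (sign_code X n \<omega>)} =
      (\<Sum>l\<in>paths n. if P l then measure M {\<omega>\<in>space M. sign_code X n \<omega> = l} else 0)"
proof -
  interpret prob_space M using X by (simp add: sign_process_def)
  define E where "E l = {\<omega>\<in>space M. sign_code X n \<omega> = l}" for l
  have E: "E l \<in> sets M" for l unfolding E_def by (rule sign_code_event[OF X])
  have fin: "finite {l\<in>paths n. P l}" by simp
  have eq: "{\<omega>\<in>space M. P (sign_code X n \<omega>)} = (\<Union>l\<in>{l\<in>paths n. P l}. E l)"
    by (auto simp: E_def paths_def)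
  show "{\<omega>\<in>space M. P (sign_code X n \<omega>)} \<in> sets M"
    unfolding eq using E fin by (intro sets.finite_UN) auto
  have "disjoint_family_on E {l\<in>paths n. P l}" by (auto simp: disjoint_family_on_def E_def)
  then have "prob (\<Union>l\<in>{l\<in>paths n. P l}. E l) = (\<Sum>l\<in>{l\<in>paths n. P l}. prob (E l))"
    using E fin by (intro finite_measure_finite_Union) auto
  also have "\<dots> = (\<Sum>l\<in>paths n. if P l then prob (E l) else 0)"
    by (rule sum.inter_filter) simp
  finally show "prob {\<omega>\<in>space M. P (sign_code X n \<omega>)} = (\<Sum>l\<in>paths n. if P l then prob {\<omega>\<in>space M. sign_code X n \<omega> = l} else 0)"
    unfolding eq E_def .
qed

lemma sign_markov_chain_process: "sign_markov_chain M p X \<Longrightarrow> sign_process M X"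
  by (simp add: sign_markov_chain_def sign_process_def)

text \<open>As \<open>p\<close> and \<open>1 - p\<close> are positive, every finite path has
  positive probability. The guard in the Markov property is thus satisfied at each step of the
  induction.\<close>

lemma sign_markov_chain_law:
  assumes p: "0 < p" "p < 1" and X: "sign_markov_chain M p X" and l: "length l = n"
  shows "measure M {\<omega>\<in>space M. sign_code X n \<omega> = l} = chain_weight p l"
  using l
proof (induction n arbitrary: l)
  case 0
  interpret prob_space M using X by (simp add: sign_markov_chain_def)
  show ?case using 0 prob_space by (simp add: sign_code_def)
next
  case (Suc n)
  interpret prob_space M using X by (simp add: sign_markov_chain_def)
  have sp: "sign_process M X" by (rule sign_markov_chain_process[OF X])
  have iff: "(0 < X k \<omega>) = b \<longleftrightarrow> X k \<omega> = sgn_of b" if "k \<ge> 1" "\<omega> \<in> space M" for k \<omega> b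
  proof -
    have "X k \<omega> = 1 \<or> X k \<omega> = -1" using sp that by (simp add: sign_process_def)
    then show ?thesis by (cases b) (auto simp: sgn_of_def)
  qed
  define l' where "l' = butlast l"
  define c where "c = last l"
  have "l \<noteq> []" using Suc.prems by auto
  then have lc: "l = l' @ [c]" "length l' = n" using Suc.prems by (simp_all add: l'_def c_def)
  show ?case
  proof (cases "n = 0")
    case True
    have "{\<omega>\<in>space M. sign_code X (Suc n) \<omega> = l} = {\<omega>\<in>space M. X 1 \<omega> = sgn_of c}"
      using iff[of 1] True lc by (auto simp: sign_code_def)
    then show ?thesis using X lc True by (auto simp: sign_markov_chain_def sgn_of_def)
  next
    case False
    then have n1: "n \<ge> 1" by simp
    define b where "b = last l'"
    have ne: "l' \<noteq> []" using lc(2) False by auto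
    have nth: "l' ! (n - 1) = b" using ne lc(2) by (simp add: b_def last_conv_nth)
    define x where "x j = sgn_of (l' ! (j - 1))" for j
    have cyl: "(\<forall>j\<in>{1..n}. X j \<omega> = x j) \<longleftrightarrow> sign_code X n \<omega> = l'" if w: "\<omega> \<in> space M" for \<omega>
    proof
      assume H: "\<forall>j\<in>{1..n}. X j \<omega> = x j"
      show "sign_code X n \<omega> = l'"
      proof (rule nth_equalityI)
        fix i assume "i < length (sign_code X n \<omega>)"
        then have i: "i < n" by simp
        then have "X (Suc i) \<omega> = sgn_of (l' ! i)" using H by (simp add: x_def)
        then show "sign_code X n \<omega> ! i = l' ! i" using iff[of "Suc i" \<omega>] w i by (simp add: sign_code_def)
      qed (simp add: lc)
    next
      assume "sign_code X n \<omega> = l'"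
      then show "\<forall>j\<in>{1..n}. X j \<omega> = x j" using sign_process_code[OF sp w, of _ n] by (auto simp: x_def)
    qed
    have xn: "x n = sgn_of b" unfolding x_def nth ..
    define C where "C = {\<omega>\<in>space M. sign_code X n \<omega> = l'}"
    have PC: "prob C = chain_weight p l'" unfolding C_def by (rule Suc.IH[OF lc(2)])
    have PC0: "prob C > 0" unfolding PC by (rule chain_weight_pos[OF p])
    have Ceq: "C = {\<omega>\<in>space M. \<forall>j\<in>{1..n}. X j \<omega> = x j}"
      unfolding C_def using cyl by blast
    have D: "{\<omega>\<in>space M. sign_code X (Suc n) \<omega> = l} = {\<omega>\<in>space M. X (Suc n) \<omega> = sgn_of c \<and> (\<forall>j\<in>{1..n}. X j \<omega> = x j)}"
      using iff[of "Suc n"] cyl lc(1) by (auto simp: sign_code_Suc)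
    have "\<P>(\<omega> in M. X (Suc n) \<omega> = sgn_of c \<bar> \<forall>j\<in>{1..n}. X j \<omega> = x j) = \<P>(\<omega> in M. X (Suc n) \<omega> = sgn_of c \<bar> X n \<omega> = x n)"
      using X n1 PC0 Ceq unfolding sign_markov_chain_def by auto
    also have "\<dots> = (if c = b then p else 1 - p)"
      using X n1 unfolding xn sign_markov_chain_def sgn_of_def by (cases b; cases c) auto
    finally have "prob {\<omega>\<in>space M. X (Suc n) \<omega> = sgn_of c \<and> (\<forall>j\<in>{1..n}. X j \<omega> = x j)} / prob C = (if c = b then p else 1 - p)"
      unfolding cond_prob_def Ceq .
    then have "prob {\<omega>\<in>space M. X (Suc n) \<omega> = sgn_of c \<and> (\<forall>j\<in>{1..n}. X j \<omega> = x j)} = chain_weight p l' * (if c = b then p else 1 - p)"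
      using PC0 unfolding PC[symmetric] by (simp add: field_simps)
    then show ?thesis unfolding D using ne lc by (simp add: chain_weight_append b_def)
  qed
qed


text \<open>
  The variable \<open>X 0\<close> of a chain is unconstrained, not even measurable.
\<close>

definition zero_at_0 :: "(nat \<Rightarrow> 'a \<Rightarrow> real) \<Rightarrow> nat \<Rightarrow> 'a \<Rightarrow> real" where
  "zero_at_0 Y k \<omega> = (if k = 0 then 0 else Y k \<omega>)"

lemma zero_at_0_measurable:
  assumes "sign_process M X"
  shows "(\<lambda>\<omega> k. zero_at_0 X k \<omega>) \<in> M \<rightarrow>\<^sub>M (\<Pi>\<^sub>M n\<in>(UNIV::nat set). borel)"
proof (rule measurable_PiM_single')
  fix k show "(\<lambda>\<omega>. zero_at_0 X k \<omega>) \<in> borel_measurable M"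
    using assms by (cases "k = 0") (simp_all add: zero_at_0_def sign_process_def)
qed auto

lemma zero_at_0_vimage:
  assumes Y: "sign_process L Y" and S: "\<And>x. x \<in> S \<longleftrightarrow> (\<forall>k\<in>J. x k \<in> A k)" and n: "\<And>k. k \<in> J \<Longrightarrow> k \<le> n"
  shows "(\<lambda>\<omega> k. zero_at_0 Y k \<omega>) -` S \<inter> space L =
    {\<omega>\<in>space L. \<forall>k\<in>J. (if k = 0 then 0 else sgn_of (sign_code Y n \<omega> ! (k - 1))) \<in> A k}"
proof -
  have z: "zero_at_0 Y k \<omega> = (if k = 0 then 0 else sgn_of (sign_code Y n \<omega> ! (k - 1)))" if "\<omega> \<in> space L" "k \<in> J" for k \<omega>
    using sign_process_code[OF Y that(1), of k n] n[OF that(2)] by (simp add: zero_at_0_def)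
  have "(\<lambda>k. zero_at_0 Y k \<omega>) \<in> S \<longleftrightarrow> (\<forall>k\<in>J. (if k = 0 then 0 else sgn_of (sign_code Y n \<omega> ! (k - 1))) \<in> A k)"
    if "\<omega> \<in> space L" for \<omega>
    unfolding S by (rule ball_cong[OF refl]) (simp only: z[OF that])
  then show ?thesis by blast
qed

text \<open>Equality of the laws of arbitrarily long codes is enough, since an event about finitely
  many indices can be read off from any code that is long enough. The constructed signs are compared
  with the chain at block ends only.\<close>

lemma zero_at_0_same_law:
  assumes X: "sign_process M X" and X': "sign_process N X'"
    and law: "\<And>m. \<exists>n\<ge>m. \<forall>l. length l = n \<longrightarrow>
      measure M {\<omega>\<in>space M. sign_code X n \<omega> = l} = measure N {\<omega>\<in>space N. sign_code X' n \<omega> = l}"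
  shows "distr N (\<Pi>\<^sub>M n\<in>(UNIV::nat set). borel) (\<lambda>\<omega> k. zero_at_0 X' k \<omega>) =
    distr M (\<Pi>\<^sub>M n\<in>(UNIV::nat set). borel) (\<lambda>\<omega> k. zero_at_0 X k \<omega>)"
proof (rule measure_eqI_PiM_infinite[where I = UNIV and M = "\<lambda>_. borel"])
  interpret M: prob_space M using X by (simp add: sign_process_def)
  interpret N: prob_space N using X' by (simp add: sign_process_def)
  show "finite_measure (distr N (\<Pi>\<^sub>M n\<in>(UNIV::nat set). borel) (\<lambda>\<omega> k. zero_at_0 X' k \<omega>))"
    using N.prob_space_distr[OF zero_at_0_measurable[OF X']] by (simp add: prob_space_def)
  fix A :: "nat \<Rightarrow> real set" and J :: "nat set"
  assume J: "finite J" "J \<subseteq> UNIV" and A: "\<And>i. i \<in> J \<Longrightarrow> A i \<in> sets borel"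
  obtain m where m: "\<And>k. k \<in> J \<Longrightarrow> k \<le> m" using J(1) by (meson finite_nat_set_iff_bounded_le)
  obtain n where n: "n \<ge> m" and eq: "\<And>l. length l = n \<Longrightarrow>
      measure M {\<omega>\<in>space M. sign_code X n \<omega> = l} = measure N {\<omega>\<in>space N. sign_code X' n \<omega> = l}"
    using law[of m] by auto
  define P where "P l \<longleftrightarrow> (\<forall>k\<in>J. (if k = 0 then 0 else sgn_of (l ! (k - 1))) \<in> A k)" for l :: "bool list"
  define S where "S = prod_emb UNIV (\<lambda>_. borel :: real measure) J (Pi\<^sub>E J A)"
  have S: "S \<in> sets (\<Pi>\<^sub>M n\<in>(UNIV::nat set). borel)"
    unfolding S_def using J A by (intro sets_PiM_I) auto
  have mem: "x \<in> S \<longleftrightarrow> (\<forall>k\<in>J. x k \<in> A k)" for x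
    unfolding S_def by (auto simp: prod_emb_iff PiE_iff)
  have pre: "(\<lambda>\<omega> k. zero_at_0 X k \<omega>) -` S \<inter> space M = {\<omega>\<in>space M. P (sign_code X n \<omega>)}"
    unfolding P_def by (rule zero_at_0_vimage[OF X mem]) (use m n in \<open>blast intro: order_trans\<close>)
  have pre': "(\<lambda>\<omega> k. zero_at_0 X' k \<omega>) -` S \<inter> space N = {\<omega>\<in>space N. P (sign_code X' n \<omega>)}"
    unfolding P_def by (rule zero_at_0_vimage[OF X' mem]) (use m n in \<open>blast intro: order_trans\<close>)
  have "measure N {\<omega>\<in>space N. P (sign_code X' n \<omega>)} = measure M {\<omega>\<in>space M. P (sign_code X n \<omega>)}"
    unfolding sign_code_event_prob(2)[OF X'] sign_code_event_prob(2)[OF X]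
    by (rule sum.cong) (auto simp: eq paths_def)
  then show "emeasure (distr N (\<Pi>\<^sub>M n\<in>(UNIV::nat set). borel) (\<lambda>\<omega> k. zero_at_0 X' k \<omega>)) S
    = emeasure (distr M (\<Pi>\<^sub>M n\<in>(UNIV::nat set). borel) (\<lambda>\<omega> k. zero_at_0 X k \<omega>)) S"
    unfolding emeasure_distr[OF zero_at_0_measurable[OF X] S] emeasure_distr[OF zero_at_0_measurable[OF X'] S]
      pre pre' by (simp add: M.emeasure_eq_measure N.emeasure_eq_measure)
qed simp_all

lemma weighted_sum_zero_at_0:
  "(\<lambda>\<omega> n. weighted_sum a Y n \<omega>) = (\<lambda>x n. \<Sum>k=1..n. a k * x k) \<circ> (\<lambda>\<omega> k. zero_at_0 Y k \<omega>)"
  by (auto simp: fun_eq_iff weighted_sum_def zero_at_0_def intro!: sum.cong)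

lemma weighted_sum_same_law:
  assumes X: "sign_process M X" and X': "sign_process N X'"
    and law: "\<And>m. \<exists>n\<ge>m. \<forall>l. length l = n \<longrightarrow>
      measure M {\<omega>\<in>space M. sign_code X n \<omega> = l} = measure N {\<omega>\<in>space N. sign_code X' n \<omega> = l}"
  shows "same_process_law N (weighted_sum a X') M (weighted_sum a X)"
proof -
  let ?P = "\<Pi>\<^sub>M n\<in>(UNIV::nat set). (borel :: real measure)"
  define \<phi> where "\<phi> = (\<lambda>(x :: nat \<Rightarrow> real) n. \<Sum>k=1..n. a k * x k)"
  have \<phi>: "\<phi> \<in> ?P \<rightarrow>\<^sub>M ?P"
  proof (rule measurable_PiM_single')
    fix n show "(\<lambda>x. \<phi> x n) \<in> borel_measurable ?P" unfolding \<phi>_def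
      by (intro borel_measurable_sum borel_measurable_times borel_measurable_const measurable_component_singleton) simp
  qed auto
  have "weighted_sum a X' n \<in> borel_measurable N" for n
    unfolding weighted_sum_def[abs_def] using X' by (intro borel_measurable_sum borel_measurable_times) (auto simp: sign_process_def)
  moreover have "weighted_sum a X n \<in> borel_measurable M" for n
    unfolding weighted_sum_def[abs_def] using X by (intro borel_measurable_sum borel_measurable_times) (auto simp: sign_process_def)
  moreover have "distr N ?P (\<lambda>\<omega> n. weighted_sum a X' n \<omega>) = distr M ?P (\<lambda>\<omega> n. weighted_sum a X n \<omega>)"
    unfolding weighted_sum_zero_at_0 \<phi>_def[symmetric] distr_distr[OF \<phi> zero_at_0_measurable[OF X], symmetric] distr_distr[OF \<phi> zero_at_0_measurable[OF X'], symmetric]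
      zero_at_0_same_law[OF X X' law] ..
  ultimately show ?thesis unfolding same_process_law_def by simp
qed

section \<open>Construction of the chain from Brownian motion\<close>

text \<open>The locale prescribes the laws of the transforms \<open>Q0\<close> and
  \<open>Q j b\<close> of Gaussian increments and says nothing about their distance to the
  increments. Thus the law of the constructed signs is settled separately, and coupling bounds enter
  as hypotheses of the estimates.\<close>

locale block_coupling =
  fixes N :: "'b measure" and B :: "real \<Rightarrow> 'b \<Rightarrow> real" and p :: real and a :: "nat \<Rightarrow> real"
    and nb :: "nat \<Rightarrow> nat" and Q0 :: "real \<Rightarrow> bool list" and Q :: "nat \<Rightarrow> bool \<Rightarrow> real \<Rightarrow> bool list"
  assumes B: "standard_brownian_motion N B"
    and p: "0 < p" "p < 1"
    and nb: "strict_mono nb" "1 \<le> nb 0"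
    and A0: "0 < square_sum a (nb 0)"
    and A_inc: "\<And>j. square_sum a (nb j) < square_sum a (nb (Suc j))"
    and Q0: "\<And>x. length (Q0 x) = nb 0" "\<And>l. length l = nb 0 \<Longrightarrow> {x. Q0 x = l} \<in> sets borel"
      "\<And>l. length l = nb 0 \<Longrightarrow>
         measure (normal_measure (sqrt (p / (1 - p) * square_sum a (nb 0)))) {x. Q0 x = l} = chain_weight p l"
    and Q: "\<And>j b x. length (Q j b x) = nb (Suc j) - nb j"
      "\<And>j b l. length l = nb (Suc j) - nb j \<Longrightarrow> {x. Q j b x = l} \<in> sets borel"
      "\<And>j b l. length l = nb (Suc j) - nb j \<Longrightarrow>
         measure (normal_measure (sqrt (p / (1 - p) * (square_sum a (nb (Suc j)) - square_sum a (nb j))))) {x. Q j b x = l} =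
         path_weight p b l"
begin

sublocale prob_space N using B by (simp add: standard_brownian_motion_def)

definition r :: real where "r = p / (1 - p)"

lemma r_pos: "r > 0" using p by (simp add: r_def)

definition t :: "nat \<Rightarrow> real" where "t j = square_sum a (nb j)"

text \<open>
  The increment \<open>H 0\<close> over \<open>[0, t 0]\<close> only generates the initial signs up to \<open>nb 0\<close>; \<open>H (Suc j)\<close> belongs to the
  block of indices from \<open>nb j + 1\<close> to \<open>nb (Suc j)\<close>.
\<close>

definition tau :: "nat \<Rightarrow> real" where "tau i = (case i of 0 \<Rightarrow> 0 | Suc j \<Rightarrow> t j)"

definition H :: "nat \<Rightarrow> 'b \<Rightarrow> real" where
  "H i \<omega> = sqrt r * (B (tau (Suc i)) \<omega> - B (tau i) \<omega>)"

primrec pre :: "nat \<Rightarrow> 'b \<Rightarrow> bool list" where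
  "pre 0 \<omega> = Q0 (H 0 \<omega>)"
| "pre (Suc j) \<omega> = pre j \<omega> @ Q j (last (pre j \<omega>)) (H (Suc j) \<omega>)"

text \<open>The list \<open>pre k\<close> already contains the sign with index \<open>k\<close>
  because \<open>k < nb k\<close>; by \<open>X_eq\<close> every list that is long enough gives the
  same value.\<close>

definition X :: "nat \<Rightarrow> 'b \<Rightarrow> real" where
  "X k \<omega> = sgn_of (pre k \<omega> ! (k - 1))"

lemma tau_0 [simp]: "tau 0 = 0" and tau_Suc [simp]: "tau (Suc j) = t j"
  by (simp_all add: tau_def)

lemma tau_less: "tau i < tau (Suc i)"
  using A0 A_inc by (cases i) (simp_all add: t_def)

lemma t_mono: "i \<le> j \<Longrightarrow> t i \<le> t j"
  by (rule lift_Suc_mono_le[of t]) (use A_inc in \<open>auto simp: t_def intro: less_imp_le\<close>)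

lemma t_pos: "0 < t j"
  using t_mono[of 0 j] A0 by (simp add: t_def)

lemma tau_nonneg: "0 \<le> tau i"
  using t_pos by (cases i) (auto intro: less_imp_le)

lemma B_measurable: "s \<ge> 0 \<Longrightarrow> B s \<in> borel_measurable N"
  by (rule bm_measurable[OF B])

lemma H_measurable [measurable]: "H i \<in> borel_measurable N"
proof -
  have [measurable]: "B (tau (Suc i)) \<in> borel_measurable N" "B (tau i) \<in> borel_measurable N"
    by (rule B_measurable, rule tau_nonneg)+
  show ?thesis unfolding H_def[abs_def] by measurable
qed

lemma H_law: "distr N borel (H i) = normal_measure (sqrt (r * (tau (Suc i) - tau i)))"
proof -
  define D where "D \<omega> = B (tau (Suc i)) \<omega> - B (tau i) \<omega>" for \<omega>
  define s where "s = tau (Suc i) - tau i"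
  have s: "s > 0" using tau_less[of i] by (simp add: s_def)
  have [measurable]: "B (tau (Suc i)) \<in> borel_measurable N" "B (tau i) \<in> borel_measurable N"
    by (rule B_measurable, rule tau_nonneg)+
  have [measurable]: "D \<in> borel_measurable N" unfolding D_def[abs_def] by measurable
  have "distr N borel (H i) = distr (distr N borel D) borel (\<lambda>y. sqrt r * y)"
    by (subst distr_distr) (simp_all add: comp_def D_def H_def[abs_def])
  also have "distr N borel D = normal_measure (sqrt s)"
    unfolding D_def[abs_def] s_def by (rule bm_increment_law[OF B tau_nonneg tau_less])
  also have "\<dots> = distr std_gauss borel (\<lambda>y. sqrt s * y)" by (rule normal_measure_distr) (use s in simp)
  also have "distr (distr std_gauss borel (\<lambda>y. sqrt s * y)) borel (\<lambda>y. sqrt r * y) = distr std_gauss borel (\<lambda>y. sqrt (r * s) * y)"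
    by (subst distr_distr) (auto simp: comp_def real_sqrt_mult mult.assoc intro!: distr_cong)
  also have "\<dots> = normal_measure (sqrt (r * s))" by (rule normal_measure_distr[symmetric]) (use s r_pos in simp)
  finally show ?thesis by (simp add: s_def)
qed

lemma H_indep: "indep_vars (\<lambda>_. borel) H {..<n}"
proof -
  have "indep_vars (\<lambda>_. borel) (\<lambda>i \<omega>. B (tau (Suc i)) \<omega> - B (tau i) \<omega>) {..<n}"
    using B tau_less tau_nonneg[of 0] unfolding standard_brownian_motion_def by blast
  then have "indep_vars (\<lambda>_. borel) (\<lambda>i x. (\<lambda>y. sqrt r * y) (B (tau (Suc i)) x - B (tau i) x)) {..<n}"
    by (rule indep_vars_compose2) simp
  then show ?thesis by (simp add: H_def[abs_def])
qed

lemma H_prob: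
  assumes "S \<in> sets borel"
  shows "prob {\<omega>\<in>space N. H i \<omega> \<in> S} = measure (normal_measure (sqrt (r * (tau (Suc i) - tau i)))) S"
proof -
  have "{\<omega>\<in>space N. H i \<omega> \<in> S} = H i -` S \<inter> space N" by auto
  then show ?thesis unfolding H_law[symmetric] using assms by (simp add: measure_distr)
qed

lemma nb_less: "nb j < nb (Suc j)"
  using nb(1) by (simp add: strict_mono_Suc_iff)

lemma nb_mono: "i \<le> j \<Longrightarrow> nb i \<le> nb j"
  using nb(1) by (simp add: strict_mono_less_eq)

lemma nb_gt: "j < nb j"
proof (induction j)
  case 0 then show ?case using nb(2) by simp
next
  case (Suc j) then show ?case using nb_less[of j] by simp
qed

lemma length_pre [simp]: "length (pre j \<omega>) = nb j"
  using nb_less by (induction j) (simp_all add: Q0 Q less_imp_le)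

lemma pre_not_Nil: "pre j \<omega> \<noteq> []"
proof
  assume "pre j \<omega> = []"
  then have "nb j = 0" using length_pre[of j \<omega>] by simp
  then show False using nb_gt[of j] by simp
qed

lemma take_pre: "i \<le> j \<Longrightarrow> take (nb i) (pre j \<omega>) = pre i \<omega>"
proof (induction j)
  case (Suc j)
  show ?case
  proof (cases "i = Suc j")
    case True
    show ?thesis unfolding True by (rule take_all) (simp only: length_pre order_refl)
  next
    case False
    then have ij: "i \<le> j" using Suc by simp
    then show ?thesis using Suc.IH nb_mono[OF ij] by simp
  qed
qed (simp add: Q0)

lemma X_eq: "1 \<le> k \<Longrightarrow> k \<le> nb j \<Longrightarrow> X k \<omega> = sgn_of (pre j \<omega> ! (k - 1))"
proof -
  assume k: "1 \<le> k" "k \<le> nb j"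
  have *: "pre i \<omega> ! (k - 1) = pre i' \<omega> ! (k - 1)" if "i \<le> i'" "k \<le> nb i" for i i'
  proof -
    have "pre i \<omega> ! (k - 1) = take (nb i) (pre i' \<omega>) ! (k - 1)" by (simp only: take_pre[OF that(1)])
    also have "\<dots> = pre i' \<omega> ! (k - 1)" using that k by (intro nth_take) simp
    finally show ?thesis .
  qed
  have kk: "k \<le> nb k" using nb_gt[of k] by simp
  show ?thesis
  proof (cases "k \<le> j")
    case True
    show ?thesis unfolding X_def *[OF True kk] ..
  next
    case False
    then have "j \<le> k" by simp
    from *[OF this k(2)] show ?thesis unfolding X_def by (rule arg_cong[OF sym])
  qed
qed

lemma sign_code_X: "sign_code X (nb j) \<omega> = pre j \<omega>"
proof (rule nth_equalityI)
  fix i assume "i < length (sign_code X (nb j) \<omega>)"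
  then have i: "i < nb j" by simp
  have "X (Suc i) \<omega> = sgn_of (pre j \<omega> ! i)" using X_eq[of "Suc i" j \<omega>] i by simp
  then show "sign_code X (nb j) \<omega> ! i = pre j \<omega> ! i"
    using i by (simp add: sign_code_def sgn_of_def)
qed simp

text \<open>The values of \<open>H i\<close> that are compatible with the path \<open>l\<close>. The
  last sign before the block is taken from \<open>l\<close> and not from the random path, which
  makes the set deterministic.\<close>

definition block_event :: "bool list \<Rightarrow> nat \<Rightarrow> real set" where
  "block_event l i = (case i of 0 \<Rightarrow> {x. Q0 x = take (nb 0) l}
     | Suc i \<Rightarrow> {x. Q i (last (take (nb i) l)) x = take (nb (Suc i) - nb i) (drop (nb i) l)})"

lemma take_nb_Suc: "take (nb (Suc i)) l = take (nb i) l @ take (nb (Suc i) - nb i) (drop (nb i) l)"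
  using take_add[of "nb i" "nb (Suc i) - nb i" l] nb_less[of i] by simp

lemma pre_eq_iff:
  assumes "i \<le> j" "length l = nb j"
  shows "pre i \<omega> = take (nb i) l \<longleftrightarrow> (\<forall>k\<le>i. H k \<omega> \<in> block_event l k)"
  using assms(1)
proof (induction i)
  case 0
  show ?case by (simp add: block_event_def)
next
  case (Suc i)
  have ln: "length (pre i \<omega>) = length (take (nb i) l)" using nb_mono[of i j] Suc.prems assms(2) by simp
  have "pre (Suc i) \<omega> = take (nb (Suc i)) l \<longleftrightarrow>
    pre i \<omega> = take (nb i) l \<and> Q i (last (pre i \<omega>)) (H (Suc i) \<omega>) = take (nb (Suc i) - nb i) (drop (nb i) l)"
    unfolding take_nb_Suc using ln by simp
  also have "\<dots> \<longleftrightarrow> (\<forall>k\<le>i. H k \<omega> \<in> block_event l k) \<and> H (Suc i) \<omega> \<in> block_event l (Suc i)"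
    using Suc by (auto simp: block_event_def)
  also have "\<dots> \<longleftrightarrow> (\<forall>k\<le>Suc i. H k \<omega> \<in> block_event l k)" by (auto simp: le_Suc_eq)
  finally show ?case .
qed

lemma block_event_sets:
  assumes "i \<le> j" "length l = nb j"
  shows "block_event l i \<in> sets borel"
proof (cases i)
  case 0
  then show ?thesis using Q0(2)[of "take (nb 0) l"] assms nb_mono[of 0 j] by (simp add: block_event_def)
next
  case (Suc i')
  have "length (take (nb (Suc i') - nb i') (drop (nb i') l)) = nb (Suc i') - nb i'"
    using nb_mono[of "Suc i'" j] assms Suc by simp
  then show ?thesis using Q(2) by (simp add: block_event_def Suc)
qed

lemma prod_block_event:
  assumes "i \<le> j" "length l = nb j"
  shows "(\<Prod>k\<le>i. measure (normal_measure (sqrt (r * (tau (Suc k) - tau k)))) (block_event l k)) = chain_weight p (take (nb i) l)"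
  using assms(1)
proof (induction i)
  case 0
  have "length (take (nb 0) l) = nb 0" using assms nb_mono[of 0 j] by simp
  from Q0(3)[OF this] show ?case by (simp add: block_event_def r_def t_def)
next
  case (Suc i)
  have ln: "length (take (nb (Suc i) - nb i) (drop (nb i) l)) = nb (Suc i) - nb i"
    using nb_mono[of "Suc i" j] Suc.prems assms(2) by simp
  have ne: "take (nb i) l \<noteq> []" using nb_gt[of i] nb_gt[of j] assms(2) by auto
  have "measure (normal_measure (sqrt (r * (tau (Suc (Suc i)) - tau (Suc i))))) (block_event l (Suc i)) =
    path_weight p (last (take (nb i) l)) (take (nb (Suc i) - nb i) (drop (nb i) l))"
    using Q(3)[OF ln, of "last (take (nb i) l)"] by (simp add: block_event_def r_def t_def)
  then show ?case
    using Suc unfolding take_nb_Suc[of i] chain_weight_append[OF ne] by simp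
qed

text \<open>For fixed \<open>l\<close> the event is a rectangle in the independent increments
  \<open>H k\<close>, and its probability is the product of the block weights, which compose by
  \<open>chain_weight_append\<close>.\<close>

lemma pre_event_prob:
  assumes "length l = nb j"
  shows "{\<omega>\<in>space N. pre j \<omega> = l} \<in> events" "prob {\<omega>\<in>space N. pre j \<omega> = l} = chain_weight p l"
proof -
  have iff: "pre j \<omega> = l \<longleftrightarrow> (\<forall>k\<le>j. H k \<omega> \<in> block_event l k)" for \<omega>
    using pre_eq_iff[OF order_refl assms, of \<omega>] unfolding take_all[OF eq_refl[OF assms]] .
  have "\<omega> \<in> (\<Inter>k\<in>{..<Suc j}. H k -` block_event l k \<inter> space N) \<longleftrightarrow> \<omega> \<in> space N \<and> (\<forall>k\<le>j. H k \<omega> \<in> block_event l k)" for \<omega>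
    unfolding lessThan_Suc_atMost by auto
  then have eq: "{\<omega>\<in>space N. pre j \<omega> = l} = (\<Inter>k\<in>{..<Suc j}. H k -` block_event l k \<inter> space N)"
    unfolding iff by blast
  have s: "block_event l k \<in> sets borel" if "k \<in> {..<Suc j}" for k
    by (rule block_event_sets[of k j]) (use that assms in auto)
  have m: "H k -` block_event l k \<inter> space N \<in> events" if "k \<in> {..<Suc j}" for k
    using H_measurable s[OF that] by (rule measurable_sets)
  show "{\<omega>\<in>space N. pre j \<omega> = l} \<in> events" unfolding eq using m by (intro sets.finite_INT) auto
  have "prob (\<Inter>k\<in>{..<Suc j}. H k -` block_event l k \<inter> space N) = (\<Prod>k\<in>{..<Suc j}. prob (H k -` block_event l k \<inter> space N))"
  proof (rule indep_varsD[OF H_indep[of "Suc j"]])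
    show "{..<Suc j} \<noteq> {}" by (simp add: lessThan_empty_iff)
  qed (simp_all only: s finite_lessThan order_refl)
  also have "\<dots> = (\<Prod>k\<le>j. measure (normal_measure (sqrt (r * (tau (Suc k) - tau k)))) (block_event l k))"
    unfolding lessThan_Suc_atMost
  proof (rule prod.cong[OF refl])
    fix k assume "k \<in> {..j}"
    then have "block_event l k \<in> sets borel" using s by simp
    moreover have "H k -` block_event l k \<inter> space N = {\<omega>\<in>space N. H k \<omega> \<in> block_event l k}" by blast
    ultimately show "prob (H k -` block_event l k \<inter> space N) = measure (normal_measure (sqrt (r * (tau (Suc k) - tau k)))) (block_event l k)"
      by (simp only: H_prob)
  qed
  also have "\<dots> = chain_weight p l" using prod_block_event[OF order_refl assms] assms by simp
  finally show "prob {\<omega>\<in>space N. pre j \<omega> = l} = chain_weight p l" unfolding eq .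
qed

lemma pre_measurable: "pre j \<in> N \<rightarrow>\<^sub>M count_space UNIV"
proof -
  have "pre j -` {l} \<inter> space N \<in> events" for l
  proof (cases "length l = nb j")
    case True
    have "pre j -` {l} \<inter> space N = {\<omega>\<in>space N. pre j \<omega> = l}" by blast
    then show ?thesis using pre_event_prob(1)[OF True] by simp
  next
    case False
    then have "pre j -` {l} \<inter> space N = {}" by auto
    then show ?thesis by (simp only: sets.empty_sets)
  qed
  then show ?thesis
    by (subst measurable_count_space_eq_countable) auto
qed

lemma sign_process_X: "sign_process N X"
proof -
  have "X k \<in> borel_measurable N" for k
  proof -
    have "(\<lambda>\<omega>. (\<lambda>l. sgn_of (l ! (k - 1))) (pre k \<omega>)) \<in> borel_measurable N"
      by (rule measurable_compose[OF pre_measurable]) simp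
    then show ?thesis by (simp add: X_def[abs_def])
  qed
  then show ?thesis unfolding sign_process_def using prob_space_axioms by (auto simp: X_def sgn_of_def)
qed

lemma weighted_sum_X_same_law:
  assumes "sign_markov_chain M p Y"
  shows "same_process_law N (weighted_sum a X) M (weighted_sum a Y)"
proof (rule weighted_sum_same_law[OF sign_markov_chain_process[OF assms] sign_process_X])
  fix m
  show "\<exists>n\<ge>m. \<forall>l. length l = n \<longrightarrow>
      measure M {\<omega>\<in>space M. sign_code Y n \<omega> = l} = measure N {\<omega>\<in>space N. sign_code X n \<omega> = l}"
  proof (intro exI[of _ "nb m"] conjI allI impI)
    show "m \<le> nb m" using nb_gt[of m] by simp
    fix l :: "bool list" assume l: "length l = nb m"
    show "measure M {\<omega>\<in>space M. sign_code Y (nb m) \<omega> = l} = prob {\<omega>\<in>space N. sign_code X (nb m) \<omega> = l}"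
      unfolding sign_code_X sign_markov_chain_law[OF p assms l] pre_event_prob(2)[OF l] ..
  qed
qed

end

section \<open>Almost sure estimates\<close>

lemma sum_greaterThanAtMost_shift:
  "(\<Sum>k\<in>{m<..m + n}. f k) = (\<Sum>i<n. f (m + 1 + i))" for f :: "nat \<Rightarrow> real"
proof (induction n)
  case (Suc n)
  have "{m<..m + Suc n} = insert (m + 1 + n) {m<..m + n}" by auto
  then show ?case using Suc by simp
qed simp

lemma sum_greaterThanAtMost_split:
  fixes f :: "nat \<Rightarrow> real"
  assumes "l \<le> m" "m \<le> n"
  shows "(\<Sum>k\<in>{l<..n}. f k) = (\<Sum>k\<in>{l<..m}. f k) + (\<Sum>k\<in>{m<..n}. f k)"
proof -
  have "{l<..n} = {l<..m} \<union> {m<..n}" using assms by auto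
  then show ?thesis by (simp add: sum.union_disjoint disjoint_iff)
qed

lemma summation_by_parts:
  fixes a x :: "nat \<Rightarrow> real"
  assumes "m < n"
  shows "(\<Sum>k\<in>{m<..n}. a k * (x k - x (k - 1))) = a n * x n - a (m + 1) * x m - (\<Sum>k\<in>{m<..<n}. (a (k + 1) - a k) * x k)"
proof -
  have "(\<Sum>k\<in>{m<..Suc (m + i)}. a k * (x k - x (k - 1))) =
    a (Suc (m + i)) * x (Suc (m + i)) - a (m + 1) * x m - (\<Sum>k\<in>{m<..<Suc (m + i)}. (a (k + 1) - a k) * x k)" for i
  proof (induction i)
    case 0
    have "{m<..Suc m} = {Suc m}" "{m<..<Suc m} = {}" by auto
    then show ?case by (simp add: algebra_simps)
  next
    case (Suc i)
    have e: "{m<..Suc (m + Suc i)} = insert (Suc (m + Suc i)) {m<..Suc (m + i)}"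
      "{m<..<Suc (m + Suc i)} = insert (Suc (m + i)) {m<..<Suc (m + i)}" by auto
    show ?case unfolding e using Suc by (simp add: algebra_simps)
  qed
  from this[of "n - Suc m"] show ?thesis using assms by simp
qed

lemma abs_sum6_le:
  fixes x y u q v z :: real
  shows "\<bar>x - y + u + q - v - z\<bar> \<le> \<bar>x\<bar> + \<bar>y\<bar> + \<bar>u\<bar> + \<bar>q\<bar> + \<bar>v\<bar> + \<bar>z\<bar>"
proof -
  have "\<bar>x - y + u + q - v - z\<bar> \<le> \<bar>x - y + u + q - v\<bar> + \<bar>z\<bar>" by (rule abs_triangle_ineq4)
  also have "\<dots> \<le> \<bar>x - y + u + q\<bar> + \<bar>v\<bar> + \<bar>z\<bar>" by (intro add_right_mono abs_triangle_ineq4)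
  also have "\<dots> \<le> \<bar>x - y + u\<bar> + \<bar>q\<bar> + \<bar>v\<bar> + \<bar>z\<bar>" by (intro add_right_mono abs_triangle_ineq)
  also have "\<dots> \<le> \<bar>x - y\<bar> + \<bar>u\<bar> + \<bar>q\<bar> + \<bar>v\<bar> + \<bar>z\<bar>" by (intro add_right_mono abs_triangle_ineq)
  also have "\<dots> \<le> \<bar>x\<bar> + \<bar>y\<bar> + \<bar>u\<bar> + \<bar>q\<bar> + \<bar>v\<bar> + \<bar>z\<bar>" by (intro add_right_mono abs_triangle_ineq4)
  finally show ?thesis .
qed

context block_coupling
begin

definition coef :: "nat \<Rightarrow> nat \<Rightarrow> real" where "coef j i = a (nb j + 1 + i)"

definition kap :: real where "kap = (2 * p - 1) / (2 * (1 - p))"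

text \<open>By \<open>incr_eq\<close> this is \<open>incr\<close> at the signs with indices
  \<open>k - 1\<close> and \<open>k\<close>.\<close>

definition mdiff :: "nat \<Rightarrow> 'b \<Rightarrow> real" where "mdiff k \<omega> = X k \<omega> + kap * (X k \<omega> - X (k - 1) \<omega>)"

definition blk :: "nat \<Rightarrow> 'b \<Rightarrow> bool list" where "blk j \<omega> = Q j (last (pre j \<omega>)) (H (Suc j) \<omega>)"

definition W :: "nat \<Rightarrow> 'b \<Rightarrow> real" where "W j \<omega> = path_sum p (coef j) (last (pre j \<omega>)) (blk j \<omega>)"

lemma length_blk: "length (blk j \<omega>) = nb (Suc j) - nb j"
  by (simp add: blk_def Q)

lemma pre_Suc_blk: "pre (Suc j) \<omega> = pre j \<omega> @ blk j \<omega>"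
  by (simp add: blk_def)

lemma X_blk: "i < nb (Suc j) - nb j \<Longrightarrow> X (nb j + 1 + i) \<omega> = sgn_of (blk j \<omega> ! i)"
  using X_eq[of "nb j + 1 + i" "Suc j" \<omega>] by (simp add: pre_Suc_blk nth_append del: pre.simps)

lemma X_last: "X (nb j) \<omega> = sgn_of (last (pre j \<omega>))"
  using X_eq[of "nb j" j \<omega>] nb_gt[of j] by (simp add: last_conv_nth[OF pre_not_Nil])

lemma block_path_sum:
  assumes m: "m \<le> nb (Suc j) - nb j"
  shows "path_sum p (coef j) (last (pre j \<omega>)) (take m (blk j \<omega>)) = (\<Sum>k\<in>{nb j<..nb j + m}. a k * mdiff k \<omega>)"
proof -
  have len: "length (take m (blk j \<omega>)) = m" using m by (simp add: length_blk)
  have "incr p ((last (pre j \<omega>) # take m (blk j \<omega>)) ! i) (take m (blk j \<omega>) ! i) = mdiff (nb j + 1 + i) \<omega>" if i: "i < m" for i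
  proof -
    have c: "sgn_of (take m (blk j \<omega>) ! i) = X (nb j + 1 + i) \<omega>" using X_blk[of i j \<omega>] i m by simp
    have b: "sgn_of ((last (pre j \<omega>) # take m (blk j \<omega>)) ! i) = X (nb j + i) \<omega>"
    proof (cases i)
      case 0
      then show ?thesis using X_last[of j \<omega>] by simp
    next
      case (Suc i')
      then show ?thesis using X_blk[of i' j \<omega>] i m by simp
    qed
    show ?thesis unfolding incr_eq[OF p(2)] c b mdiff_def kap_def by simp
  qed
  then show ?thesis
    unfolding path_sum_eq len sum_greaterThanAtMost_shift by (intro sum.cong refl) (simp add: coef_def)
qed

lemma W_eq: "W j \<omega> = (\<Sum>k\<in>{nb j<..nb (Suc j)}. a k * mdiff k \<omega>)"
  using block_path_sum[of "nb (Suc j) - nb j" j \<omega>] length_blk[of j \<omega>] nb_less[of j] by (simp add: W_def)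

lemma sum_W: "(\<Sum>k\<in>{nb 0<..nb j}. a k * mdiff k \<omega>) = (\<Sum>i<j. W i \<omega>)"
proof (induction j)
  case (Suc j)
  then show ?case
    using sum_greaterThanAtMost_split[of "nb 0" "nb j" "nb (Suc j)" "\<lambda>k. a k * mdiff k \<omega>"] nb_mono[of 0 j] nb_less[of j]
    by (simp add: W_eq)
qed simp

lemma sum_H: "sqrt r * B (t j) \<omega> = sqrt r * B (t 0) \<omega> + (\<Sum>i<j. H (Suc i) \<omega>)"
  by (induction j) (simp_all add: H_def algebra_simps)

text \<open>A pathwise inequality that separates the sources of error: the initial stretch, the
  coupling of complete blocks, the incomplete last block of the martingale and of \<open>B\<close>,
  and what summation by parts leaves behind. The almost sure lemmas that follow treat them one at a
  time.\<close>

lemma approximation_error: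
  assumes n: "nb j < n" "n \<le> nb (Suc j)"
  shows "\<bar>weighted_sum a X n \<omega> - sqrt r * B (square_sum a n) \<omega>\<bar> \<le>
    \<bar>weighted_sum a X (nb 0) \<omega>\<bar> + sqrt r * \<bar>B (t 0) \<omega>\<bar> + (\<Sum>i<j. \<bar>W i \<omega> - H (Suc i) \<omega>\<bar>)
    + \<bar>path_sum p (coef j) (last (pre j \<omega>)) (take (n - nb j) (blk j \<omega>))\<bar>
    + sqrt r * \<bar>B (square_sum a n) \<omega> - B (t j) \<omega>\<bar>
    + \<bar>kap\<bar> * (\<bar>a n\<bar> + \<bar>a (nb 0 + 1)\<bar> + \<bar>\<Sum>k\<in>{nb 0<..<n}. (a (k + 1) - a k) * X k \<omega>\<bar>)"
proof -
  define n0 where "n0 = nb 0"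
  define R where "R = (\<Sum>k\<in>{n0<..<n}. (a (k + 1) - a k) * X k \<omega>)"
  define P where "P = path_sum p (coef j) (last (pre j \<omega>)) (take (n - nb j) (blk j \<omega>))"
  have n0: "n0 < n" "n0 \<le> nb j" using nb_mono[of 0 j] n by (auto simp: n0_def)
  have X1: "\<bar>X k \<omega>\<bar> = 1" for k by (simp add: X_def sgn_of_def)
  have "{1..n} = {1..n0} \<union> {n0<..n}" using n0 by auto
  then have "weighted_sum a X n \<omega> = weighted_sum a X n0 \<omega> + (\<Sum>k\<in>{n0<..n}. a k * X k \<omega>)"
    unfolding weighted_sum_def by (simp add: sum.union_disjoint disjoint_iff)
  also have "(\<Sum>k\<in>{n0<..n}. a k * X k \<omega>) = (\<Sum>k\<in>{n0<..n}. a k * mdiff k \<omega>) - kap * (\<Sum>k\<in>{n0<..n}. a k * (X k \<omega> - X (k - 1) \<omega>))"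
    by (simp add: mdiff_def sum_distrib_left sum_subtractf[symmetric] algebra_simps)
  also have "(\<Sum>k\<in>{n0<..n}. a k * (X k \<omega> - X (k - 1) \<omega>)) = a n * X n \<omega> - a (n0 + 1) * X n0 \<omega> - R"
    unfolding R_def by (rule summation_by_parts[OF n0(1)])
  also have "(\<Sum>k\<in>{n0<..n}. a k * mdiff k \<omega>) = (\<Sum>i<j. W i \<omega>) + P"
    using sum_greaterThanAtMost_split[of n0 "nb j" n "\<lambda>k. a k * mdiff k \<omega>"] n0 n block_path_sum[of "n - nb j" j \<omega>]
    by (simp add: P_def sum_W[symmetric] n0_def)
  finally have S: "weighted_sum a X n \<omega> = weighted_sum a X n0 \<omega> + ((\<Sum>i<j. W i \<omega>) + P - kap * (a n * X n \<omega> - a (n0 + 1) * X n0 \<omega> - R))" .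
  have Bn: "sqrt r * B (square_sum a n) \<omega> = sqrt r * B (t 0) \<omega> + (\<Sum>i<j. H (Suc i) \<omega>) + sqrt r * (B (square_sum a n) \<omega> - B (t j) \<omega>)"
    using sum_H[of j \<omega>] by (simp add: algebra_simps)
  define U where "U = (\<Sum>i<j. W i \<omega> - H (Suc i) \<omega>)"
  define Z where "Z = kap * (a n * X n \<omega> - a (n0 + 1) * X n0 \<omega> - R)"
  define x where "x = weighted_sum a X n0 \<omega>"
  define y where "y = sqrt r * B (t 0) \<omega>"
  define v where "v = sqrt r * (B (square_sum a n) \<omega> - B (t j) \<omega>)"
  have eq: "weighted_sum a X n \<omega> - sqrt r * B (square_sum a n) \<omega> = x - y + U + P - v - Z"
    unfolding S Bn U_def Z_def x_def y_def v_def sum_subtractf by simp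
  have "\<bar>U\<bar> \<le> (\<Sum>i<j. \<bar>W i \<omega> - H (Suc i) \<omega>\<bar>)" unfolding U_def by (rule sum_abs)
  moreover have "\<bar>Z\<bar> \<le> \<bar>kap\<bar> * (\<bar>a n\<bar> + \<bar>a (n0 + 1)\<bar> + \<bar>R\<bar>)"
  proof -
    have "\<bar>a n * X n \<omega> - a (n0 + 1) * X n0 \<omega> - R\<bar> \<le> \<bar>a n * X n \<omega>\<bar> + \<bar>a (n0 + 1) * X n0 \<omega>\<bar> + \<bar>R\<bar>" by linarith
    also have "\<dots> = \<bar>a n\<bar> + \<bar>a (n0 + 1)\<bar> + \<bar>R\<bar>" by (simp add: abs_mult X1)
    finally show ?thesis unfolding Z_def abs_mult by (rule mult_left_mono) simp
  qed
  moreover have "\<bar>y\<bar> = sqrt r * \<bar>B (t 0) \<omega>\<bar>" "\<bar>v\<bar> = sqrt r * \<bar>B (square_sum a n) \<omega> - B (t j) \<omega>\<bar>"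
    using r_pos by (simp_all add: abs_mult y_def v_def)
  ultimately have "\<bar>x\<bar> + \<bar>y\<bar> + \<bar>U\<bar> + \<bar>P\<bar> + \<bar>v\<bar> + \<bar>Z\<bar> \<le> \<bar>x\<bar> + sqrt r * \<bar>B (t 0) \<omega>\<bar> + (\<Sum>i<j. \<bar>W i \<omega> - H (Suc i) \<omega>\<bar>)
    + \<bar>P\<bar> + sqrt r * \<bar>B (square_sum a n) \<omega> - B (t j) \<omega>\<bar> + \<bar>kap\<bar> * (\<bar>a n\<bar> + \<bar>a (n0 + 1)\<bar> + \<bar>R\<bar>)"
    by (intro add_mono) simp_all
  then show ?thesis
    unfolding eq n0_def[symmetric] unfolding P_def[symmetric] R_def[symmetric] x_def[symmetric]
    by (rule order_trans[OF abs_sum6_le])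
qed

lemma Q_event:
  "{x. P (Q j b x)} \<in> sets borel"
  "measure (normal_measure (sqrt (r * (t (Suc j) - t j)))) {x. P (Q j b x)} =
     path_exp p b (nb (Suc j) - nb j) (\<lambda>l. if P l then 1 else 0)"
proof -
  define m where "m = nb (Suc j) - nb j"
  define \<sigma> where "\<sigma> = sqrt (r * (t (Suc j) - t j))"
  have \<sigma>: "\<sigma> > 0" using r_pos A_inc[of j] by (simp add: \<sigma>_def t_def)
  interpret nm: real_distribution "normal_measure \<sigma>" by (rule real_distribution_normal_measure[OF \<sigma>])
  have eq: "{x. P (Q j b x)} = (\<Union>l\<in>{l\<in>paths m. P l}. {x. Q j b x = l})"
    using Q(1)[of j b] by (auto simp: paths_def m_def)
  have s: "{x. Q j b x = l} \<in> sets borel" if "l \<in> {l\<in>paths m. P l}" for l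
    using Q(2)[of l j b] that by (simp add: paths_def m_def)
  show "{x. P (Q j b x)} \<in> sets borel"
    unfolding eq by (rule sets.finite_UN) (use s in auto)
  have "disjoint_family_on (\<lambda>l. {x. Q j b x = l}) {l\<in>paths m. P l}" by (auto simp: disjoint_family_on_def)
  then have "nm.prob (\<Union>l\<in>{l\<in>paths m. P l}. {x. Q j b x = l}) = (\<Sum>l\<in>{l\<in>paths m. P l}. nm.prob {x. Q j b x = l})"
    by (intro nm.finite_measure_finite_Union) (use s in auto)
  also have "\<dots> = (\<Sum>l\<in>{l\<in>paths m. P l}. path_weight p b l)"
    by (rule sum.cong[OF refl]) (use Q(3)[of _ j b] in \<open>simp add: paths_def m_def \<sigma>_def r_def t_def\<close>)
  also have "\<dots> = (\<Sum>l\<in>paths m. if P l then path_weight p b l else 0)"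
    by (rule sum.inter_filter) simp
  also have "\<dots> = path_exp p b m (\<lambda>l. if P l then 1 else 0)"
    unfolding path_exp_def by (rule sum.cong) auto
  finally show "measure (normal_measure (sqrt (r * (t (Suc j) - t j)))) {x. P (Q j b x)} =
     path_exp p b (nb (Suc j) - nb j) (\<lambda>l. if P l then 1 else 0)"
    unfolding eq m_def \<sigma>_def .
qed

lemma H_Suc_law: "distr N borel (H (Suc j)) = normal_measure (sqrt (r * (t (Suc j) - t j)))"
  using H_law[of "Suc j"] by simp

text \<open>The random last sign selects one of the errors for \<open>b = True\<close> and
  \<open>b = False\<close>. Their sum dominates it and is a function of the increment alone, whose
  law is known. A series of nonnegative variables with finite total expectation converges almost
  surely.\<close>

lemma AE_coupling_summable:
  assumes e: "\<And>j b. integrable (normal_measure (sqrt (r * (t (Suc j) - t j)))) (\<lambda>x. \<bar>path_sum p (coef j) b (Q j b x) - x\<bar>)"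
    "\<And>j b. (LINT x|normal_measure (sqrt (r * (t (Suc j) - t j))). \<bar>path_sum p (coef j) b (Q j b x) - x\<bar>) \<le> e j"
    and w: "\<And>j. 0 \<le> w j" "summable (\<lambda>j. w j * e j)"
  shows "AE \<omega> in N. summable (\<lambda>j. w j * \<bar>W j \<omega> - H (Suc j) \<omega>\<bar>)"
proof -
  define g where "g j b x = \<bar>path_sum p (coef j) b (Q j b x) - x\<bar>" for j b x
  define f where "f j \<omega> = w j * (g j True (H (Suc j) \<omega>) + g j False (H (Suc j) \<omega>))" for j \<omega>
  have gm: "g j b \<in> borel_measurable borel" for j b
    using borel_measurable_integrable[OF e(1)[of j b]] by (simp add: g_def[abs_def])
  have gi: "integrable N (\<lambda>\<omega>. g j b (H (Suc j) \<omega>))" "(LINT \<omega>|N. g j b (H (Suc j) \<omega>)) \<le> e j" for j b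
  proof -
    have "integrable (distr N borel (H (Suc j))) (g j b)" unfolding H_Suc_law g_def[abs_def] by (rule e(1))
    then show "integrable N (\<lambda>\<omega>. g j b (H (Suc j) \<omega>))"
      by (subst (asm) integrable_distr_eq) (simp_all add: gm)
    have "(LINT x|distr N borel (H (Suc j)). g j b x) \<le> e j" unfolding H_Suc_law g_def by (rule e(2))
    then show "(LINT \<omega>|N. g j b (H (Suc j) \<omega>)) \<le> e j"
      by (subst (asm) integral_distr) (simp_all add: gm)
  qed
  have g0: "0 \<le> g j b x" for j b x by (simp add: g_def)
  have f0: "0 \<le> f j \<omega>" for j \<omega> unfolding f_def using w(1) g0 by (intro mult_nonneg_nonneg add_nonneg_nonneg) auto
  have fi: "integrable N (f j)" for j unfolding f_def[abs_def] by (intro integrable_mult_right Bochner_Integration.integrable_add gi)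
  have fE: "(LINT \<omega>|N. f j \<omega>) \<le> 2 * (w j * e j)" for j
  proof -
    have "(LINT \<omega>|N. f j \<omega>) = w j * ((LINT \<omega>|N. g j True (H (Suc j) \<omega>)) + (LINT \<omega>|N. g j False (H (Suc j) \<omega>)))"
      unfolding f_def using gi(1) by simp
    also have "\<dots> \<le> w j * (e j + e j)" using w(1) gi(2) by (intro mult_left_mono add_mono)
    finally show ?thesis by (simp add: algebra_simps)
  qed
  have we: "summable (\<lambda>j. 2 * (w j * e j))" using w(2) by (rule summable_mult)
  have E0: "0 \<le> (LINT \<omega>|N. f j \<omega>)" for j using f0 by simp
  have sE: "summable (\<lambda>j. LINT \<omega>|N. f j \<omega>)"
    by (rule summable_comparison_test'[OF we, of 0]) (use fE E0 in simp)
  have "(\<integral>\<^sup>+\<omega>. (\<Sum>j. ennreal (f j \<omega>)) \<partial>N) = (\<Sum>j. \<integral>\<^sup>+\<omega>. ennreal (f j \<omega>) \<partial>N)"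
    by (rule nn_integral_suminf) (use fi in \<open>auto intro: borel_measurable_integrable\<close>)
  also have "\<dots> = (\<Sum>j. ennreal (LINT \<omega>|N. f j \<omega>))"
    by (rule suminf_cong, rule nn_integral_eq_integral) (use fi f0 in auto)
  also have "\<dots> = ennreal (\<Sum>j. LINT \<omega>|N. f j \<omega>)" by (rule suminf_ennreal2[OF E0 sE])
  finally have fin: "(\<integral>\<^sup>+\<omega>. (\<Sum>j. ennreal (f j \<omega>)) \<partial>N) \<noteq> \<infinity>" by simp
  have [measurable]: "f j \<in> borel_measurable N" for j by (rule borel_measurable_integrable[OF fi])
  have "AE \<omega> in N. (\<Sum>j. ennreal (f j \<omega>)) \<noteq> \<infinity>"
    by (rule nn_integral_PInf_AE[OF _ fin]) measurable
  then show ?thesis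
  proof (rule AE_mp, intro AE_I2 impI)
    fix \<omega> assume "(\<Sum>j. ennreal (f j \<omega>)) \<noteq> \<infinity>"
    then have sf: "summable (\<lambda>j. f j \<omega>)" by (intro summable_suminf_not_top f0) simp
    have "norm (w j * \<bar>W j \<omega> - H (Suc j) \<omega>\<bar>) \<le> f j \<omega>" for j
    proof -
      have "\<bar>W j \<omega> - H (Suc j) \<omega>\<bar> = g j (last (pre j \<omega>)) (H (Suc j) \<omega>)" by (simp add: g_def W_def blk_def)
      also have "\<dots> \<le> g j True (H (Suc j) \<omega>) + g j False (H (Suc j) \<omega>)"
        using g0[of j True "H (Suc j) \<omega>"] g0[of j False "H (Suc j) \<omega>"] by (cases "last (pre j \<omega>)") simp_all
      finally show ?thesis using w(1)[of j] by (simp add: f_def mult_left_mono)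
    qed
    then show "summable (\<lambda>j. w j * \<bar>W j \<omega> - H (Suc j) \<omega>\<bar>)" by (intro summable_comparison_test'[OF sf, of 0])
  qed
qed

text \<open>The event for the actual last sign lies in the union of the events for both signs, which
  depend on the increment alone. No conditioning on the past takes place before the Borel-Cantelli
  lemma is applied.\<close>

lemma AE_block_maximum:
  assumes \<theta>: "\<And>j. 0 \<le> \<theta> j" and s: "summable (\<lambda>j. exp (- (\<theta> j)\<^sup>2 / (4 * mgf_const p * (t (Suc j) - t j))))"
  shows "AE \<omega> in N. \<forall>\<^sub>F j in sequentially. \<forall>k\<le>nb (Suc j) - nb j. \<bar>path_sum p (coef j) (last (pre j \<omega>)) (take k (blk j \<omega>))\<bar> < \<theta> j"
proof -
  define P where "P j b l \<longleftrightarrow> (\<exists>k\<le>length l. \<theta> j \<le> \<bar>path_sum p (coef j) b (take k l)\<bar>)" for j b l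
  define E where "E j b = {\<omega>\<in>space N. H (Suc j) \<omega> \<in> {x. P j b (Q j b x)}}" for j b
  define q where "q j = exp (- (\<theta> j)\<^sup>2 / (4 * mgf_const p * (t (Suc j) - t j)))" for j
  have Ee: "E j b \<in> events" for j b
    unfolding E_def using measurable_sets[OF H_measurable[of "Suc j"] Q_event(1)[of "P j b" j b]] by (simp add: vimage_def Int_def conj_commute)
  have Ep: "prob (E j b) \<le> 2 * q j" for j b
  proof -
    have "prob (E j b) = path_exp p b (nb (Suc j) - nb j) (\<lambda>l. if P j b l then 1 else 0)"
      unfolding E_def H_prob[OF Q_event(1)] tau_Suc Q_event(2) ..
    also have "\<dots> \<le> 2 * q j"
      unfolding P_def q_def
    proof (rule path_maximal_inequality[OF p \<theta>])
      have "{1..nb (Suc j)} = {1..nb j} \<union> {nb j<..nb j + (nb (Suc j) - nb j)}" using nb_less[of j] by auto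
      then have "t (Suc j) = t j + (\<Sum>k\<in>{nb j<..nb j + (nb (Suc j) - nb j)}. (a k)\<^sup>2)"
        unfolding t_def square_sum_def by (simp add: sum.union_disjoint disjoint_iff)
      then show "(\<Sum>i<nb (Suc j) - nb j. (coef j i)\<^sup>2) \<le> t (Suc j) - t j"
        unfolding sum_greaterThanAtMost_shift by (simp add: coef_def)
      show "0 < t (Suc j) - t j" using A_inc[of j] by (simp add: t_def)
    qed
    finally show ?thesis .
  qed
  define F where "F j = E j True \<union> E j False" for j
  have Fe: "F j \<in> events" for j unfolding F_def using Ee by auto
  have Fp: "prob (F j) \<le> 4 * q j" for j
    using measure_Un_le[OF Ee[of j True] Ee[of j False]] Ep[of j True] Ep[of j False] unfolding F_def by linarith
  have sq: "summable (\<lambda>j. 4 * q j)" using s unfolding q_def by (rule summable_mult)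
  have "summable (\<lambda>j. prob (F j))"
    by (rule summable_comparison_test'[OF sq, of 0]) (use Fp in simp)
  then have "AE \<omega> in N. \<forall>\<^sub>F j in sequentially. \<omega> \<in> space N - F j"
    by (rule borel_cantelli_AE1[OF Fe, rotated]) (simp add: emeasure_eq_measure)
  then show ?thesis
  proof (rule AE_mp, intro AE_I2 impI)
    fix \<omega> assume w: "\<omega> \<in> space N" and "\<forall>\<^sub>F j in sequentially. \<omega> \<in> space N - F j"
    then show "\<forall>\<^sub>F j in sequentially. \<forall>k\<le>nb (Suc j) - nb j. \<bar>path_sum p (coef j) (last (pre j \<omega>)) (take k (blk j \<omega>))\<bar> < \<theta> j"
    proof (elim eventually_mono)
      fix j assume "\<omega> \<in> space N - F j"
      then have "\<omega> \<notin> E j b" for b unfolding F_def by (cases b) auto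
      then have "\<not> P j (last (pre j \<omega>)) (blk j \<omega>)" using w unfolding E_def blk_def by blast
      then show "\<forall>k\<le>nb (Suc j) - nb j. \<bar>path_sum p (coef j) (last (pre j \<omega>)) (take k (blk j \<omega>))\<bar> < \<theta> j"
        unfolding P_def length_blk by (meson not_le)
    qed
  qed
qed

lemma AE_bm_maximum:
  assumes \<theta>: "\<And>j. 0 < \<theta> j" and s: "summable (\<lambda>j. exp (- (\<theta> j)\<^sup>2 / (8 * (t (Suc j) - t j))))"
  shows "AE \<omega> in N. \<forall>\<^sub>F j in sequentially. \<forall>n. nb j < n \<and> n \<le> nb (Suc j) \<longrightarrow> \<bar>B (square_sum a n) \<omega> - B (t j) \<omega>\<bar> < \<theta> j"
proof -
  define T where "T j = square_sum a ` {nb j<..nb (Suc j)}" for j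
  define F where "F j = {\<omega>\<in>space N. \<exists>u\<in>T j. \<theta> j \<le> \<bar>B u \<omega> - B (t j) \<omega>\<bar>}" for j
  have T: "finite (T j)" "T j \<subseteq> {t j..t (Suc j)}" for j
    unfolding T_def t_def by (auto intro!: square_sum_mono)
  have Fp: "prob (F j) \<le> 4 * exp (- (\<theta> j)\<^sup>2 / (8 * (t (Suc j) - t j)))" for j
    unfolding F_def by (rule bm_maximal_inequality[OF B _ _ T \<theta>]) (use t_pos[of j] A_inc[of j] in \<open>auto simp: t_def\<close>)
  have Fe: "F j \<in> events" for j
  proof -
    have "{\<omega>\<in>space N. \<theta> j \<le> \<bar>B u \<omega> - B (t j) \<omega>\<bar>} \<in> events" if "u \<in> T j" for u
    proof -
      have "u \<ge> 0" using T(2)[of j] that t_pos[of j] by auto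
      then have [measurable]: "B u \<in> borel_measurable N" "B (t j) \<in> borel_measurable N"
        using t_pos[of j] by (auto intro!: B_measurable)
      show ?thesis by measurable
    qed
    then have "(\<Union>u\<in>T j. {\<omega>\<in>space N. \<theta> j \<le> \<bar>B u \<omega> - B (t j) \<omega>\<bar>}) \<in> events" using T(1) by (intro sets.finite_UN) auto
    also have "(\<Union>u\<in>T j. {\<omega>\<in>space N. \<theta> j \<le> \<bar>B u \<omega> - B (t j) \<omega>\<bar>}) = F j" unfolding F_def by blast
    finally show ?thesis .
  qed
  have sq: "summable (\<lambda>j. 4 * exp (- (\<theta> j)\<^sup>2 / (8 * (t (Suc j) - t j))))" using s by (rule summable_mult)
  have "summable (\<lambda>j. prob (F j))"
    by (rule summable_comparison_test'[OF sq, of 0]) (use Fp in simp)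
  then have "AE \<omega> in N. \<forall>\<^sub>F j in sequentially. \<omega> \<in> space N - F j"
    by (rule borel_cantelli_AE1[OF Fe, rotated]) (simp add: emeasure_eq_measure)
  then show ?thesis
  proof (rule AE_mp, intro AE_I2 impI)
    fix \<omega> assume w: "\<omega> \<in> space N" and "\<forall>\<^sub>F j in sequentially. \<omega> \<in> space N - F j"
    then show "\<forall>\<^sub>F j in sequentially. \<forall>n. nb j < n \<and> n \<le> nb (Suc j) \<longrightarrow> \<bar>B (square_sum a n) \<omega> - B (t j) \<omega>\<bar> < \<theta> j"
    proof (elim eventually_mono)
      fix j assume "\<omega> \<in> space N - F j"
      then have F: "\<And>u. u \<in> T j \<Longrightarrow> \<bar>B u \<omega> - B (t j) \<omega>\<bar> < \<theta> j" unfolding F_def by (auto simp: not_le)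
      show "\<forall>n. nb j < n \<and> n \<le> nb (Suc j) \<longrightarrow> \<bar>B (square_sum a n) \<omega> - B (t j) \<omega>\<bar> < \<theta> j"
        by (intro allI impI F) (simp add: T_def)
    qed
  qed
qed

end

lemma backward_sum:
  fixes \<beta> c x :: "nat \<Rightarrow> real"
  assumes "\<And>k. \<beta> (Suc k) = c k - \<rho> * c (Suc k)"
  shows "(\<Sum>k=1..Suc m. \<beta> k * x k) =
    c 0 * x 1 + (\<Sum>i<m. c (Suc i) * (x (i + 2) - \<rho> * x (i + 1))) - \<rho> * c (Suc m) * x (Suc m)"
proof (induction m)
  case 0
  have e: "\<beta> (Suc 0) = c 0 - \<rho> * c (Suc 0)" by (rule assms)
  show ?case by (simp add: e algebra_simps)
next
  case (Suc m)
  have "(\<Sum>k=1..Suc (Suc m). \<beta> k * x k) = (\<Sum>k=1..Suc m. \<beta> k * x k) + \<beta> (Suc (Suc m)) * x (Suc (Suc m))" by simp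
  then show ?case unfolding Suc assms[of "Suc m"] by (simp add: algebra_simps)
qed

section \<open>The remainder of the summation by parts, and the combination of all estimates\<close>

context block_coupling
begin

lemma pre_event:
  "{\<omega>\<in>space N. P (pre j \<omega>)} \<in> events"
  "prob {\<omega>\<in>space N. P (pre j \<omega>)} = (\<Sum>l\<in>paths (nb j). if P l then chain_weight p l else 0)"
proof -
  show "{\<omega>\<in>space N. P (pre j \<omega>)} \<in> events"
    using sign_code_event_prob(1)[OF sign_process_X, of P "nb j"] unfolding sign_code_X .
  have "prob {\<omega>\<in>space N. P (pre j \<omega>)} = (\<Sum>l\<in>paths (nb j). if P l then prob {\<omega>\<in>space N. pre j \<omega> = l} else 0)"
    using sign_code_event_prob(2)[OF sign_process_X, of P "nb j"] unfolding sign_code_X .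
  also have "\<dots> = (\<Sum>l\<in>paths (nb j). if P l then chain_weight p l else 0)"
  proof (rule sum.cong[OF refl])
    fix l assume "l \<in> paths (nb j)"
    then have "length l = nb j" by (simp add: paths_def)
    from pre_event_prob(2)[OF this]
    show "(if P l then prob {\<omega>\<in>space N. pre j \<omega> = l} else 0) = (if P l then chain_weight p l else 0)" by (simp only:)
  qed
  finally show "prob {\<omega>\<in>space N. P (pre j \<omega>)} = (\<Sum>l\<in>paths (nb j). if P l then chain_weight p l else 0)" .
qed

text \<open>The first sign of the whole path plays the role of the initial sign, so the martingale
  sum starts with the second one; hence the indices \<open>i + 1\<close> and
  \<open>i + 2\<close>.\<close>

lemma prefix_path_sum:
  assumes "k < nb j"
  shows "path_sum p c (hd (pre j \<omega>)) (take k (tl (pre j \<omega>))) =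
    (\<Sum>i<k. c i * ((X (i + 2) \<omega> - (2 * p - 1) * X (i + 1) \<omega>) / (2 * (1 - p))))"
proof -
  obtain b l where bl: "pre j \<omega> = b # l" using pre_not_Nil[of j \<omega>] by (cases "pre j \<omega>") auto
  have len: "length (take k l) = k" using assms length_pre[of j \<omega>] bl by simp
  have "incr p ((b # take k l) ! i) (take k l ! i) = (X (i + 2) \<omega> - (2 * p - 1) * X (i + 1) \<omega>) / (2 * (1 - p))"
    if i: "i < k" for i
  proof -
    have c: "X (i + 2) \<omega> = sgn_of (take k l ! i)" using X_eq[of "i + 2" j \<omega>] bl i assms by simp
    have b: "X (i + 1) \<omega> = sgn_of ((b # take k l) ! i)"
      using X_eq[of "i + 1" j \<omega>] bl i assms by (cases i) simp_all
    show ?thesis unfolding b c incr_eq'[OF p(2)] using p by simp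
  qed
  then show ?thesis unfolding bl list.sel path_sum_eq len by simp
qed

text \<open>Boundedness is enough for the remainder term. The weights \<open>c\<close> of the
  associated martingale have finite total variance, so the maximal inequality holds with one
  constant for all lengths, and the supremum exceeds the level \<open>i\<close> with a probability
  that tends to 0.\<close>

lemma AE_signed_sum_bounded:
  assumes \<beta>: "summable (\<lambda>k. (\<beta> (Suc k))\<^sup>2)"
  shows "AE \<omega> in N. \<exists>C. \<forall>n. \<bar>\<Sum>k=1..n. \<beta> k * X k \<omega>\<bar> \<le> C"
proof -
  define \<rho> where "\<rho> = 2 * p - 1"
  have \<rho>: "\<bar>\<rho>\<bar> < 1" using p by (simp add: \<rho>_def abs_less_iff)
  from geometric_backward_solution[OF \<beta> \<rho>] obtain c V Bd where
    c: "(\<forall>k. \<beta> (Suc k) = c k - \<rho> * c (Suc k)) \<and> (\<forall>k. \<bar>c k\<bar> \<le> Bd) \<and> 0 < V \<and> (\<forall>n. (\<Sum>i<n. (c i)\<^sup>2) \<le> V)"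
    by (elim exE)
  then have rec: "\<And>k. \<beta> (Suc k) = c k - \<rho> * c (Suc k)" and Bd: "\<And>k. \<bar>c k\<bar> \<le> Bd" and V: "0 < V" "\<And>n. (\<Sum>i<n. (c i)\<^sup>2) \<le> V"
    by auto
  \<comment> \<open>The weight \<open>c 0\<close> belongs to the first sign, which has no
    predecessor; the martingale part begins with \<open>c 1\<close>.\<close>
  define c' where "c' i = c (Suc i)" for i
  have c'V: "(\<Sum>i<n. (c' i)\<^sup>2) \<le> V" for n
    using V(2)[of "Suc n"] sum.lessThan_Suc_shift[of "\<lambda>i. (c i)\<^sup>2" n] zero_le_power2[of "c 0"]
    unfolding c'_def by linarith
  define D where "D k \<omega> = (\<Sum>i<k. c' i * ((X (i + 2) \<omega> - \<rho> * X (i + 1) \<omega>) / (2 * (1 - p))))" for k \<omega>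
  define E where "E \<theta> j = {\<omega>\<in>space N. \<exists>k<nb j. \<theta> \<le> \<bar>D k \<omega>\<bar>}" for \<theta> :: real and j
  define PP where "PP \<theta> l \<longleftrightarrow> (\<exists>k\<le>length (tl l). \<theta> \<le> \<bar>path_sum p c' (hd l) (take k (tl l))\<bar>)" for \<theta> and l :: "bool list"
  have E_eq: "E \<theta> j = {\<omega>\<in>space N. PP \<theta> (pre j \<omega>)}" for \<theta> j
  proof -
    have "(\<exists>k<nb j. \<theta> \<le> \<bar>D k \<omega>\<bar>) \<longleftrightarrow> PP \<theta> (pre j \<omega>)" for \<omega>
    proof -
      have le: "k \<le> length (tl (pre j \<omega>)) \<longleftrightarrow> k < nb j" for k using nb_gt[of j] by auto
      show ?thesis unfolding PP_def le using prefix_path_sum[of _ j c' \<omega>] unfolding D_def \<rho>_def by auto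
    qed
    then show ?thesis by (simp add: E_def)
  qed
  have Ee: "E \<theta> j \<in> events" for \<theta> j unfolding E_eq by (rule pre_event(1))
  have Ep: "prob (E \<theta> j) \<le> 2 * exp (- \<theta>\<^sup>2 / (4 * mgf_const p * V))" if \<theta>: "\<theta> \<ge> 0" for \<theta> j
  proof -
    obtain m where m: "nb j = Suc m" using nb_gt[of j] by (cases "nb j") auto
    have *: "(\<Sum>l\<in>paths m. if PP \<theta> (b # l) then chain_weight p (b # l) else 0) \<le> exp (- \<theta>\<^sup>2 / (4 * mgf_const p * V))" for b
    proof -
      have "(\<Sum>l\<in>paths m. if PP \<theta> (b # l) then chain_weight p (b # l) else 0) =
        path_exp p b m (\<lambda>l. if \<exists>k\<le>length l. \<theta> \<le> \<bar>path_sum p c' b (take k l)\<bar> then 1 else 0) / 2"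
        unfolding path_exp_def sum_divide_distrib by (rule sum.cong) (auto simp: PP_def)
      also have "\<dots> \<le> 2 * exp (- \<theta>\<^sup>2 / (4 * mgf_const p * V)) / 2"
        by (intro divide_right_mono path_maximal_inequality[OF p \<theta> c'V V(1)]) simp
      finally show ?thesis by simp
    qed
    have "prob (E \<theta> j) = (\<Sum>l\<in>paths m. if PP \<theta> (True # l) then chain_weight p (True # l) else 0)
      + (\<Sum>l\<in>paths m. if PP \<theta> ((\<not> True) # l) then chain_weight p ((\<not> True) # l) else 0)"
      unfolding E_eq pre_event(2) m by (rule sum_paths_Suc)
    then show ?thesis using *[of True] *[of "\<not> True"] by linarith
  qed
  define U where "U \<theta> = (\<Union>j. E \<theta> j)" for \<theta>
  have Ue: "U \<theta> \<in> events" for \<theta> unfolding U_def using Ee by auto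
  have Up: "prob (U \<theta>) \<le> 2 * exp (- \<theta>\<^sup>2 / (4 * mgf_const p * V))" if \<theta>: "\<theta> \<ge> 0" for \<theta>
  proof (rule LIMSEQ_le_const2)
    have "incseq (E \<theta>)"
    proof (rule monoI)
      fix i j :: nat assume "i \<le> j"
      then have "nb i \<le> nb j" by (rule nb_mono)
      then show "E \<theta> i \<subseteq> E \<theta> j" unfolding E_def by (blast intro: less_le_trans)
    qed
    then show "(\<lambda>j. prob (E \<theta> j)) \<longlonglongrightarrow> prob (U \<theta>)"
      unfolding U_def using Ee by (intro finite_Lim_measure_incseq) auto
    show "\<exists>n. \<forall>j\<ge>n. prob (E \<theta> j) \<le> 2 * exp (- \<theta>\<^sup>2 / (4 * mgf_const p * V))" using Ep[OF \<theta>] by blast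
  qed
  define Z where "Z = (\<Inter>i::nat. U (real i))"
  have Ze: "Z \<in> events" unfolding Z_def using Ue by auto
  have "prob Z \<le> 0"
  proof (rule LIMSEQ_le_const)
    have K: "4 * mgf_const p * V > 0" using mgf_const_ge_1[of p] V(1) by simp
    have "(\<lambda>i. 2 * exp (- (real i)\<^sup>2 / k)) \<longlonglongrightarrow> 0" if "k > 0" for k :: real
      using that by real_asymp
    from this[OF K] show "(\<lambda>i. 2 * exp (- (real i)\<^sup>2 / (4 * mgf_const p * V))) \<longlonglongrightarrow> 0" .
    show "\<exists>n. \<forall>i\<ge>n. prob Z \<le> 2 * exp (- (real i)\<^sup>2 / (4 * mgf_const p * V))"
    proof (intro exI[of _ 0] allI impI)
      fix i :: nat
      have "prob Z \<le> prob (U (real i))" by (rule finite_measure_mono[OF _ Ue]) (auto simp: Z_def)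
      then show "prob Z \<le> 2 * exp (- (real i)\<^sup>2 / (4 * mgf_const p * V))" using Up[of "real i"] by simp
    qed
  qed
  then have "prob Z = 0" using measure_nonneg[of N Z] by linarith
  then have "AE \<omega> in N. \<omega> \<notin> Z" using prob_eq_0[OF Ze] by simp
  then show ?thesis
  proof (rule AE_mp, intro AE_I2 impI)
    fix \<omega> assume w: "\<omega> \<in> space N" "\<omega> \<notin> Z"
    then obtain i :: nat where i: "\<omega> \<notin> U (real i)" unfolding Z_def by blast
    have D: "\<bar>D k \<omega>\<bar> \<le> real i" for k
    proof -
      have "\<omega> \<notin> E (real i) k" using i unfolding U_def by blast
      then show ?thesis using w(1) nb_gt[of k] unfolding E_def by (auto simp: not_le intro: less_imp_le)
    qed
    have X1: "\<bar>X k \<omega>\<bar> = 1" for k by (simp add: X_def sgn_of_def)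
    have Bd0: "0 \<le> Bd" using Bd[of 0] by linarith
    have "\<bar>\<Sum>k=1..n. \<beta> k * X k \<omega>\<bar> \<le> 2 * Bd + 2 * (1 - p) * real i" for n
    proof (cases n)
      case 0
      then show ?thesis using Bd0 p by simp
    next
      case (Suc m)
      have "(\<Sum>i<m. c (Suc i) * (X (i + 2) \<omega> - \<rho> * X (i + 1) \<omega>)) = 2 * (1 - p) * D m \<omega>"
        unfolding D_def sum_distrib_left c'_def using p by (intro sum.cong refl) simp
      then have "(\<Sum>k=1..n. \<beta> k * X k \<omega>) = c 0 * X 1 \<omega> + 2 * (1 - p) * D m \<omega> - \<rho> * c (Suc m) * X (Suc m) \<omega>"
        unfolding Suc using backward_sum[where x = "\<lambda>k. X k \<omega>" and m = m and \<beta> = \<beta> and c = c and \<rho> = \<rho>, OF rec] by simp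
      moreover have "\<bar>c 0 * X 1 \<omega>\<bar> \<le> Bd" using Bd[of 0] by (simp add: abs_mult X1)
      moreover have "\<bar>2 * (1 - p) * D m \<omega>\<bar> \<le> 2 * (1 - p) * real i" using D[of m] p by (simp add: abs_mult)
      moreover have "\<bar>\<rho> * c (Suc m) * X (Suc m) \<omega>\<bar> \<le> Bd"
        using mult_mono[of "\<bar>\<rho>\<bar>" 1 "\<bar>c (Suc m)\<bar>" Bd] \<rho> Bd[of "Suc m"] by (simp add: abs_mult X1)
      ultimately show ?thesis by linarith
    qed
    then show "\<exists>C. \<forall>n. \<bar>\<Sum>k=1..n. \<beta> k * X k \<omega>\<bar> \<le> C" by blast
  qed
qed

text \<open>For monotone weights the total variation telescopes to a difference of two weights,
  which is where the term \<open>\<bar>a n\<bar>\<close> comes from. Square-summable differences are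
  covered by \<open>AE_signed_sum_bounded\<close>.\<close>

lemma AE_residual_bounded:
  assumes "summable (\<lambda>k. (a (k + 2) - a (k + 1))\<^sup>2) \<or> mono_on {1..} a \<or> antimono_on {1..} a"
  shows "AE \<omega> in N. \<exists>C. \<forall>n>nb 0. \<bar>\<Sum>k\<in>{nb 0<..<n}. (a (k + 1) - a k) * X k \<omega>\<bar> \<le> C + \<bar>a n\<bar>"
  using assms
proof (elim disjE)
  assume s: "summable (\<lambda>k. (a (k + 2) - a (k + 1))\<^sup>2)"
  define \<beta> where "\<beta> k = a (k + 1) - a k" for k
  have "summable (\<lambda>k. (\<beta> (Suc k))\<^sup>2)" using s by (simp add: \<beta>_def)
  from AE_signed_sum_bounded[OF this] show ?thesis
  proof (rule AE_mp, intro AE_I2 impI)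
    fix \<omega> assume "\<exists>C. \<forall>n. \<bar>\<Sum>k=1..n. \<beta> k * X k \<omega>\<bar> \<le> C"
    then obtain C where C: "\<And>n. \<bar>\<Sum>k=1..n. \<beta> k * X k \<omega>\<bar> \<le> C" by blast
    have "\<bar>\<Sum>k\<in>{nb 0<..<n}. (a (k + 1) - a k) * X k \<omega>\<bar> \<le> 2 * C + \<bar>a n\<bar>" if n: "n > nb 0" for n
    proof -
      have "{1..n - 1} = {1..nb 0} \<union> {nb 0<..<n}" using n by auto
      then have "(\<Sum>k=1..n - 1. \<beta> k * X k \<omega>) = (\<Sum>k=1..nb 0. \<beta> k * X k \<omega>) + (\<Sum>k\<in>{nb 0<..<n}. \<beta> k * X k \<omega>)"
        by (simp add: sum.union_disjoint disjoint_iff)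
      then show ?thesis using C[of "n - 1"] C[of "nb 0"] unfolding \<beta>_def by linarith
    qed
    then show "\<exists>C. \<forall>n>nb 0. \<bar>\<Sum>k\<in>{nb 0<..<n}. (a (k + 1) - a k) * X k \<omega>\<bar> \<le> C + \<bar>a n\<bar>" by blast
  qed
next
  have main: ?thesis if s: "\<bar>s\<bar> = 1" and mono: "\<And>k. k \<ge> 1 \<Longrightarrow> 0 \<le> s * (a (k + 1) - a k)" for s :: real
  proof (rule AE_I2)
    fix \<omega>
    have X1: "\<bar>X k \<omega>\<bar> = 1" for k by (simp add: X_def sgn_of_def)
    have "\<bar>\<Sum>k\<in>{nb 0<..<n}. (a (k + 1) - a k) * X k \<omega>\<bar> \<le> \<bar>a (nb 0 + 1)\<bar> + \<bar>a n\<bar>" if n: "n > nb 0" for n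
    proof -
      have "\<bar>\<Sum>k\<in>{nb 0<..<n}. (a (k + 1) - a k) * X k \<omega>\<bar> \<le> (\<Sum>k\<in>{nb 0<..<n}. \<bar>(a (k + 1) - a k) * X k \<omega>\<bar>)"
        by (rule sum_abs)
      also have "\<dots> = (\<Sum>k\<in>{nb 0<..<n}. s * (a (k + 1) - a k))"
      proof (rule sum.cong[OF refl])
        fix k assume "k \<in> {nb 0<..<n}"
        then have "0 \<le> s * (a (k + 1) - a k)" by (intro mono) simp
        then have "\<bar>a (k + 1) - a k\<bar> = s * (a (k + 1) - a k)" using s by (metis abs_mult abs_of_nonneg mult_1)
        then show "\<bar>(a (k + 1) - a k) * X k \<omega>\<bar> = s * (a (k + 1) - a k)" by (simp add: abs_mult X1)
      qed
      also have "\<dots> = s * (a n - a (nb 0 + 1))"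
      proof -
        have "{nb 0<..<n} = {Suc (nb 0)..<n}" by auto
        then have "(\<Sum>k\<in>{nb 0<..<n}. a (Suc k) - a k) = a n - a (Suc (nb 0))"
          using sum_Suc_diff'[of "Suc (nb 0)" n a] n by simp
        then show ?thesis by (simp add: sum_distrib_left[symmetric])
      qed
      also have "\<dots> \<le> \<bar>s * (a n - a (nb 0 + 1))\<bar>" by (rule abs_ge_self)
      also have "\<dots> = \<bar>a n - a (nb 0 + 1)\<bar>" using s by (simp add: abs_mult)
      also have "\<dots> \<le> \<bar>a (nb 0 + 1)\<bar> + \<bar>a n\<bar>" by linarith
      finally show ?thesis .
    qed
    then show "\<exists>C. \<forall>n>nb 0. \<bar>\<Sum>k\<in>{nb 0<..<n}. (a (k + 1) - a k) * X k \<omega>\<bar> \<le> C + \<bar>a n\<bar>" by blast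
  qed
  show ?thesis if "mono_on {1..} a"
    by (rule main[of 1]) (use that in \<open>auto simp: monotone_on_def\<close>)
  show ?thesis if "antimono_on {1..} a"
    by (rule main[of "-1"]) (use that in \<open>auto simp: monotone_on_def\<close>)
qed

lemma block_exists:
  assumes "nb j0 < n"
  shows "\<exists>j\<ge>j0. nb j < n \<and> n \<le> nb (Suc j)"
proof -
  define i where "i = (LEAST i. n \<le> nb i)"
  have ex: "n \<le> nb n" using nb_gt[of n] by simp
  have i: "n \<le> nb i" unfolding i_def by (rule LeastI[of _ n]) (rule ex)
  have "i \<noteq> 0" using i assms nb_mono[of 0 j0] by (cases "i = 0") auto
  then obtain j where j: "i = Suc j" by (cases i) auto
  have "\<not> n \<le> nb j" using not_less_Least[of j "\<lambda>i. n \<le> nb i"] j unfolding i_def by simp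
  moreover have "j0 \<le> j"
  proof (rule ccontr)
    assume "\<not> j0 \<le> j"
    then have "i \<le> j0" using j by simp
    then show False using i nb_mono[of i j0] assms by simp
  qed
  ultimately show ?thesis using i j by auto
qed

text \<open>The smaller exponent \<open>\<gamma>'\<close> is the common scale: every summand of
  \<open>approximation_error\<close> is of order \<open>A powr \<gamma>'\<close>, and the gap to
  \<open>\<gamma>\<close> changes this order bound into little-o.\<close>

theorem AE_approximation:
  assumes A: "filterlim (square_sum a) at_top sequentially"
    and t1: "\<And>j. 1 \<le> t j" and \<gamma>: "0 \<le> \<gamma>'" "\<gamma>' < \<gamma>"
    and ab: "\<And>j k. nb j < k \<Longrightarrow> k \<le> nb (Suc j) \<Longrightarrow> \<bar>a k\<bar> \<le> C * t j powr \<gamma>'"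
    and e: "\<And>j b. integrable (normal_measure (sqrt (r * (t (Suc j) - t j)))) (\<lambda>x. \<bar>path_sum p (coef j) b (Q j b x) - x\<bar>)"
      "\<And>j b. (LINT x|normal_measure (sqrt (r * (t (Suc j) - t j))). \<bar>path_sum p (coef j) b (Q j b x) - x\<bar>) \<le> e j"
      "summable (\<lambda>j. t j powr (- \<gamma>') * e j)"
    and s1: "summable (\<lambda>j. exp (- (t j powr \<gamma>')\<^sup>2 / (4 * mgf_const p * (t (Suc j) - t j))))"
    and s2: "summable (\<lambda>j. exp (- (t j powr \<gamma>')\<^sup>2 / (8 * (t (Suc j) - t j))))"
    and reg: "summable (\<lambda>k. (a (k + 2) - a (k + 1))\<^sup>2) \<or> mono_on {1..} a \<or> antimono_on {1..} a"
  shows "AE \<omega> in N. (\<lambda>n. weighted_sum a X n \<omega> - sqrt r * B (square_sum a n) \<omega>) \<in> o(\<lambda>n. square_sum a n powr \<gamma>)"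
proof -
  define \<theta> where "\<theta> j = t j powr \<gamma>'" for j
  have \<theta>1: "1 \<le> \<theta> j" for j unfolding \<theta>_def using t1[of j] \<gamma>(1) by (rule ge_one_powr_ge_zero)
  have \<theta>0: "0 \<le> \<theta> j" "0 < \<theta> j" for j using \<theta>1[of j] by linarith+
  have \<theta>_mono: "i \<le> j \<Longrightarrow> \<theta> i \<le> \<theta> j" for i j
    unfolding \<theta>_def using \<gamma>(1) t_mono[of i j] t_pos[of i] by (intro powr_mono2) auto
  have AE1: "AE \<omega> in N. summable (\<lambda>j. t j powr (- \<gamma>') * \<bar>W j \<omega> - H (Suc j) \<omega>\<bar>)"
    by (rule AE_coupling_summable[OF e(1) e(2) _ e(3)]) simp
  have AE2: "AE \<omega> in N. \<forall>\<^sub>F j in sequentially. \<forall>k\<le>nb (Suc j) - nb j. \<bar>path_sum p (coef j) (last (pre j \<omega>)) (take k (blk j \<omega>))\<bar> < \<theta> j"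
    by (rule AE_block_maximum[OF \<theta>0(1)]) (use s1 in \<open>simp add: \<theta>_def\<close>)
  have AE3: "AE \<omega> in N. \<forall>\<^sub>F j in sequentially. \<forall>n. nb j < n \<and> n \<le> nb (Suc j) \<longrightarrow> \<bar>B (square_sum a n) \<omega> - B (t j) \<omega>\<bar> < \<theta> j"
    by (rule AE_bm_maximum[OF \<theta>0(2)]) (use s2 in \<open>simp add: \<theta>_def\<close>)
  note AE4 = AE_residual_bounded[OF reg]
  show ?thesis using AE1 AE2 AE3 AE4
  proof eventually_elim
    case (elim \<omega>)
    define S where "S = (\<Sum>j. t j powr (- \<gamma>') * \<bar>W j \<omega> - H (Suc j) \<omega>\<bar>)"
    have S0: "0 \<le> S" unfolding S_def by (rule suminf_nonneg[OF elim(1)]) simp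
    \<comment> \<open>As in Kronecker's lemma: \<open>\<theta>\<close> is increasing, so
      \<open>\<theta> j / \<theta> i \<ge> 1\<close> for \<open>i < j\<close>, and the partial sum
      is at most \<open>\<theta> j\<close> times the convergent weighted series.\<close>
    have sumWH: "(\<Sum>i<j. \<bar>W i \<omega> - H (Suc i) \<omega>\<bar>) \<le> S * \<theta> j" for j
    proof -
      have "(\<Sum>i<j. \<bar>W i \<omega> - H (Suc i) \<omega>\<bar>) \<le> (\<Sum>i<j. \<theta> j * (t i powr (- \<gamma>') * \<bar>W i \<omega> - H (Suc i) \<omega>\<bar>))"
      proof (rule sum_mono)
        fix i assume "i \<in> {..<j}"
        then have "\<theta> i \<le> \<theta> j" by (intro \<theta>_mono) simp
        then have "1 \<le> \<theta> j * t i powr (- \<gamma>')"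
          using \<theta>0(2)[of i] by (simp add: powr_minus \<theta>_def[symmetric] field_simps)
        then have "1 * \<bar>W i \<omega> - H (Suc i) \<omega>\<bar> \<le> (\<theta> j * t i powr (- \<gamma>')) * \<bar>W i \<omega> - H (Suc i) \<omega>\<bar>" by (rule mult_right_mono) simp
        then show "\<bar>W i \<omega> - H (Suc i) \<omega>\<bar> \<le> \<theta> j * (t i powr (- \<gamma>') * \<bar>W i \<omega> - H (Suc i) \<omega>\<bar>)" by (simp add: mult.assoc)
      qed
      also have "\<dots> = \<theta> j * (\<Sum>i<j. t i powr (- \<gamma>') * \<bar>W i \<omega> - H (Suc i) \<omega>\<bar>)" by (simp add: sum_distrib_left)
      also have "\<dots> \<le> \<theta> j * S" unfolding S_def
        by (intro mult_left_mono sum_le_suminf[OF elim(1)] \<theta>0) auto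
      finally show ?thesis by (simp add: mult.commute)
    qed
    obtain Rc where Rc: "\<And>n. n > nb 0 \<Longrightarrow> \<bar>\<Sum>k\<in>{nb 0<..<n}. (a (k + 1) - a k) * X k \<omega>\<bar> \<le> Rc + \<bar>a n\<bar>" using elim(4) by blast
    from elim(2,3) have "\<forall>\<^sub>F j in sequentially. (\<forall>k\<le>nb (Suc j) - nb j. \<bar>path_sum p (coef j) (last (pre j \<omega>)) (take k (blk j \<omega>))\<bar> < \<theta> j)
      \<and> (\<forall>n. nb j < n \<and> n \<le> nb (Suc j) \<longrightarrow> \<bar>B (square_sum a n) \<omega> - B (t j) \<omega>\<bar> < \<theta> j)" by (rule eventually_conj)
    then obtain j0 where j0: "\<And>j k. j \<ge> j0 \<Longrightarrow> k \<le> nb (Suc j) - nb j \<Longrightarrow> \<bar>path_sum p (coef j) (last (pre j \<omega>)) (take k (blk j \<omega>))\<bar> < \<theta> j"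
      "\<And>j n. j \<ge> j0 \<Longrightarrow> nb j < n \<Longrightarrow> n \<le> nb (Suc j) \<Longrightarrow> \<bar>B (square_sum a n) \<omega> - B (t j) \<omega>\<bar> < \<theta> j"
      unfolding eventually_sequentially by blast
    define C0 where "C0 = \<bar>weighted_sum a X (nb 0) \<omega>\<bar> + sqrt r * \<bar>B (t 0) \<omega>\<bar>"
    define C1 where "C1 = \<bar>a (nb 0 + 1)\<bar> + \<bar>Rc\<bar>"
    define K where "K = C0 + S + 1 + sqrt r + \<bar>kap\<bar> * (2 * C + C1)"
    have C00: "0 \<le> C0" "0 \<le> C1" using r_pos by (simp_all add: C0_def C1_def)
    have bound: "\<bar>weighted_sum a X n \<omega> - sqrt r * B (square_sum a n) \<omega>\<bar> \<le> K * square_sum a n powr \<gamma>'" if n: "n > nb j0" for n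
    proof -
      obtain j where j: "j \<ge> j0" "nb j < n" "n \<le> nb (Suc j)" using block_exists[OF n] by blast
      define P where "P = \<bar>path_sum p (coef j) (last (pre j \<omega>)) (take (n - nb j) (blk j \<omega>))\<bar>"
      define Bd where "Bd = \<bar>B (square_sum a n) \<omega> - B (t j) \<omega>\<bar>"
      define R where "R = \<bar>\<Sum>k\<in>{nb 0<..<n}. (a (k + 1) - a k) * X k \<omega>\<bar>"
      define an where "an = \<bar>a n\<bar>"
      define Rc' where "Rc' = \<bar>Rc\<bar>"
      define a0 where "a0 = \<bar>a (nb 0 + 1)\<bar>"
      have nn0: "n > nb 0" using j nb_mono[of 0 j] by simp
      have "\<bar>weighted_sum a X n \<omega> - sqrt r * B (square_sum a n) \<omega>\<bar> \<le> C0 + (\<Sum>i<j. \<bar>W i \<omega> - H (Suc i) \<omega>\<bar>) + P + sqrt r * Bd + \<bar>kap\<bar> * (an + a0 + R)"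
        unfolding C0_def P_def Bd_def R_def an_def a0_def by (rule approximation_error[OF j(2,3)])
      also have "\<dots> \<le> C0 * \<theta> j + S * \<theta> j + \<theta> j + sqrt r * \<theta> j + \<bar>kap\<bar> * ((2 * C + C1) * \<theta> j)"
      proof (intro add_mono)
        show "C0 \<le> C0 * \<theta> j" using mult_left_mono[OF \<theta>1[of j] C00(1)] by simp
        show "P \<le> \<theta> j" unfolding P_def by (rule less_imp_le, rule j0(1)[OF j(1)]) (use j(3) in simp)
        have "Bd \<le> \<theta> j" using j0(2)[OF j] by (simp add: Bd_def)
        then show "sqrt r * Bd \<le> sqrt r * \<theta> j" using r_pos by (intro mult_left_mono) auto
        have "an \<le> C * \<theta> j" unfolding an_def \<theta>_def by (rule ab[OF j(2,3)])
        moreover have "R \<le> Rc' + an" using Rc[OF nn0] abs_ge_self[of Rc] unfolding R_def Rc'_def an_def by linarith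
        moreover have "a0 + Rc' \<le> C1 * \<theta> j"
          using mult_left_mono[OF \<theta>1[of j] C00(2)] unfolding C1_def a0_def Rc'_def by simp
        ultimately have "an + a0 + R \<le> (2 * C + C1) * \<theta> j" by (simp add: algebra_simps)
        then show "\<bar>kap\<bar> * (an + a0 + R) \<le> \<bar>kap\<bar> * ((2 * C + C1) * \<theta> j)" by (rule mult_left_mono) simp
      qed (rule sumWH)
      also have "\<dots> = K * \<theta> j" by (simp add: K_def algebra_simps)
      also have "\<dots> \<le> \<bar>K\<bar> * \<theta> j" by (rule mult_right_mono[OF abs_ge_self \<theta>0(1)])
      finally have b1: "\<bar>weighted_sum a X n \<omega> - sqrt r * B (square_sum a n) \<omega>\<bar> \<le> \<bar>K\<bar> * \<theta> j" .
      have "\<theta> j \<le> square_sum a n powr \<gamma>'"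
        unfolding \<theta>_def using \<gamma>(1) t_pos[of j] square_sum_mono[of "nb j" n a] j by (intro powr_mono2) (auto simp: t_def)
      moreover have "\<bar>K\<bar> = K"
      proof -
        have "0 \<le> C * \<theta> j" using ab[OF j(2,3)] abs_ge_zero[of "a n"] unfolding \<theta>_def by linarith
        then have "0 \<le> C" using \<theta>0(2)[of j] by (simp add: zero_le_mult_iff)
        then have "0 \<le> K" unfolding K_def using C00 S0 r_pos by (intro add_nonneg_nonneg mult_nonneg_nonneg) auto
        then show ?thesis by simp
      qed
      ultimately show ?thesis using order_trans[OF b1 mult_left_mono[of "\<theta> j" "square_sum a n powr \<gamma>'" "\<bar>K\<bar>"]] by simp
    qed
    have "(\<lambda>n. weighted_sum a X n \<omega> - sqrt r * B (square_sum a n) \<omega>) \<in> O(\<lambda>n. square_sum a n powr \<gamma>')"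
    proof (rule landau_o.bigI[of "\<bar>K\<bar> + 1"])
      show "\<forall>\<^sub>F n in sequentially. norm (weighted_sum a X n \<omega> - sqrt r * B (square_sum a n) \<omega>) \<le> (\<bar>K\<bar> + 1) * norm (square_sum a n powr \<gamma>')"
        using eventually_gt_at_top[of "nb j0"]
      proof eventually_elim
        case (elim n)
        have "K * square_sum a n powr \<gamma>' \<le> (\<bar>K\<bar> + 1) * square_sum a n powr \<gamma>'" by (rule mult_right_mono) auto
        then show ?case using bound[OF elim] by simp
      qed
    qed simp
    also have "(\<lambda>n. square_sum a n powr \<gamma>') \<in> o(\<lambda>n. square_sum a n powr \<gamma>)"
      using powr_smallo_iff[OF A] \<gamma>(2) by simp
    finally show ?case .
  qed
qed

end

section \<open>Strong approximation\<close>

lemma summable_exp_neg_powr: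
  fixes c s :: real
  assumes "c > 0" "s > 0"
  shows "summable (\<lambda>j. exp (- (c * real j powr s)))"
proof (rule summable_comparison_test_bigo)
  show "summable (\<lambda>j. norm (1 / real j ^ 2))"
    using inverse_power_summable[of 2] by (simp add: divide_inverse)
  show "(\<lambda>j. exp (- (c * real j powr s))) \<in> O(\<lambda>j. 1 / real j ^ 2)"
    using assms by real_asymp
qed

theorem theorem2p5:
  fixes M :: "'a measure" and X :: "nat \<Rightarrow> 'a \<Rightarrow> real"
    and a :: "nat \<Rightarrow> real" and p \<delta> :: real
  assumes "0 < p" and "p < 1"
    and "sign_markov_chain M p X"
    and "filterlim (square_sum a) at_top sequentially"
    and "0 < \<delta>" and "\<delta> \<le> 1"
    and "(\<lambda>n. (a n)\<^sup>2) \<in> O(\<lambda>n. square_sum a n powr (1 - \<delta>))"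
    and "summable (\<lambda>k. (a (k + 2) - a (k + 1))\<^sup>2) \<or> mono_on {1..} a \<or> antimono_on {1..} a"
  shows "\<exists>(N :: (nat \<Rightarrow> real) measure) S' B.
           prob_space N \<and>
           same_process_law N S' M (weighted_sum a X) \<and>
           standard_brownian_motion N B \<and>
           (AE \<omega> in N.
              (\<lambda>n. S' n \<omega> - sqrt (p / (1 - p)) * B (square_sum a n) \<omega>)
                \<in> o(\<lambda>n. square_sum a n powr (1 / 2 - \<delta> / 16)))"
proof -
  note p = assms(1,2) and \<delta> = assms(5,6)
  \<comment> \<open>A smoothing scale \<open>h = t powr \<eta>\<close> bounds the coupling error of a block ending at time about \<open>t\<close> by
    \<open>4 h + O(h powr -2 * t powr ((1 - \<delta>) / 2 + 1 - \<beta>))\<close>. The requirements are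
    \<open>(1 - \<delta>) / 2 + 1 - \<beta> \<le> 3 \<eta>\<close> for the second term, \<open>\<eta> - \<gamma>' < - \<beta>\<close> for the summability of the errors
    over the blocks, and \<open>2 \<gamma>' > 1 - \<beta>\<close> for the oscillation inside the blocks.\<close>
  define \<beta> where "\<beta> = 9 * \<delta> / 64"
  define \<gamma> where "\<gamma> = 1 / 2 - \<delta> / 16"
  \<comment> \<open>The shifts by \<open>\<delta> / 256\<close> in \<open>\<gamma>'\<close> and
    \<open>\<eta>\<close> provide the slack for strict inequalities. Counted in units of
    \<open>\<delta> / 256\<close>, the requirements then confine \<open>\<beta>\<close> to values
    above 34 and at most 37; the choice above is 36.\<close>
  define \<gamma>' where "\<gamma>' = \<gamma> - \<delta> / 256"
  define \<eta> where "\<eta> = \<gamma>' - \<beta> - \<delta> / 256"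
  have \<beta>: "0 < \<beta>" "\<beta> \<le> \<delta>" using \<delta> by (simp_all add: \<beta>_def)
  have \<gamma>: "0 \<le> \<gamma>'" "\<gamma>' < \<gamma>" using \<delta> by (simp_all add: \<gamma>_def \<gamma>'_def)
  from block_structure[OF assms(4) \<delta> \<beta> assms(7)] obtain nb C where bs:
    "strict_mono nb \<and> 1 \<le> nb 0 \<and> 0 < C \<and> (\<forall>j. 1 \<le> square_sum a (nb j)) \<and>
    (\<forall>j. real j \<le> square_sum a (nb j) powr \<beta>) \<and>
    (\<forall>j. square_sum a (nb j) < square_sum a (nb (Suc j))) \<and>
    (\<forall>j. square_sum a (nb (Suc j)) - square_sum a (nb j) \<le> C * square_sum a (nb j) powr (1 - \<beta>)) \<and>
    (\<forall>j k. nb j < k \<and> k \<le> nb (Suc j) \<longrightarrow> \<bar>a k\<bar> \<le> C * square_sum a (nb j) powr ((1 - \<delta>) / 2))"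
    by (elim exE)
  define t where "t j = square_sum a (nb j)" for j
  have nb: "strict_mono nb" "1 \<le> nb 0" and C: "0 < C" and t1: "\<And>j. 1 \<le> t j" and jt: "\<And>j. real j \<le> t j powr \<beta>"
    and inc: "\<And>j. t j < t (Suc j)" and V: "\<And>j. t (Suc j) - t j \<le> C * t j powr (1 - \<beta>)"
    and ab: "\<And>j k. nb j < k \<Longrightarrow> k \<le> nb (Suc j) \<Longrightarrow> \<bar>a k\<bar> \<le> C * t j powr ((1 - \<delta>) / 2)"
    using bs unfolding t_def by simp_all
  define m where "m j = nb (Suc j) - nb j" for j
  define coef where "coef j i = a (nb j + 1 + i)" for j i
  have nb_less: "nb j < nb (Suc j)" for j using nb(1) by (simp add: strict_mono_Suc_iff)
  have sum_coef: "(\<Sum>i<m j. (coef j i)\<^sup>2) = t (Suc j) - t j" for j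
  proof -
    have "{1..nb (Suc j)} = {1..nb j} \<union> {nb j<..nb j + m j}" using nb_less[of j] by (auto simp: m_def)
    then have "t (Suc j) = t j + (\<Sum>k\<in>{nb j<..nb j + m j}. (a k)\<^sup>2)"
      unfolding t_def square_sum_def by (simp add: sum.union_disjoint disjoint_iff)
    then show ?thesis unfolding sum_greaterThanAtMost_shift by (simp add: coef_def)
  qed
  define L where "L = lindeberg_const p"
  have L: "0 \<le> L" unfolding L_def by (rule lindeberg_const_nonneg[OF p])
  define K where "K = 4 + 2 * L * C\<^sup>2"
  have K: "0 \<le> K" using L by (simp add: K_def)
  define e where "e j = K * t j powr \<eta>" for j
  have e_bound: "4 * (t j powr \<eta>) + 2 / (t j powr \<eta>)\<^sup>2 * L * (\<Sum>i<m j. \<bar>coef j i\<bar> ^ 3) \<le> e j" for j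
  proof -
    have tp: "t j > 0" using t1[of j] by linarith
    \<comment> \<open>One factor of each cube is estimated by the bound on the coefficients, and the
      two others add up to the variance of the block.\<close>
    have "(\<Sum>i<m j. \<bar>coef j i\<bar> ^ 3) \<le> (\<Sum>i<m j. C * t j powr ((1 - \<delta>) / 2) * (coef j i)\<^sup>2)"
    proof (rule sum_mono)
      fix i assume "i \<in> {..<m j}"
      then have "\<bar>coef j i\<bar> \<le> C * t j powr ((1 - \<delta>) / 2)" unfolding coef_def by (intro ab) (auto simp: m_def)
      then have "\<bar>coef j i\<bar> * (coef j i)\<^sup>2 \<le> C * t j powr ((1 - \<delta>) / 2) * (coef j i)\<^sup>2" by (rule mult_right_mono) simp
      then show "\<bar>coef j i\<bar> ^ 3 \<le> C * t j powr ((1 - \<delta>) / 2) * (coef j i)\<^sup>2" by (simp add: power3_eq_cube power2_eq_square mult.assoc abs_mult_self_eq)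
    qed
    also have "\<dots> = C * t j powr ((1 - \<delta>) / 2) * (t (Suc j) - t j)" by (simp add: sum_distrib_left[symmetric] sum_coef)
    also have "\<dots> \<le> C * t j powr ((1 - \<delta>) / 2) * (C * t j powr (1 - \<beta>))"
      using C V[of j] by (intro mult_left_mono) auto
    also have "\<dots> = C\<^sup>2 * t j powr ((1 - \<delta>) / 2 + (1 - \<beta>))" by (simp add: powr_add power2_eq_square)
    finally have "2 / (t j powr \<eta>)\<^sup>2 * L * (\<Sum>i<m j. \<bar>coef j i\<bar> ^ 3) \<le> 2 / (t j powr \<eta>)\<^sup>2 * L * (C\<^sup>2 * t j powr ((1 - \<delta>) / 2 + (1 - \<beta>)))"
      using L by (intro mult_left_mono) auto
    also have "\<dots> = 2 * L * C\<^sup>2 * (t j powr ((1 - \<delta>) / 2 + (1 - \<beta>)) / (t j powr \<eta>)\<^sup>2)" by simp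
    also have "t j powr ((1 - \<delta>) / 2 + (1 - \<beta>)) / (t j powr \<eta>)\<^sup>2 = t j powr ((1 - \<delta>) / 2 + (1 - \<beta>) - 2 * \<eta>)"
      using tp by (simp add: powr_diff powr_power mult.commute)
    also have "2 * L * C\<^sup>2 * t j powr ((1 - \<delta>) / 2 + (1 - \<beta>) - 2 * \<eta>) \<le> 2 * L * C\<^sup>2 * t j powr \<eta>"
    proof (intro mult_left_mono powr_mono)
      show "(1 - \<delta>) / 2 + (1 - \<beta>) - 2 * \<eta> \<le> \<eta>"
        using \<delta> unfolding \<eta>_def \<gamma>'_def \<gamma>_def \<beta>_def by (simp add: field_simps)
    qed (use L t1[of j] in auto)
    finally show ?thesis by (simp add: e_def K_def algebra_simps)
  qed
  define \<sigma> where "\<sigma> j = sqrt (p / (1 - p) * (t (Suc j) - t j))" for j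
  define G where "G j b Q \<longleftrightarrow> (\<forall>x. length (Q x) = m j) \<and>
    (\<forall>l. length l = m j \<longrightarrow> {x. Q x = l} \<in> sets borel \<and> measure (normal_measure (\<sigma> j)) {x. Q x = l} = path_weight p b l) \<and>
    integrable (normal_measure (\<sigma> j)) (\<lambda>x. \<bar>path_sum p (coef j) b (Q x) - x\<bar>) \<and>
    (\<forall>h>0. (LINT x|normal_measure (\<sigma> j). \<bar>path_sum p (coef j) b (Q x) - x\<bar>)
       \<le> 4 * h + 2 / h\<^sup>2 * L * (\<Sum>i<m j. \<bar>coef j i\<bar> ^ 3))" for j b and Q :: "real \<Rightarrow> bool list"
  have exG: "\<exists>Q. G j b Q" for j b
  proof -
    have "0 < (\<Sum>i<m j. (coef j i)\<^sup>2)" unfolding sum_coef using inc[of j] by simp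
    from path_coupling[OF p this, of b] show ?thesis
      unfolding G_def sum_coef \<sigma>_def L_def .
  qed
  define Q where "Q j b = (SOME Q. G j b Q)" for j b
  have G: "G j b (Q j b)" for j b unfolding Q_def by (rule someI_ex[OF exG])
  define \<sigma>0 where "\<sigma>0 = sqrt (p / (1 - p) * t 0)"
  have \<sigma>0: "0 < \<sigma>0" unfolding \<sigma>0_def using p t1[of 0] by simp
  have ne: "paths (nb 0) \<noteq> {}" unfolding paths_def using Ex_list_of_length[of "nb 0"] by auto
  have cw: "0 \<le> chain_weight p l" for l using chain_weight_pos[OF p, of l] by simp
  \<comment> \<open>Only the law matters for the signs up to \<open>nb 0\<close>, so they are
    ordered by a constant function: their contribution to the error is a fixed random variable,
    bounded along each path.\<close>
  from quantile_map[OF \<sigma>0 finite_paths ne cw sum_chain_weight, of "\<lambda>_. 0"]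
  obtain Q0 where Q0: "(\<forall>x. Q0 x \<in> paths (nb 0)) \<and> mono (\<lambda>x :: real. 0 :: real) \<and>
    (\<forall>l\<in>paths (nb 0). {x. Q0 x = l} \<in> sets borel \<and> measure (normal_measure \<sigma>0) {x. Q0 x = l} = chain_weight p l)" ..
  define B where "B s \<omega> = levy_path (gauss_array \<omega>) s" for s \<omega>
  have BM: "standard_brownian_motion gauss_space B"
    using standard_brownian_motion_exists unfolding B_def[abs_def] .
  interpret bc: block_coupling gauss_space B p a nb Q0 Q
  proof
    show "0 < square_sum a (nb 0)" using t1[of 0] by (simp add: t_def)
    show "square_sum a (nb j) < square_sum a (nb (Suc j))" for j using inc[of j] by (simp add: t_def)
    show "length (Q0 x) = nb 0" for x using Q0 by (simp add: paths_def)
    show "{x. Q0 x = l} \<in> sets borel" if "length l = nb 0" for l using Q0 that by (simp add: paths_def)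
    show "measure (normal_measure (sqrt (p / (1 - p) * square_sum a (nb 0)))) {x. Q0 x = l} = chain_weight p l"
      if "length l = nb 0" for l using Q0 that unfolding \<sigma>0_def t_def by (simp add: paths_def)
    show "length (Q j b x) = nb (Suc j) - nb j" for j b x using G[of j b] by (simp add: G_def m_def)
    show "{x. Q j b x = l} \<in> sets borel" if "length l = nb (Suc j) - nb j" for j b l
      using G[of j b] that by (simp add: G_def m_def)
    show "measure (normal_measure (sqrt (p / (1 - p) * (square_sum a (nb (Suc j)) - square_sum a (nb j))))) {x. Q j b x = l} = path_weight p b l"
      if "length l = nb (Suc j) - nb j" for j b l
      using G[of j b] that unfolding G_def \<sigma>_def t_def m_def by blast
  qed (use BM p nb in simp_all)
  have bt: "bc.t = t" by (simp add: fun_eq_iff bc.t_def t_def)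
  have bcoef: "bc.coef = coef" by (simp add: fun_eq_iff bc.coef_def coef_def)
  have b\<sigma>: "sqrt (bc.r * (t (Suc j) - t j)) = \<sigma> j" for j by (simp add: bc.r_def \<sigma>_def)
  have tp: "0 < t j" for j using t1[of j] by linarith
  have tpow: "real j powr u \<le> t j powr (\<beta> * u)" if "u \<ge> 0" for j u
  proof -
    have "real j powr u \<le> (t j powr \<beta>) powr u" by (rule powr_mono2) (use that jt in auto)
    then show ?thesis by (simp add: powr_powr)
  qed
  have exp_sum: "summable (\<lambda>j. exp (- (t j powr \<gamma>')\<^sup>2 / (k * (t (Suc j) - t j))))" if k: "k > 0" for k
  proof (rule summable_comparison_test')
    have "1 / (k * C) > 0" using k C by simp
    then show "summable (\<lambda>j. exp (- (1 / (k * C) * real j powr (1 / 18))))" by (rule summable_exp_neg_powr) simp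
    fix j :: nat
    have "1 / (k * C) * real j powr (1 / 18) \<le> 1 / (k * C) * t j powr (\<beta> * (1 / 18))"
      using k C tpow[of "1 / 18" j] by (intro mult_left_mono) auto
    \<comment> \<open>Both sides equal \<open>\<delta> / 128\<close>, the margin by which
      \<open>2 * \<gamma>'\<close> exceeds \<open>1 - \<beta>\<close>.\<close>
    also have "\<beta> * (1 / 18) = 2 * \<gamma>' - (1 - \<beta>)" by (simp add: \<beta>_def \<gamma>'_def \<gamma>_def)
    also have "1 / (k * C) * t j powr (2 * \<gamma>' - (1 - \<beta>)) = (t j powr \<gamma>')\<^sup>2 / (k * (C * t j powr (1 - \<beta>)))"
      using tp[of j] by (simp add: powr_diff powr_power mult.commute)
    also have "\<dots> \<le> (t j powr \<gamma>')\<^sup>2 / (k * (t (Suc j) - t j))"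
      using k C V[of j] inc[of j] tp[of j] by (intro divide_left_mono mult_left_mono mult_pos_pos) auto
    finally show "norm (exp (- (t j powr \<gamma>')\<^sup>2 / (k * (t (Suc j) - t j)))) \<le> exp (- (1 / (k * C) * real j powr (1 / 18)))" by simp
  qed
  have e_sum: "summable (\<lambda>j. t j powr (- \<gamma>') * e j)"
  proof (rule summable_comparison_test')
    have "summable (\<lambda>j. real j powr (- (37 / 36)))" by (simp add: summable_real_powr_iff)
    then show "summable (\<lambda>j. K * real j powr (- (37 / 36)))" by (rule summable_mult)
    fix j :: nat assume "1 \<le> j"
    then have j: "real j > 0" by simp
    have "t j powr (- \<gamma>') * e j = K * t j powr (\<eta> - \<gamma>')"
      by (simp add: e_def powr_add[symmetric])
    \<comment> \<open>The slack \<open>\<delta> / 256\<close> is \<open>\<beta> / 36\<close>; it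
      lifts the exponent of \<open>j\<close> above 1 and makes the series converge.\<close>
    also have "\<eta> - \<gamma>' = - (\<beta> * (37 / 36))" by (simp add: \<eta>_def \<beta>_def)
    also have "t j powr (- (\<beta> * (37 / 36))) \<le> real j powr (- (37 / 36))"
      using tpow[of "37 / 36" j] j tp[of j] by (simp add: powr_minus le_imp_inverse_le)
    then have "K * t j powr (- (\<beta> * (37 / 36))) \<le> K * real j powr (- (37 / 36))" using K by (rule mult_left_mono)
    finally have "t j powr (- \<gamma>') * e j \<le> K * real j powr (- (37 / 36))" .
    moreover have "0 \<le> t j powr (- \<gamma>') * e j" using K by (simp add: e_def)
    ultimately show "norm (t j powr (- \<gamma>') * e j) \<le> K * real j powr (- (37 / 36))" by simp
  qed
  have "AE \<omega> in gauss_space. (\<lambda>n. weighted_sum a bc.X n \<omega> - sqrt bc.r * B (square_sum a n) \<omega>) \<in> o(\<lambda>n. square_sum a n powr \<gamma>)"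
  proof (rule bc.AE_approximation[OF assms(4) _ \<gamma>])
    show "1 \<le> bc.t j" for j unfolding bt by (rule t1)
    show "\<bar>a k\<bar> \<le> C * bc.t j powr \<gamma>'" if "nb j < k" "k \<le> nb (Suc j)" for j k
    proof -
      have "C * t j powr ((1 - \<delta>) / 2) \<le> C * t j powr \<gamma>'"
        using C t1[of j] \<delta> by (intro mult_left_mono powr_mono) (auto simp: \<gamma>'_def \<gamma>_def)
      then show ?thesis unfolding bt using ab[OF that] by linarith
    qed
    show "integrable (normal_measure (sqrt (bc.r * (bc.t (Suc j) - bc.t j)))) (\<lambda>x. \<bar>path_sum p (bc.coef j) b (Q j b x) - x\<bar>)" for j b
      unfolding bt bcoef b\<sigma> using G[of j b] unfolding G_def by blast
    show "(LINT x|normal_measure (sqrt (bc.r * (bc.t (Suc j) - bc.t j))). \<bar>path_sum p (bc.coef j) b (Q j b x) - x\<bar>) \<le> e j" for j b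
    proof -
      have "0 < t j powr \<eta>" using tp[of j] by simp
      then have "(LINT x|normal_measure (\<sigma> j). \<bar>path_sum p (coef j) b (Q j b x) - x\<bar>)
         \<le> 4 * (t j powr \<eta>) + 2 / (t j powr \<eta>)\<^sup>2 * L * (\<Sum>i<m j. \<bar>coef j i\<bar> ^ 3)"
        using G[of j b] unfolding G_def by blast
      then show ?thesis unfolding bt bcoef b\<sigma> using e_bound[of j] by linarith
    qed
    show "summable (\<lambda>j. bc.t j powr (- \<gamma>') * e j)" unfolding bt by (rule e_sum)
    show "summable (\<lambda>j. exp (- (bc.t j powr \<gamma>')\<^sup>2 / (4 * mgf_const p * (bc.t (Suc j) - bc.t j))))"
      unfolding bt by (rule exp_sum) (use mgf_const_ge_1[of p] in linarith)
    show "summable (\<lambda>j. exp (- (bc.t j powr \<gamma>')\<^sup>2 / (8 * (bc.t (Suc j) - bc.t j))))"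
      unfolding bt by (rule exp_sum) simp
  qed (rule assms(8))
  then have "prob_space gauss_space \<and> same_process_law gauss_space (weighted_sum a bc.X) M (weighted_sum a X) \<and>
    standard_brownian_motion gauss_space B \<and>
    (AE \<omega> in gauss_space. (\<lambda>n. weighted_sum a bc.X n \<omega> - sqrt (p / (1 - p)) * B (square_sum a n) \<omega>)
                \<in> o(\<lambda>n. square_sum a n powr (1 / 2 - \<delta> / 16)))"
    unfolding bc.r_def \<gamma>_def
    by (intro conjI gauss.prob_space_axioms bc.weighted_sum_X_same_law[OF assms(3)] BM)
  then show ?thesis
    by - (rule exI[of _ gauss_space], rule exI[of _ "weighted_sum a bc.X"], rule exI[of _ B])
qed

end
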